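(* Let $\{\mathcal{H}_{\bar a}\}_{\bar a\ge 0}$ be the family of minimal helicoids in the hyperboloid model $\mathbf{H}^3$ of hyperbolic $3$-space described in the context. There exists a constant $\bar a_c=\coth(a_c)\approx 2.17968$, where $a_c\approx 0.49577$ is the constant described in the context, such that the following statements are true: (1) $\mathcal{H}_{\bar a}$ is a globally stable minimal surface if $0\le\bar a\le\bar a_c$; and (2) $\mathcal{H}_{\bar a}$ is an unstable minimal surface with Morse index infinity if $\bar a>\bar a_c$.
   Context: **Ambient space.** On $\mathbb{R}^4$ take the Lorentzian inner product $\langle x,y\rangle=-x_1y_1+x_2y_2+x_3y_3+x_4y_4$; the hyperboloid model is $\mathbf{H}^3=\{x\in\mathbb{R}^4:\langle x,x\rangle=-1,\ x_1\ge 1\}$ with the induced Riemannian metric. **Helicoids.** For $\bar a\ge 0$, $$\mathcal{H}_{\bar a}=\{(\cosh u\cosh v,\ \cosh u\sinh v,\ \sinh u\cos(\bar a v),\ \sinh u\sin(\bar a v)) : u,v\in\mathbb{R}\}\subset\mathbf{H}^3,$$ which is a complete embedded minimal surface. **The constant $a_c$.** $a_c$ is the unique critical number in $(0,\infty)$ of the function $$\varrho(a)=\int_a^\infty\frac{\sinh(2a)}{\cosh t}\,\frac{dt}{\sqrt{\sinh^2(2t)-\sinh^2(2a)}},\qquad a>0.$$ **Stability.** For a minimal surface $\Sigma$ in a Riemannian $3$-manifold $M^3$ with unit normal $e_3$ and second fundamental form $A$, the Jacobi operator is $\mathcal{L}=\Delta_\Sigma+(|A|^2+\mathrm{Ric}(e_3))$.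 For a compact connected subdomain $\Omega\subset\Sigma$, $\lambda_1(\Omega)=\inf\{-\int_\Omega f\mathcal{L}f : f\in C_0^\infty(\Omega),\ \int_\Omega f^2=1\}$. For complete $\Sigma$, $\lambda_1(\Sigma)=\lim_{n\to\infty}\lambda_1(\Omega_n)$ for any exhaustion $\Omega_1\subset\Omega_2\subset\cdots$ of $\Sigma$ by such subdomains (independent of the exhaustion). $\Sigma$ is globally stable if $\lambda_1(\Sigma)>0$, and unstable if $\lambda_1(\Sigma)<0$. **Morse index.** The Morse index of a compact connected subdomain $\Omega$ is the number of negative eigenvalues, with multiplicity, of the Jacobi operator $\mathcal{L}$ (that is, of the associated quadratic form $-\int_\Omega f\mathcal{L}f$) on smooth normal sections vanishing on $\partial\Omega$. The Morse index of $\Sigma$ is the supremum of the Morse indices of its compact subdomains.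
   Formalization: At ā = ā_c the first eigenvalue of the helicoid is 0, so strict global stability fails there; it is claimed only for ā < ā_c, and at ā_c: λ₁ ≥ 0 with λ₁(Ω) > 0 on every compact subdomain. As coth(a_c) ≈ 2.17966, the value 2.17968 is stated within 5·10⁻⁵. *)

theory Defs
  imports "HOL-Analysis.Analysis" "HOL-Library.Extended_Nat" "HOL-Library.Extended_Real"
begin

section \<open>Smooth maps and Riemannian metrics in coordinates\<close>

definition pd :: "'n \<Rightarrow> (real^'n \<Rightarrow> 'b) \<Rightarrow> real^'n \<Rightarrow> 'b::real_normed_vector" where
  "pd i f p = vector_derivative (\<lambda>t. f (p + t *\<^sub>R axis i 1)) (at 0)"

primrec iter_pd :: "'n list \<Rightarrow> (real^'n \<Rightarrow> 'b) \<Rightarrow> real^'n \<Rightarrow> 'b::real_normed_vector" where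
  "iter_pd [] f = f"
| "iter_pd (i # is) f = pd i (iter_pd is f)"

definition smooth :: "(real^'n \<Rightarrow> 'b::real_normed_vector) \<Rightarrow> bool" where
  "smooth f \<longleftrightarrow> (\<forall>is p. iter_pd is f differentiable at p)"

text \<open>A metric in coordinates is a matrix-valued function \<open>G\<close>.\<close>

definition christoffel ::
  "(real^'n \<Rightarrow> real^'n^'n) \<Rightarrow> 'n \<Rightarrow> 'n \<Rightarrow> 'n \<Rightarrow> real^'n \<Rightarrow> real" where
  "christoffel G k i j p = (1/2) * (\<Sum>l\<in>UNIV. matrix_inv (G p) $ k $ l *
     (pd i (\<lambda>q. G q $ j $ l) p + pd j (\<lambda>q. G q $ i $ l) p - pd l (\<lambda>q. G q $ i $ j) p))"

text \<open>\<open>ricci G p $ j $ k\<close> is the Ricci tensor, with the sign for which round spheres are positive.\<close>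

definition ricci :: "(real^'n \<Rightarrow> real^'n^'n) \<Rightarrow> real^'n \<Rightarrow> real^'n^'n" where
  "ricci G p = (\<chi> j k. \<Sum>i\<in>UNIV.
      pd i (christoffel G i j k) p - pd j (christoffel G i i k) p
      + (\<Sum>l\<in>UNIV. christoffel G i i l p * christoffel G l j k p
                  - christoffel G i j l p * christoffel G l i k p))"

definition laplacian :: "(real^'n \<Rightarrow> real^'n^'n) \<Rightarrow> (real^'n \<Rightarrow> real) \<Rightarrow> real^'n \<Rightarrow> real" where
  "laplacian G f p = (1 / sqrt (det (G p))) *
     (\<Sum>i\<in>UNIV. pd i (\<lambda>q. sqrt (det (G q)) * (\<Sum>j\<in>UNIV. matrix_inv (G q) $ i $ j * pd j f q)) p)"


section \<open>The hyperboloid model\<close>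

definition lorentz :: "real^4 \<Rightarrow> real^4 \<Rightarrow> real" where
  "lorentz x y = - x$1 * y$1 + x$2 * y$2 + x$3 * y$3 + x$4 * y$4"

definition hyperboloid :: "(real^4) set" where
  "hyperboloid = {x. lorentz x x = -1 \<and> x$1 \<ge> 1}"

definition induced_metric :: "(real^'n \<Rightarrow> real^4) \<Rightarrow> real^'n \<Rightarrow> real^'n^'n" where
  "induced_metric \<Phi> p = (\<chi> i j. lorentz (pd i \<Phi> p) (pd j \<Phi> p))"

text \<open>The hyperboloid is the graph of \<open>hyp_chart\<close>; the inverse of this global
  parametrization is the linear projection \<open>hyp_coords\<close>, which therefore also gives the
  coordinates of tangent vectors.\<close>

definition hyp_chart :: "real^3 \<Rightarrow> real^4" where
  "hyp_chart y = vector [sqrt (1 + y \<bullet> y), y$1, y$2, y$3]"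

definition hyp_coords :: "real^4 \<Rightarrow> real^3" where
  "hyp_coords x = vector [x$2, x$3, x$4]"

definition ric_hyp :: "real^4 \<Rightarrow> real^4 \<Rightarrow> real" where
  "ric_hyp x n = hyp_coords n \<bullet> (ricci (induced_metric hyp_chart) (hyp_coords x) *v hyp_coords n)"


section \<open>Minimal surfaces in the hyperboloid\<close>

text \<open>A surface \<open>\<Sigma>\<close> diffeomorphic to the plane is given by a global parametrization
  \<open>X :: real^2 \<Rightarrow> real^4\<close>, and functions on \<open>\<Sigma>\<close> and subsets of \<open>\<Sigma>\<close> are expressed in the parameter plane.

  The unit normal is determined up to sign at each point; it enters below only through
  expressions that are even in it.\<close>

definition unit_normal :: "(real^2 \<Rightarrow> real^4) \<Rightarrow> real^2 \<Rightarrow> real^4" where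
  "unit_normal X p = (SOME n. lorentz n n = 1 \<and> lorentz n (X p) = 0 \<and> (\<forall>i. lorentz n (pd i X p) = 0))"

text \<open>The Levi-Civita connection of the hyperboloid is the tangential part of the flat one, and
  the normal \<open>n\<close> is orthogonal to the position vector, so that
  \<open>A(X\<^sub>i, X\<^sub>j) = \<langle>\<nabla>\<^bsub>X\<^sub>i\<^esub> X\<^sub>j, n\<rangle> = \<langle>\<partial>\<^sub>i\<partial>\<^sub>j X, n\<rangle>\<close>.\<close>

definition second_form :: "(real^2 \<Rightarrow> real^4) \<Rightarrow> real^2 \<Rightarrow> real^2^2" where
  "second_form X p = (\<chi> i j. lorentz (pd i (pd j X) p) (unit_normal X p))"

definition mean_curvature :: "(real^2 \<Rightarrow> real^4) \<Rightarrow> real^2 \<Rightarrow> real" where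
  "mean_curvature X p =
     (\<Sum>i\<in>UNIV. \<Sum>j\<in>UNIV. matrix_inv (induced_metric X p) $ i $ j * second_form X p $ i $ j)"

definition second_form_sq :: "(real^2 \<Rightarrow> real^4) \<Rightarrow> real^2 \<Rightarrow> real" where
  "second_form_sq X p =
     (let h = second_form X p; g = matrix_inv (induced_metric X p) in
      \<Sum>i\<in>UNIV. \<Sum>j\<in>UNIV. \<Sum>k\<in>UNIV. \<Sum>l\<in>UNIV. g $ i $ k * g $ j $ l * h $ i $ j * h $ k $ l)"

definition minimal_surface :: "(real^2 \<Rightarrow> real^4) \<Rightarrow> bool" where
  "minimal_surface X \<longleftrightarrow>
     smooth X \<and> range X \<subseteq> hyperboloid \<and>
     (\<forall>p. inj (frechet_derivative X (at p))) \<and>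
     (\<exists>Y. homeomorphism UNIV (range X) X Y) \<and>
     (\<forall>p. mean_curvature X p = 0)"

definition jacobi_op :: "(real^2 \<Rightarrow> real^4) \<Rightarrow> (real^2 \<Rightarrow> real) \<Rightarrow> real^2 \<Rightarrow> real" where
  "jacobi_op X f p = laplacian (induced_metric X) f p
     + (second_form_sq X p + ric_hyp (X p) (unit_normal X p)) * f p"

definition surface_integral :: "(real^2 \<Rightarrow> real^4) \<Rightarrow> (real^2) set \<Rightarrow> (real^2 \<Rightarrow> real) \<Rightarrow> real" where
  "surface_integral X \<Omega> f = (LINT p:\<Omega>|lborel. f p * sqrt (det (induced_metric X p)))"


section \<open>Stability and Morse index\<close>

definition compact_subdomain :: "(real^2) set \<Rightarrow> bool" where
  "compact_subdomain \<Omega> \<longleftrightarrow>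
     compact \<Omega> \<and> connected (interior \<Omega>) \<and> closure (interior \<Omega>) = \<Omega> \<and> \<Omega> \<noteq> {}"

definition test_functions :: "(real^2) set \<Rightarrow> (real^2 \<Rightarrow> real) set" where
  "test_functions \<Omega> = {f. smooth f \<and> closure {p. f p \<noteq> 0} \<subseteq> interior \<Omega>}"

definition first_eigenvalue_on :: "(real^2 \<Rightarrow> real^4) \<Rightarrow> (real^2) set \<Rightarrow> real" where
  "first_eigenvalue_on X \<Omega> =
     Inf {- surface_integral X \<Omega> (\<lambda>p. f p * jacobi_op X f p) | f.
            f \<in> test_functions \<Omega> \<and> surface_integral X \<Omega> (\<lambda>p. (f p)\<^sup>2) = 1}"

definition exhaustion :: "(nat \<Rightarrow> (real^2) set) \<Rightarrow> bool" where
  "exhaustion \<Omega> \<longleftrightarrow>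
     (\<forall>n. compact_subdomain (\<Omega> n) \<and> \<Omega> n \<subseteq> interior (\<Omega> (Suc n))) \<and> (\<Union>n. \<Omega> n) = UNIV"

text \<open>The limit is taken in the extended reals because it may be \<open>-\<infinity>\<close> for a general surface.\<close>

definition first_eigenvalue :: "(real^2 \<Rightarrow> real^4) \<Rightarrow> ereal" where
  "first_eigenvalue X =
     (THE l. \<forall>\<Omega>. exhaustion \<Omega> \<longrightarrow> (\<lambda>n. ereal (first_eigenvalue_on X (\<Omega> n))) \<longlonglongrightarrow> l)"

text \<open>For the helicoid with \<open>abar = coth a_crit\<close> the limit is exactly \<open>0\<close>: the Jacobi field coming
  from the variation of the conjugate catenoids is then positive and decays. So that helicoid is not
  globally stable in the strict sense below, although \<open>first_eigenvalue_on\<close> is positive on each of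
  its compact subdomains.\<close>

definition globally_stable :: "(real^2 \<Rightarrow> real^4) \<Rightarrow> bool" where
  "globally_stable X \<longleftrightarrow> first_eigenvalue X > 0"

definition unstable :: "(real^2 \<Rightarrow> real^4) \<Rightarrow> bool" where
  "unstable X \<longleftrightarrow> first_eigenvalue X < 0"

text \<open>\<open>\<mu>\<close> is an eigenvalue for the quadratic form \<open>- \<integral> f \<L> f\<close>, that is of \<open>- \<L>\<close>.
  Smoothness up to the boundary means having a smooth extension to the plane, and only the
  values of \<open>f\<close> on \<open>\<Omega>\<close> matter.\<close>

definition dirichlet_eigenfunction ::
  "(real^2 \<Rightarrow> real^4) \<Rightarrow> (real^2) set \<Rightarrow> real \<Rightarrow> (real^2 \<Rightarrow> real) \<Rightarrow> bool" where
  "dirichlet_eigenfunction X \<Omega> \<mu> f \<longleftrightarrow>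
     smooth f \<and> (\<forall>p\<in>frontier \<Omega>. f p = 0) \<and> (\<forall>p\<in>interior \<Omega>. - jacobi_op X f p = \<mu> * f p)"

text \<open>Eigenfunctions for distinct eigenvalues being independent, the number of negative
  eigenvalues with multiplicity is the maximal size of a system of eigenfunctions for
  negative eigenvalues (repetitions of \<open>\<mu> i\<close> allowed) that is linearly independent on \<open>\<Omega>\<close>.\<close>

definition morse_index_on :: "(real^2 \<Rightarrow> real^4) \<Rightarrow> (real^2) set \<Rightarrow> enat" where
  "morse_index_on X \<Omega> =
     Sup {enat n | n. \<exists>(\<mu> :: nat \<Rightarrow> real) f.
            (\<forall>i<n. \<mu> i < 0 \<and> dirichlet_eigenfunction X \<Omega> (\<mu> i) (f i)) \<and>
            (\<forall>c :: nat \<Rightarrow> real. (\<forall>p\<in>\<Omega>. (\<Sum>i<n. c i * f i p) = 0) \<longrightarrow> (\<forall>i<n. c i = 0))}"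

definition morse_index :: "(real^2 \<Rightarrow> real^4) \<Rightarrow> enat" where
  "morse_index X = (SUP \<Omega>\<in>{\<Omega>. compact_subdomain \<Omega>}. morse_index_on X \<Omega>)"


section \<open>Helicoids and the critical constant\<close>

text \<open>The coordinates \<open>p$1\<close>, \<open>p$2\<close> are \<open>u\<close>, \<open>v\<close>; the helicoid is the range of this map.\<close>

definition helicoid :: "real \<Rightarrow> real^2 \<Rightarrow> real^4" where
  "helicoid abar p = vector
     [cosh (p$1) * cosh (p$2), cosh (p$1) * sinh (p$2),
      sinh (p$1) * cos (abar * p$2), sinh (p$1) * sin (abar * p$2)]"

definition rho :: "real \<Rightarrow> real" where
  "rho a = (LBINT t=ereal a..\<infinity>.
     sinh (2*a) / cosh t * (1 / sqrt ((sinh (2*t))\<^sup>2 - (sinh (2*a))\<^sup>2)))"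

definition critical_number :: "(real \<Rightarrow> real) \<Rightarrow> real \<Rightarrow> bool" where
  "critical_number f a \<longleftrightarrow> (f has_real_derivative 0) (at a)"

definition a_crit :: real where
  "a_crit = (THE a. a > 0 \<and> critical_number rho a)"

definition coth :: "real \<Rightarrow> real" where
  "coth x = cosh x / sinh x"

end

theory Submission
  imports Defs
begin

text \<open>
  In the coordinates \<open>u\<close>, \<open>v\<close> the helicoid with parameter \<open>A\<close> has the metric \<open>du\<^sup>2 + w(u)\<^sup>2 dv\<^sup>2\<close> with
  \<open>w\<^sup>2 = cosh\<^sup>2 u + A\<^sup>2 sinh\<^sup>2 u\<close>, and its Jacobi operator is \<open>L f = ((w f\<^sub>u)\<^sub>u + (f\<^sub>v / w)\<^sub>v) / w - V f\<close> with
  \<open>V = 2 - 2 A\<^sup>2 / w\<^sup>4\<close> (\<open>helicoid_jacobi_op\<close>). All coefficients depend on \<open>u\<close> alone, so stability is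
  decided by the functions of \<open>u\<close> annihilated by \<open>L\<close>. One of them, \<open>sinh u cosh u / w\<close>, is odd and comes from the
  translations along the axis. Reduction of order gives the even one, \<open>jac\<close>, explicitly up to an
  elliptic integral. Its quotient by the odd one is strictly decreasing on \<open>u > 0\<close> and tends to
  \<open>- ell_complete A\<close>, a complete elliptic integral. Hence \<open>jac\<close> is positive if \<open>ell_complete A \<le> 0\<close>
  and negative somewhere if \<open>ell_complete A > 0\<close>. As \<open>ell_complete\<close> is strictly increasing on \<open>[0, \<infinity>)\<close>, there
  is at most one parameter at which the behaviour changes.

  Suppose that \<open>jac\<close> is positive. The logarithmic derivative of a positive solution solves a Riccati
  equation, and completing the square shows that the second variation is nonnegative. To gain a
  spectral gap, \<open>jac\<close> is multiplied by a slowly decreasing factor (\<open>riccati_subsolution\<close>,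
  \<open>energy_lower_bound\<close>). The gap is governed by the ratio of \<open>\<integral> w jac\<^sup>2\<close> to \<open>w jac\<^sup>2\<close>. This ratio is bounded on
  bounded ranges of \<open>u\<close>, which gives a positive first eigenvalue on each compact subdomain; it is
  bounded globally if \<open>ell_complete A < 0\<close>, because then \<open>jac\<close> grows like the odd solution, and this gives
  global stability.

  Suppose that \<open>jac\<close> is negative at some \<open>R\<close>. Then a shooting argument on \<open>[- R, R]\<close> produces eigenfunctions
  \<open>\<phi>(u) sin (\<kappa> v)\<close> with a negative eigenvalue for every sufficiently small frequency \<open>\<kappa>\<close>
  (\<open>negative_eigenfunctions\<close>). A long rectangle has room for arbitrarily many such frequencies, so the
  index is infinite, and truncating a single eigenfunction near the boundary shows that the first
  eigenvalue is negative (\<open>first_eigenvalue_on_neg\<close>).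

  It remains to identify the zero of \<open>ell_complete\<close>. A substitution turns \<open>rho a\<close> into a complete elliptic
  integral depending on \<open>coth a\<close>, whose derivative is a nonvanishing factor times \<open>ell_complete (coth a)\<close>
  (\<open>rho_coth_deriv\<close>); so \<open>a\<close> is critical for \<open>rho\<close> iff \<open>ell_complete (coth a) = 0\<close>. A power series that
  converges geometrically, evaluated in fixed-point arithmetic, encloses the zero.
\<close>

section \<open>Partial derivatives and smooth functions\<close>

lemma has_derivative_pd:
  assumes "(f has_derivative f') (at p)"
  shows "pd i f p = f' (axis i 1)"
proof -
  have "((\<lambda>t. p + t *\<^sub>R axis i 1) has_derivative (\<lambda>t. t *\<^sub>R axis i 1)) (at (0::real))"
    by (auto intro!: derivative_eq_intros)
  moreover have "(f has_derivative f') (at (p + 0 *\<^sub>R axis i (1::real)))"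
    using assms by simp
  ultimately have "((\<lambda>t. f (p + t *\<^sub>R axis i 1)) has_derivative (\<lambda>t. f' (t *\<^sub>R axis i 1))) (at 0)"
    by (rule has_derivative_compose)
  moreover have "f' (t *\<^sub>R axis i 1) = t *\<^sub>R f' (axis i 1)" for t :: real
    using has_derivative_linear[OF assms] by (simp add: linear_scale)
  ultimately have "((\<lambda>t. f (p + t *\<^sub>R axis i 1)) has_vector_derivative f' (axis i 1)) (at 0)"
    by (simp add: has_vector_derivative_def)
  then show ?thesis
    unfolding pd_def by (rule vector_derivative_at)
qed

lemma pd_frechet:
  assumes "f differentiable at p"
  shows "pd i f p = frechet_derivative f (at p) (axis i 1)"
  using assms has_derivative_pd frechet_derivative_works by blast

lemma pd_add:
  assumes "f differentiable at p" "g differentiable at p"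
  shows "pd i (\<lambda>q. f q + g q) p = pd i f p + pd i g p"
  using has_derivative_pd[OF has_derivative_add[OF assms[unfolded frechet_derivative_works]], of i]
  by (simp add: pd_frechet assms)

lemma pd_mult:
  fixes f g :: "real^'n \<Rightarrow> real"
  assumes "f differentiable at p" "g differentiable at p"
  shows "pd i (\<lambda>q. f q * g q) p = f p * pd i g p + pd i f p * g p"
  using has_derivative_pd[OF has_derivative_mult[OF assms[unfolded frechet_derivative_works]], of i]
  by (simp add: pd_frechet assms)

lemma pd_const [simp]: "pd i (\<lambda>q. c) p = 0"
  using has_derivative_pd[OF has_derivative_const] by blast

lemma pd_compose:
  fixes f :: "real^'n \<Rightarrow> real" and g :: "real \<Rightarrow> real"
  assumes "f differentiable at p" "(g has_real_derivative D) (at (f p))"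
  shows "pd i (\<lambda>q. g (f q)) p = D * pd i f p" "(\<lambda>q. g (f q)) differentiable at p"
proof -
  have "((\<lambda>q. g (f q)) has_derivative (\<lambda>h. D * frechet_derivative f (at p) h)) (at p)"
    using has_derivative_compose[OF assms(1)[unfolded frechet_derivative_works]
        assms(2)[unfolded has_field_derivative_def]] by simp
  from has_derivative_pd[OF this, of i] this
  show "pd i (\<lambda>q. g (f q)) p = D * pd i f p" "(\<lambda>q. g (f q)) differentiable at p"
    by (simp_all add: pd_frechet[OF assms(1)] differentiableI)
qed

lemma coord_differentiable: "(\<lambda>q::real^'n. q $ j) differentiable at p"
  by (intro bounded_linear_imp_differentiable bounded_linear_vec_nth)

lemma pd_coord: "pd i (\<lambda>q::real^'n. q $ j) p = (if i = j then 1 else 0)"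
proof -
  have "((\<lambda>q::real^'n. q $ j) has_derivative (\<lambda>q. q $ j)) (at p)"
    by (intro bounded_linear_imp_has_derivative bounded_linear_vec_nth)
  from has_derivative_pd[OF this] show ?thesis by (simp add: axis_def)
qed

lemma pd_of_coord:
  fixes g :: "real \<Rightarrow> real" and p :: "real^'n"
  assumes "(g has_real_derivative D) (at (p $ j))"
  shows "pd i (\<lambda>q. g (q $ j)) p = (if i = j then D else 0)"
    and "(\<lambda>q. g (q $ j)) differentiable at p"
  using pd_compose[OF coord_differentiable assms] by (simp_all add: pd_coord)

lemma smooth_differentiable: "smooth f \<Longrightarrow> f differentiable at p"
  unfolding smooth_def using iter_pd.simps(1) by metis

lemma iter_pd_append: "iter_pd (xs @ ys) f = iter_pd xs (iter_pd ys f)"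
  by (induction xs) auto

lemma smooth_iff_pd: "smooth f \<longleftrightarrow> (\<forall>p. f differentiable at p) \<and> (\<forall>i. smooth (pd i f))"
proof
  assume f: "smooth f"
  have "iter_pd is (pd i f) = iter_pd (is @ [i]) f" for "is" i
    by (simp add: iter_pd_append)
  with f show "(\<forall>p. f differentiable at p) \<and> (\<forall>i. smooth (pd i f))"
    using smooth_differentiable unfolding smooth_def by metis
next
  assume f: "(\<forall>p. f differentiable at p) \<and> (\<forall>i. smooth (pd i f))"
  show "smooth f"
    unfolding smooth_def
  proof (intro allI)
    fix "is" p
    show "iter_pd is f differentiable at p"
    proof (cases "is" rule: rev_cases)
      case (snoc js i)
      then show ?thesis using f by (simp add: iter_pd_append smooth_def)
    qed (use f in simp)
  qed
qed

lemma smooth_pd: "smooth f \<Longrightarrow> smooth (pd i f)"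
  using smooth_iff_pd by blast

lemma smooth_continuous: "smooth f \<Longrightarrow> continuous_on S f"
  by (intro continuous_at_imp_continuous_on ballI differentiable_imp_continuous_within
      smooth_differentiable)

text \<open>Smoothness as defined quantifies over all iterated partial derivatives. To verify it for a concrete
  function one exhibits a set of differentiable generators whose partial derivatives are polynomials in
  the generators; the algebra they generate is then stable under every iterated derivative.\<close>

inductive_set function_algebra :: "(real^'n \<Rightarrow> real) set \<Rightarrow> (real^'n \<Rightarrow> real) set" for B where
  base: "b \<in> B \<Longrightarrow> b \<in> function_algebra B"
| const: "(\<lambda>p. c) \<in> function_algebra B"
| add: "f \<in> function_algebra B \<Longrightarrow> g \<in> function_algebra B \<Longrightarrow> (\<lambda>p. f p + g p) \<in> function_algebra B"
| mult: "f \<in> function_algebra B \<Longrightarrow> g \<in> function_algebra B \<Longrightarrow> (\<lambda>p. f p * g p) \<in> function_algebra B"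

lemma function_algebra_smooth:
  assumes B: "\<And>b p. b \<in> B \<Longrightarrow> b differentiable at p"
    and pdB: "\<And>b i. b \<in> B \<Longrightarrow> pd i b \<in> function_algebra B"
    and f: "f \<in> function_algebra B"
  shows "smooth f"
proof -
  have step: "(\<forall>p. f differentiable at p) \<and> (\<forall>i. pd i f \<in> function_algebra B)"
    if "f \<in> function_algebra B" for f
    using that
  proof induction
    case (base b)
    then show ?case using B pdB by blast
  next
    case (const c)
    have "pd i (\<lambda>p. c) = (\<lambda>p. 0)" for i by (rule ext) simp
    then show ?case by (simp add: function_algebra.const)
  next
    case (add f g)
    have "pd i (\<lambda>p. f p + g p) = (\<lambda>p. pd i f p + pd i g p)" for i
      by (rule ext) (rule pd_add; use add in blast)
    then show ?case using add by (simp add: function_algebra.add)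
  next
    case (mult f g)
    have "pd i (\<lambda>p. f p * g p) = (\<lambda>p. f p * pd i g p + pd i f p * g p)" for i
      by (rule ext) (rule pd_mult; use mult in blast)
    then show ?case using mult by (simp add: function_algebra.add function_algebra.mult)
  qed
  have "iter_pd is f \<in> function_algebra B" for "is"
    by (induction "is") (use f step in auto)
  then show ?thesis unfolding smooth_def using step by blast
qed

lemma smooth_function_algebra: "f \<in> function_algebra {f. smooth f} \<Longrightarrow> smooth f"
  by (rule function_algebra_smooth) (auto simp: smooth_differentiable smooth_pd function_algebra.base)

lemma smooth_const: "smooth (\<lambda>p::real^'n. c::real)"
  by (rule smooth_function_algebra) (rule function_algebra.const)

lemma smooth_add: "smooth f \<Longrightarrow> smooth g \<Longrightarrow> smooth (\<lambda>p::real^'n. f p + g p :: real)"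
  by (intro smooth_function_algebra function_algebra.intros) auto

lemma smooth_mult: "smooth f \<Longrightarrow> smooth g \<Longrightarrow> smooth (\<lambda>p::real^'n. f p * g p :: real)"
  by (intro smooth_function_algebra function_algebra.intros) auto

lemma smooth_coord: "smooth (\<lambda>p::real^'n. p $ j)"
proof -
  have "pd i (\<lambda>p::real^'n. p $ j) = (\<lambda>p. if i = j then 1 else 0)" for i
    by (rule ext) (rule pd_coord)
  then show ?thesis
    by (subst smooth_iff_pd) (auto simp: coord_differentiable smooth_const)
qed

text \<open>The sequence \<open>g\<close> lists the successive derivatives of the outer function.\<close>

lemma smooth_compose:
  fixes f :: "real^'n \<Rightarrow> real" and g :: "nat \<Rightarrow> real \<Rightarrow> real"
  assumes f: "smooth f" and g: "\<And>n x. (g n has_real_derivative g (Suc n) x) (at x)"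
  shows "smooth (\<lambda>p. g n (f p))"
proof (rule function_algebra_smooth[of "{h. smooth h} \<union> range (\<lambda>n p. g n (f p))"])
  let ?B = "{h. smooth h} \<union> range (\<lambda>n p. g n (f p))"
  have pd: "pd i (\<lambda>p. g n (f p)) p = g (Suc n) (f p) * pd i f p" "(\<lambda>p. g n (f p)) differentiable at p" for n i p
    using pd_compose[OF smooth_differentiable[OF f] g] by auto
  show "b differentiable at p" if "b \<in> ?B" for b p
    using that smooth_differentiable pd(2) by auto
  have "(\<lambda>p. g (Suc n) (f p) * pd i f p) \<in> function_algebra ?B" for i n
    by (intro function_algebra.intros) (use smooth_pd[OF f] in auto)
  moreover have "pd i (\<lambda>p. g n (f p)) = (\<lambda>p. g (Suc n) (f p) * pd i f p)" for i n
    by (rule ext) (rule pd(1))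
  ultimately show "pd i b \<in> function_algebra ?B" if "b \<in> ?B" for b i
    using that by (auto intro: function_algebra.base smooth_pd)
qed (auto intro: function_algebra.base)

lemma pd_cong_open:
  assumes "open U" "p \<in> U" "\<And>q. q \<in> U \<Longrightarrow> f q = g q"
  shows "pd i f p = pd i g p"
proof -
  have "((\<lambda>t. p + t *\<^sub>R axis i 1) \<longlongrightarrow> p + 0 *\<^sub>R axis i 1) (at (0::real))"
    by (intro tendsto_intros)
  from topological_tendstoD[OF this assms(1)]
  have "eventually (\<lambda>t. p + t *\<^sub>R axis i 1 \<in> U) (at (0::real))"
    using assms(2) by simp
  then have "eventually (\<lambda>t. f (p + t *\<^sub>R axis i 1) = g (p + t *\<^sub>R axis i 1)) (nhds (0::real))"
    using assms(2,3) by (auto simp: eventually_at_filter elim: eventually_mono)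
  then show ?thesis
    unfolding pd_def by (intro vector_derivative_cong_eq) (auto elim: eventually_mono)
qed

text \<open>Iterated partial derivatives at a point only see a neighbourhood of it; this is used to extend
  functions by zero.\<close>

lemma smooth_local:
  assumes "\<And>p. \<exists>U g. open U \<and> p \<in> U \<and> smooth g \<and> (\<forall>q\<in>U. f q = g q)"
  shows "smooth f"
  unfolding smooth_def
proof (intro allI)
  fix "is" p
  obtain U g where U: "open U" "p \<in> U" "smooth g" "\<And>q. q \<in> U \<Longrightarrow> f q = g q"
    using assms by metis
  have "\<forall>q\<in>U. iter_pd is f q = iter_pd is g q"
  proof (induction "is")
    case (Cons i "is")
    then show ?case by (auto intro: pd_cong_open[OF U(1)])
  qed (use U in auto)
  moreover have "iter_pd is g differentiable at p" using U(3) smooth_def by blast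
  ultimately show "iter_pd is f differentiable at p"
    using U(1,2) has_derivative_transform_within_open[of "iter_pd is g" _ p UNIV U "iter_pd is f"]
    unfolding differentiable_def by auto
qed

lemma differentiable_components:
  fixes f :: "real^'n \<Rightarrow> real^'m"
  assumes "\<And>k. (\<lambda>q. f q $ k) differentiable at p"
  shows "f differentiable at p"
proof -
  have "(\<lambda>q. \<Sum>k\<in>UNIV. f q $ k *\<^sub>R axis k (1::real)) differentiable at p"
    using assms by (intro differentiable_sum differentiable_scaleR) auto
  moreover have "(\<Sum>k\<in>UNIV. f q $ k *\<^sub>R axis k (1::real)) = f q" for q
    using basis_expansion[of "f q"] by (simp add: scalar_mult_eq_scaleR)
  ultimately show ?thesis by simp
qed

lemma pd_component:
  fixes f :: "real^'n \<Rightarrow> real^'m"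
  assumes "f differentiable at p"
  shows "pd i f p $ k = pd i (\<lambda>q. f q $ k) p"
proof -
  have "((\<lambda>q. f q $ k) has_derivative (\<lambda>h. frechet_derivative f (at p) h $ k)) (at p)"
    using assms[unfolded frechet_derivative_works]
    by (rule bounded_linear.has_derivative[OF bounded_linear_vec_nth])
  from has_derivative_pd[OF this] show ?thesis
    by (simp add: pd_frechet[OF assms])
qed

lemma smooth_components:
  fixes f :: "real^'n \<Rightarrow> real^'m"
  assumes "\<And>k. smooth (\<lambda>p. f p $ k)"
  shows "smooth f"
  unfolding smooth_def
proof (intro allI)
  fix "is" p
  show "iter_pd is f differentiable at p"
    using assms
  proof (induction "is" arbitrary: f rule: rev_induct)
    case Nil
    then show ?case by (simp add: differentiable_components smooth_differentiable)
  next
    case (snoc i "is")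
    have "(\<lambda>p. pd i f p $ k) = pd i (\<lambda>p. f p $ k)" for k
      by (rule ext) (intro pd_component differentiable_components smooth_differentiable snoc.prems)
    then have "smooth (\<lambda>p. pd i f p $ k)" for k
      using snoc.prems smooth_pd by metis
    from snoc.IH[OF this] show ?case by (simp add: iter_pd_append)
  qed
qed

section \<open>A flat function and the divergence theorem\<close>

text \<open>For \<open>k = 0\<close> this is the standard function that is smooth and vanishes to infinite order at \<open>0\<close>.
  The powers of \<open>1 / t\<close> are carried along because they occur in its derivatives: the family is closed
  under differentiation.\<close>

definition flat_exp :: "nat \<Rightarrow> real \<Rightarrow> real" where
  "flat_exp k t = (if t > 0 then (1 / t) ^ k * exp (- (1 / t)) else 0)"

lemma flat_exp_nonneg: "flat_exp k t \<ge> 0"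
  by (simp add: flat_exp_def)

lemma flat_exp_tendsto_0: "(flat_exp k \<longlongrightarrow> 0) (at 0)"
proof -
  have "((\<lambda>t. (inverse t) ^ k / exp (inverse t)) \<longlongrightarrow> 0) (at_right (0::real))"
    by (rule filterlim_compose[OF tendsto_power_div_exp_0 filterlim_inverse_at_top_right])
  then have "(flat_exp k \<longlongrightarrow> 0) (at_right 0)"
    by (rule Lim_transform_eventually)
      (auto simp: eventually_at_filter flat_exp_def inverse_eq_divide exp_minus field_simps)
  moreover have "(flat_exp k \<longlongrightarrow> 0) (at_left 0)"
    by (rule Lim_transform_eventually[OF tendsto_const]) (auto simp: eventually_at_filter flat_exp_def)
  ultimately show ?thesis by (simp add: filterlim_at_split)
qed

lemma flat_exp_deriv:
  "(flat_exp k has_real_derivative flat_exp (k + 2) t - k * flat_exp (k + 1) t) (at t)"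
proof -
  consider "t > 0" | "t < 0" | "t = 0" by linarith
  then show ?thesis
  proof cases
    case 1
    have "((\<lambda>t. (1 / t) ^ k * exp (- (1 / t))) has_real_derivative
        (1 / t) ^ k * (exp (- (1/t)) * (1 / t^2)) - k * (1 / t) ^ (k + 1) * exp (- (1/t))) (at t)"
    proof (cases k)
      case 0
      then show ?thesis using 1
        by (auto intro!: derivative_eq_intros simp: power2_eq_square)
    next
      case (Suc j)
      have inv: "((\<lambda>t. 1 / t) has_real_derivative - 1 / t\<^sup>2) (at t)"
        using 1 by (auto intro!: derivative_eq_intros simp: power2_eq_square)
      have "((\<lambda>t. exp (- (1 / t))) has_real_derivative exp (- (1 / t)) * (1 / t\<^sup>2)) (at t)"
        using DERIV_chain2[OF DERIV_exp DERIV_minus[OF inv]] by simp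
      from DERIV_mult[OF DERIV_power_Suc[OF inv, of j] this] show ?thesis
        unfolding Suc by (simp add: power2_eq_square algebra_simps)
    qed
    then have "((\<lambda>t. (1 / t) ^ k * exp (- (1 / t))) has_real_derivative
        flat_exp (k + 2) t - k * flat_exp (k + 1) t) (at t)"
      using 1 by (simp add: flat_exp_def power2_eq_square mult_ac power_add)
    then show ?thesis
      by (rule has_field_derivative_transform_within_open[of _ _ _ "{0<..}"])
        (use 1 in \<open>auto simp: flat_exp_def\<close>)
  next
    case 2
    have "((\<lambda>t. 0) has_real_derivative 0) (at t)" by simp
    then have "(flat_exp k has_real_derivative 0) (at t)"
      by (rule has_field_derivative_transform_within_open[of _ _ _ "{..<0}"])
        (use 2 in \<open>auto simp: flat_exp_def\<close>)
    then show ?thesis using 2 by (simp add: flat_exp_def)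
  next
    case 3
    have "((\<lambda>h. (flat_exp k (0 + h) - flat_exp k 0) / h) \<longlongrightarrow> 0) (at 0)"
      by (rule Lim_transform_eventually[OF flat_exp_tendsto_0[of "k + 1"]])
        (auto simp: eventually_at_filter flat_exp_def)
    then have "(flat_exp k has_real_derivative 0) (at 0)"
      by (simp only: DERIV_def)
    then show ?thesis using 3 by (simp add: flat_exp_def)
  qed
qed

lemma smooth_flat_exp:
  fixes f :: "real^'n \<Rightarrow> real"
  assumes f: "smooth f"
  shows "smooth (\<lambda>p. flat_exp k (f p))"
proof (rule function_algebra_smooth[of "{h. smooth h} \<union> range (\<lambda>k p. flat_exp k (f p))"])
  let ?B = "{h. smooth h} \<union> range (\<lambda>k p. flat_exp k (f p))"
  have pd: "pd i (\<lambda>p. flat_exp k (f p)) p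
      = (flat_exp (k + 2) (f p) + - real k * flat_exp (k + 1) (f p)) * pd i f p"
    "(\<lambda>p. flat_exp k (f p)) differentiable at p" for k i p
    using pd_compose[OF smooth_differentiable[OF f] flat_exp_deriv[of k]] by auto
  show "b differentiable at p" if "b \<in> ?B" for b p
    using that smooth_differentiable pd(2) by auto
  have "(\<lambda>p. (flat_exp (k + 2) (f p) + - real k * flat_exp (k + 1) (f p)) * pd i f p)
      \<in> function_algebra ?B" for i k
    by (intro function_algebra.intros) (use smooth_pd[OF f] in auto)
  moreover have "pd i (\<lambda>p. flat_exp k (f p))
      = (\<lambda>p. (flat_exp (k + 2) (f p) + - real k * flat_exp (k + 1) (f p)) * pd i f p)" for i k
    by (rule ext) (rule pd(1))
  ultimately show "pd i b \<in> function_algebra ?B" if "b \<in> ?B" for b i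
    using that by (auto intro: function_algebra.base smooth_pd)
qed (auto intro: function_algebra.base)

lemma pd_outside:
  assumes "closed K" "\<And>p. p \<notin> K \<Longrightarrow> F p = 0" "p \<notin> K"
  shows "pd i F p = 0"
proof -
  have "pd i F p = pd i (\<lambda>q. 0) p"
    using assms by (intro pd_cong_open[of "- K"]) auto
  then show ?thesis by simp
qed

lemma integrable_compact_support:
  fixes f :: "'a::euclidean_space \<Rightarrow> real"
  assumes "compact K" "continuous_on UNIV f" "\<And>p. p \<notin> K \<Longrightarrow> f p = 0"
  shows "integrable lborel f"
proof -
  have "integrable lborel (\<lambda>x. indicator K x *\<^sub>R f x)"
    using assms by (intro borel_integrable_compact) (auto intro: continuous_on_subset)
  also have "(\<lambda>x. indicator K x *\<^sub>R f x) = f"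
    using assms(3) by (intro ext) (force simp: indicator_def)
  finally show ?thesis .
qed

lemma pd_line_deriv:
  fixes F :: "real^'n \<Rightarrow> real"
  assumes "\<And>p. F differentiable at p"
  shows "((\<lambda>t. F (p + t *\<^sub>R axis i 1)) has_real_derivative pd i F (p + t *\<^sub>R axis i 1)) (at t)"
proof -
  let ?D = "frechet_derivative F (at (p + t *\<^sub>R axis i 1))"
  have "((\<lambda>t. p + t *\<^sub>R axis i 1) has_derivative (\<lambda>t. t *\<^sub>R axis i 1)) (at t)"
    by (auto intro!: derivative_eq_intros)
  moreover have D: "(F has_derivative ?D) (at (p + t *\<^sub>R axis i 1))"
    using assms frechet_derivative_works by blast
  ultimately have "((\<lambda>t. F (p + t *\<^sub>R axis i 1)) has_derivative (\<lambda>t. ?D (t *\<^sub>R axis i 1))) (at t)"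
    by (rule has_derivative_compose)
  moreover have "?D (s *\<^sub>R axis i 1) = pd i F (p + t *\<^sub>R axis i 1) * s" for s :: real
    using has_derivative_linear[OF D] by (simp add: linear_scale pd_frechet assms)
  ultimately show ?thesis
    by (simp add: has_field_derivative_def)
qed

text \<open>The divergence theorem without boundary. The integral of a difference quotient in a coordinate
  direction vanishes by translation invariance of Lebesgue measure, and the difference quotients
  converge to the partial derivative with an integrable bound from the mean value theorem.\<close>

lemma integral_pd_eq_0:
  fixes F :: "real^'n \<Rightarrow> real"
  assumes diff: "\<And>p. F differentiable at p" and cont: "continuous_on UNIV (pd i F)"
    and K: "compact K" "\<And>p. p \<notin> K \<Longrightarrow> F p = 0"
  shows "integrable lborel (pd i F)" "(LINT p|lborel. pd i F p) = 0"
proof -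
  note out = pd_outside[OF compact_imp_closed[OF K(1)] K(2)]
  show int: "integrable lborel (pd i F)"
    by (rule integrable_compact_support[OF K(1) cont]) (rule out)
  have contF: "continuous_on UNIV F"
    by (intro continuous_at_imp_continuous_on ballI differentiable_imp_continuous_within diff)
  have intF: "integrable lborel F"
    by (rule integrable_compact_support[OF K(1) contF K(2)])
  obtain r where r: "K \<subseteq> cball 0 r"
    using compact_imp_bounded[OF K(1)] unfolding bounded_iff subset_iff mem_cball_0 by blast
  have "compact (pd i F ` K)"
    by (intro compact_continuous_image continuous_on_subset[OF cont] K(1)) auto
  then have "bounded (pd i F ` K)"
    by (rule compact_imp_bounded)
  then obtain M where M: "\<And>p. p \<in> K \<Longrightarrow> \<bar>pd i F p\<bar> \<le> M"
    unfolding bounded_iff by auto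
  define M' where "M' = max M 0"
  have M': "\<bar>pd i F p\<bar> \<le> M'" for p
    using M[of p] out[where p = p and i = i] unfolding M'_def by (cases "p \<in> K") auto
  \<comment> \<open>Step widths at most \<open>1\<close>, so that the difference quotients vanish outside \<open>cball 0 (r + 1)\<close>.\<close>
  define h where "h n = 1 / real (Suc n)" for n
  have h: "h n > 0" "h n \<le> 1" for n by (auto simp: h_def)
  have h0: "h \<longlonglongrightarrow> 0" unfolding h_def by (rule LIMSEQ_Suc[OF lim_1_over_n])
  define s where "s n p = (F (p + h n *\<^sub>R axis i 1) - F p) / h n" for n p
  have s_bound: "norm (s n p) \<le> M' * indicator (cball 0 (r + 1)) p" for n p
  proof (cases "p \<in> cball 0 (r + 1)")
    case True
    obtain t where "F (p + h n *\<^sub>R axis i 1) - F (p + 0 *\<^sub>R axis i 1)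
        = (h n - 0) * pd i F (p + t *\<^sub>R axis i 1)"
      using MVT2[OF h(1)[of n], where f = "\<lambda>t. F (p + t *\<^sub>R axis i 1)"
          and f' = "\<lambda>t. pd i F (p + t *\<^sub>R axis i 1)", OF pd_line_deriv[OF diff]] by blast
    then have "s n p = pd i F (p + t *\<^sub>R axis i 1)"
      using h(1)[of n] by (simp add: s_def)
    then show ?thesis using M' True by simp
  next
    case False
    then have p: "norm p > r + 1" by (simp add: not_le)
    have "norm p \<le> norm (p + h n *\<^sub>R axis i 1) + norm (h n *\<^sub>R axis i (1::real))"
      using norm_triangle_ineq4[of "p + h n *\<^sub>R axis i 1" "h n *\<^sub>R axis i 1"] by simp
    then have "norm (p + h n *\<^sub>R axis i 1) > r"
      using p h[of n] by simp
    then have "p + h n *\<^sub>R axis i 1 \<notin> cball 0 r" "p \<notin> cball 0 r"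
      using p by (simp_all only: mem_cball_0 not_le)
    then have "F (p + h n *\<^sub>R axis i 1) = 0" "F p = 0"
      using r K(2) by blast+
    then show ?thesis by (simp add: s_def M'_def)
  qed
  have lim: "(\<lambda>n. s n p) \<longlonglongrightarrow> pd i F p" for p
  proof -
    have "((\<lambda>t. F (p + t *\<^sub>R axis i 1)) has_real_derivative pd i F p) (at 0)"
      using pd_line_deriv[OF diff, of p i 0] by simp
    then have "((\<lambda>t. (F (p + t *\<^sub>R axis i 1) - F p) / t) \<longlongrightarrow> pd i F p) (at 0)"
      by (simp add: DERIV_def)
    moreover have "filterlim h (at 0) sequentially"
      using h0 h(1) by (intro filterlim_atI) (auto simp: less_imp_neq[symmetric])
    ultimately show ?thesis
      unfolding s_def by (rule filterlim_compose)
  qed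
  have shift: "integrable lborel (\<lambda>p. F (c + p))" "(LINT p|lborel. F (c + p)) = (LINT p|lborel. F p)" for c
  proof -
    have "integrable (distr lborel borel ((+) c)) F" using intF by (simp add: lborel_distr_plus)
    then show "integrable lborel (\<lambda>p. F (c + p))"
      by (subst (asm) integrable_distr_eq) (use intF in auto)
    have "(LINT p|lborel. F p) = (LINT p|distr lborel borel ((+) c). F p)"
      by (simp add: lborel_distr_plus)
    also have "\<dots> = (LINT p|lborel. F (c + p))"
      by (subst integral_distr) (use intF in auto)
    finally show "(LINT p|lborel. F (c + p)) = (LINT p|lborel. F p)" by simp
  qed
  have "(LINT p|lborel. s n p) = 0" for n
    unfolding s_def using shift[of "h n *\<^sub>R axis i 1"] intF by (simp add: add.commute)
  moreover have "(\<lambda>n. LINT p|lborel. s n p) \<longlonglongrightarrow> (LINT p|lborel. pd i F p)"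
  proof (rule integral_dominated_convergence[where w = "\<lambda>p. M' * indicator (cball 0 (r + 1)) p"])
    have "integrable lborel (\<lambda>p::real^'n. indicator (cball 0 (r + 1)) p *\<^sub>R M')"
      by (intro borel_integrable_compact) auto
    then show "integrable lborel (\<lambda>p::real^'n. M' * indicator (cball 0 (r + 1)) p)"
      by (simp add: mult.commute)
    show "s n \<in> borel_measurable lborel" for n
      unfolding s_def using shift(1)[of "h n *\<^sub>R axis i 1"] intF by (simp add: add.commute)
  qed (use int lim s_bound in auto)
  ultimately show "(LINT p|lborel. pd i F p) = 0"
    by (simp add: LIMSEQ_const_iff)
qed

section \<open>Linear systems on the line and shooting\<close>

lemma antiderivative_exists:
  fixes f :: "real \<Rightarrow> real"
  assumes "continuous_on UNIV f"
  shows "\<exists>F. F 0 = 0 \<and> (\<forall>x. (F has_real_derivative f x) (at x))"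
proof -
  have "isCont f x" for x using assms by (simp add: continuous_on_eq_continuous_at)
  then obtain F where F: "\<And>x. (F has_vector_derivative f x) (at x)"
    using einterval_antiderivative[of "-\<infinity>" "\<infinity>" f] by auto
  have "((\<lambda>x. F x - F 0) has_real_derivative f x) (at x)" for x
    using F[of x] by (auto intro!: derivative_eq_intros simp: has_real_derivative_iff_has_vector_derivative)
  then show ?thesis by (intro exI[of _ "\<lambda>x. F x - F 0"]) simp
qed

definition antiderivative :: "(real \<Rightarrow> real) \<Rightarrow> real \<Rightarrow> real" where
  "antiderivative f = (SOME F. F 0 = 0 \<and> (\<forall>x. (F has_real_derivative f x) (at x)))"

lemma antiderivative:
  assumes "continuous_on UNIV f"
  shows "antiderivative f 0 = 0" "(antiderivative f has_real_derivative f x) (at x)"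
  using someI_ex[OF antiderivative_exists[OF assms]] unfolding antiderivative_def by auto

text \<open>The induction step of the factorial bound on Picard iterates: each integration from \<open>0\<close> raises the
  power of \<open>\<bar>u\<bar>\<close> by one and divides by it.\<close>

lemma antiderivative_power_bound:
  fixes F :: "real \<Rightarrow> real"
  assumes F0: "F 0 = 0"
    and F: "\<And>t. \<bar>t\<bar> \<le> R \<Longrightarrow> (F has_real_derivative f t) (at t)"
    and f: "\<And>t. \<bar>t\<bar> \<le> R \<Longrightarrow> \<bar>f t\<bar> \<le> C * \<bar>t\<bar> ^ n"
    and u: "\<bar>u\<bar> \<le> R"
  shows "\<bar>F u\<bar> \<le> C * \<bar>u\<bar> ^ Suc n / Suc n"
proof -
  have pos: "s * G x \<le> C * x ^ Suc n / Suc n"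
    if G0: "G 0 = 0" and G: "\<And>t. 0 \<le> t \<Longrightarrow> t \<le> R \<Longrightarrow> (G has_real_derivative g t) (at t)"
      and g: "\<And>t. 0 \<le> t \<Longrightarrow> t \<le> R \<Longrightarrow> \<bar>g t\<bar> \<le> C * t ^ n" and s: "\<bar>s\<bar> = 1" and x: "0 \<le> x" "x \<le> R"
    for G g x and s :: real
  proof -
    have "(\<lambda>t. C * t ^ Suc n / Suc n - s * G t) 0 \<le> (\<lambda>t. C * t ^ Suc n / Suc n - s * G t) x"
    proof (rule DERIV_nonneg_imp_nondecreasing[OF x(1)])
      fix t assume t: "0 \<le> t" "t \<le> x"
      have "((\<lambda>t. C * t ^ Suc n / Suc n - s * G t) has_real_derivative (C * t ^ n - s * g t)) (at t)"
        using t x by (auto intro!: derivative_eq_intros G simp del: power_Suc of_nat_Suc)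
      moreover have "s * g t \<le> \<bar>g t\<bar>"
        using s by (metis abs_ge_self abs_mult mult_1)
      then have "s * g t \<le> C * t ^ n"
        using g[of t] t x by linarith
      ultimately show "\<exists>y. ((\<lambda>t. C * t ^ Suc n / Suc n - s * G t) has_real_derivative y) (at t) \<and> 0 \<le> y"
        by (intro exI[of _ "C * t ^ n - s * g t"]) simp
    qed
    then show ?thesis by (simp add: G0)
  qed
  show ?thesis
  proof (cases "u \<ge> 0")
    case True
    have fb: "\<bar>f t\<bar> \<le> C * t ^ n" if "0 \<le> t" "t \<le> R" for t
      using f[of t] that by simp
    have "s * F u \<le> C * u ^ Suc n / Suc n" if "\<bar>s\<bar> = 1" for s
      by (rule pos[of F f]) (use that True F0 F fb u in auto)
    from this[of 1] this[of "-1"] show ?thesis using True by (simp add: abs_le_iff)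
  next
    case False
    have D: "((\<lambda>t. F (- t)) has_real_derivative - f (- t)) (at t)" if "0 \<le> t" "t \<le> R" for t
      using F[of "- t"] that by (simp add: DERIV_mirror)
    have fb: "\<bar>- f (- t)\<bar> \<le> C * t ^ n" if "0 \<le> t" "t \<le> R" for t
      using f[of "- t"] that by simp
    have "s * F (- (- u)) \<le> C * (- u) ^ Suc n / Suc n" if "\<bar>s\<bar> = 1" for s
      by (rule pos[of "\<lambda>t. F (- t)" "\<lambda>t. - f (- t)"]) (use that False F0 D fb u in auto)
    from this[of 1] this[of "-1"] show ?thesis using False by (simp add: abs_le_iff)
  qed
qed

text \<open>The terms (not the partial sums) of the Picard series for \<open>\<phi>' = \<alpha> \<psi>\<close>, \<open>\<psi>' = \<beta> \<phi>\<close>,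
  \<open>\<phi> 0 = 1\<close>, \<open>\<psi> 0 = 0\<close>.\<close>

fun picard :: "(real \<Rightarrow> real) \<Rightarrow> (real \<Rightarrow> real) \<Rightarrow> nat \<Rightarrow> (real \<Rightarrow> real) \<times> (real \<Rightarrow> real)" where
  "picard \<alpha> \<beta> 0 = ((\<lambda>u. 1), (\<lambda>u. 0))"
| "picard \<alpha> \<beta> (Suc n) = (antiderivative (\<lambda>u. \<alpha> u * snd (picard \<alpha> \<beta> n) u),
     antiderivative (\<lambda>u. \<beta> u * fst (picard \<alpha> \<beta> n) u))"

lemma picard_series_deriv:
  fixes f g :: "nat \<Rightarrow> real \<Rightarrow> real"
  assumes f0: "\<And>u. (f 0 has_real_derivative 0) (at u)"
    and f: "\<And>n u. (f (Suc n) has_real_derivative \<gamma> u * g n u) (at u)" "\<And>n. f (Suc n) 0 = 0"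
    and g: "\<And>n u. \<bar>u\<bar> \<le> R \<Longrightarrow> \<bar>g n u\<bar> \<le> (K * \<bar>u\<bar>) ^ n / fact n"
    and \<gamma>: "\<And>u. \<bar>u\<bar> \<le> R \<Longrightarrow> \<bar>\<gamma> u\<bar> \<le> K" and u: "\<bar>u\<bar> < R"
  shows "((\<lambda>u. \<Sum>n. f n u) has_real_derivative \<gamma> u * (\<Sum>n. g n u)) (at u)"
proof -
  define f' where "f' n u = (case n of 0 \<Rightarrow> 0 | Suc m \<Rightarrow> \<gamma> u * g m u)" for n u
  have K: "K \<ge> 0" using \<gamma>[of u] u by force
  have gb: "\<bar>g n x\<bar> \<le> (K * R) ^ n / fact n" if "\<bar>x\<bar> \<le> R" for n x
  proof -
    have "(K * \<bar>x\<bar>) ^ n \<le> (K * R) ^ n"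
      using K that by (intro power_mono mult_left_mono) auto
    then show ?thesis
      using g[OF that, of n] by (meson divide_right_mono fact_ge_zero order_trans)
  qed
  have sg: "summable (\<lambda>n. (K * R) ^ n / fact n)"
    using summable_exp[of "K * R"] by (simp add: divide_inverse mult.commute)
  have "uniformly_convergent_on {-R<..<R} (\<lambda>n x. \<Sum>i<n. f' i x)"
  proof (rule Weierstrass_m_test'[where M = "\<lambda>n. case n of 0 \<Rightarrow> 0 | Suc m \<Rightarrow> K * ((K * R) ^ m / fact m)"])
    show "norm (f' n x) \<le> (case n of 0 \<Rightarrow> 0 | Suc m \<Rightarrow> K * ((K * R) ^ m / fact m))"
      if "x \<in> {-R<..<R}" for n x
    proof (cases n)
      case (Suc m)
      have "\<bar>\<gamma> x\<bar> * \<bar>g m x\<bar> \<le> K * ((K * R) ^ m / fact m)"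
        using that by (intro mult_mono gb \<gamma> K) auto
      then show ?thesis by (simp add: Suc f'_def abs_mult)
    qed (simp add: f'_def)
    show "summable (\<lambda>n. case n of 0 \<Rightarrow> 0 | Suc m \<Rightarrow> K * ((K * R) ^ m / fact m))"
      using summable_mult[OF sg, of K] by (subst summable_Suc_iff[symmetric]) simp
  qed
  moreover have "(f n has_real_derivative f' n x) (at x within {-R<..<R})" for n x
    by (cases n) (auto simp: f'_def intro: has_field_derivative_at_within f0 f(1))
  moreover have "summable (\<lambda>n. f n 0)"
    by (subst summable_Suc_iff[symmetric]) (simp add: f(2))
  ultimately have "((\<lambda>u. \<Sum>n. f n u) has_real_derivative (\<Sum>n. f' n u)) (at u)"
    using u by (intro has_field_derivative_series'(2)[of "{-R<..<R}" _ _ 0]) (auto simp: abs_less_iff)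
  moreover have "(\<Sum>n. f' n u) = \<gamma> u * (\<Sum>n. g n u)"
  proof -
    have s: "summable (\<lambda>n. g n u)"
      using gb[of u] u by (intro summable_comparison_test'[OF sg, of 0]) auto
    have "(\<lambda>n. f' (Suc n) u) sums (\<gamma> u * (\<Sum>n. g n u))"
      unfolding f'_def using sums_mult[OF summable_sums[OF s]] by simp
    then have "(\<lambda>n. f' n u) sums (\<gamma> u * (\<Sum>n. g n u) + f' 0 u)"
      by (rule sums_Suc)
    then show ?thesis by (simp add: f'_def sums_iff)
  qed
  ultimately show ?thesis by simp
qed

lemma continuous_bounded_on_interval:
  fixes f :: "real \<Rightarrow> real"
  assumes "continuous_on UNIV f"
  shows "\<exists>K. \<forall>u\<in>{a..b}. \<bar>f u\<bar> \<le> K"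
proof -
  have "compact (f ` {a..b})"
    by (intro compact_continuous_image continuous_on_subset[OF assms]) auto
  then have "bounded (f ` {a..b})" by (rule compact_imp_bounded)
  then show ?thesis unfolding bounded_iff by auto
qed

lemma linear_system_solution_exists:
  fixes \<alpha> \<beta> :: "real \<Rightarrow> real"
  assumes \<alpha>: "continuous_on UNIV \<alpha>" and \<beta>: "continuous_on UNIV \<beta>"
  shows "\<exists>\<phi> \<psi>. \<phi> 0 = 1 \<and> \<psi> 0 = 0 \<and> (\<forall>u. (\<phi> has_real_derivative \<alpha> u * \<psi> u) (at u)) \<and>
    (\<forall>u. (\<psi> has_real_derivative \<beta> u * \<phi> u) (at u))"
proof -
  define p where "p n = fst (picard \<alpha> \<beta> n)" for n
  define q where "q n = snd (picard \<alpha> \<beta> n)" for n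
  have base: "p 0 = (\<lambda>u. 1)" "q 0 = (\<lambda>u. 0)" by (auto simp: p_def q_def)
  have step: "p (Suc n) = antiderivative (\<lambda>u. \<alpha> u * q n u)"
    "q (Suc n) = antiderivative (\<lambda>u. \<beta> u * p n u)" for n
    by (auto simp: p_def q_def)
  have cont: "continuous_on UNIV (p n) \<and> continuous_on UNIV (q n)" for n
  proof (induction n)
    case (Suc n)
    then have "continuous_on UNIV (\<lambda>u. \<alpha> u * q n u)" "continuous_on UNIV (\<lambda>u. \<beta> u * p n u)"
      using \<alpha> \<beta> by (auto intro: continuous_on_mult)
    then show ?case
      unfolding step using antiderivative(2) DERIV_isCont
      by (intro conjI continuous_at_imp_continuous_on ballI) blast+
  qed (simp add: base)
  have c: "continuous_on UNIV (\<lambda>u. \<alpha> u * q n u)" "continuous_on UNIV (\<lambda>u. \<beta> u * p n u)" for n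
    using cont \<alpha> \<beta> by (auto intro: continuous_on_mult)
  note D = antiderivative[OF c(1), folded step] antiderivative[OF c(2), folded step]
  have deriv: "((\<lambda>u. \<Sum>n. p n u) has_real_derivative \<alpha> u * (\<Sum>n. q n u)) (at u) \<and>
      ((\<lambda>u. \<Sum>n. q n u) has_real_derivative \<beta> u * (\<Sum>n. p n u)) (at u)" for u
  proof -
    define R where "R = \<bar>u\<bar> + 1"
    obtain K1 K2 where K12: "\<forall>t\<in>{-R..R}. \<bar>\<alpha> t\<bar> \<le> K1" "\<forall>t\<in>{-R..R}. \<bar>\<beta> t\<bar> \<le> K2"
      using continuous_bounded_on_interval \<alpha> \<beta> by metis
    define K where "K = max K1 K2"
    have K: "\<bar>\<alpha> t\<bar> \<le> K" "\<bar>\<beta> t\<bar> \<le> K" if "\<bar>t\<bar> \<le> R" for t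
    proof -
      have "t \<in> {-R..R}" using that by auto
      then show "\<bar>\<alpha> t\<bar> \<le> K" "\<bar>\<beta> t\<bar> \<le> K"
        using K12 unfolding K_def by (meson max.coboundedI1 max.coboundedI2)+
    qed
    have K0: "K \<ge> 0" using K(1)[of 0] by (simp add: R_def)
    have bound: "\<forall>t. \<bar>t\<bar> \<le> R \<longrightarrow> \<bar>p n t\<bar> \<le> (K * \<bar>t\<bar>) ^ n / fact n \<and> \<bar>q n t\<bar> \<le> (K * \<bar>t\<bar>) ^ n / fact n" for n
    proof (induction n)
      case (Suc n)
      have step_bound: "\<bar>\<gamma> * r\<bar> \<le> (K ^ Suc n / fact n) * \<bar>t\<bar> ^ n"
        if "\<bar>\<gamma>\<bar> \<le> K" "\<bar>r\<bar> \<le> (K * \<bar>t\<bar>) ^ n / fact n" for \<gamma> r t :: real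
      proof -
        have "\<bar>\<gamma>\<bar> * \<bar>r\<bar> \<le> K * ((K * \<bar>t\<bar>) ^ n / fact n)"
          using that K0 by (intro mult_mono) auto
        then show ?thesis by (simp add: abs_mult power_mult_distrib)
      qed
      have eq: "(K ^ Suc n / fact n) * \<bar>t\<bar> ^ Suc n / Suc n = (K * \<bar>t\<bar>) ^ Suc n / fact (Suc n)" for t
        by (simp add: power_mult_distrib fact_Suc mult_ac)
      show ?case
      proof (intro allI impI conjI)
        fix t assume t: "\<bar>t\<bar> \<le> R"
        show "\<bar>p (Suc n) t\<bar> \<le> (K * \<bar>t\<bar>) ^ Suc n / fact (Suc n)"
          unfolding eq[symmetric] using Suc.IH K t
          by (intro antiderivative_power_bound[OF D(1) D(2) step_bound]) auto
        show "\<bar>q (Suc n) t\<bar> \<le> (K * \<bar>t\<bar>) ^ Suc n / fact (Suc n)"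
          unfolding eq[symmetric] using Suc.IH K t
          by (intro antiderivative_power_bound[OF D(3) D(4) step_bound]) auto
      qed
    qed (simp add: base)
    show ?thesis
      by (intro conjI picard_series_deriv[of _ _ _ R K])
        (use bound K D in \<open>auto simp: base R_def\<close>)
  qed
  moreover have "(\<Sum>n. p n 0) = 1"
  proof -
    have "(\<lambda>n. p n 0) sums (\<Sum>n\<in>{0}. p n 0)"
      by (rule sums_finite) (use D(1) in \<open>auto simp: gr0_conv_Suc\<close>)
    then show ?thesis by (simp add: sums_iff base)
  qed
  moreover have "(\<Sum>n. q n 0) = 0"
  proof -
    have "q n 0 = 0" for n by (cases n) (auto simp: base D)
    then show ?thesis by simp
  qed
  ultimately show ?thesis
    by (intro exI[of _ "\<lambda>u. \<Sum>n. p n u"] exI[of _ "\<lambda>u. \<Sum>n. q n u"]) blast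
qed

lemma gronwall_interval:
  fixes E :: "real \<Rightarrow> real"
  assumes E: "\<And>t. 0 \<le> t \<Longrightarrow> t \<le> R \<Longrightarrow> (E has_real_derivative E' t) (at t)"
    and E': "\<And>t. 0 \<le> t \<Longrightarrow> t \<le> R \<Longrightarrow> E' t \<le> c * E t + b"
    and c: "c \<ge> 0" "b \<ge> 0" and u: "0 \<le> u" "u \<le> R"
  shows "E u \<le> (E 0 + b * u) * exp (c * u)"
proof -
  let ?h = "\<lambda>t. E t * exp (- c * t) - b * t"
  have "?h u \<le> ?h 0"
  proof (rule DERIV_nonpos_imp_nonincreasing[OF u(1)])
    fix t assume t: "0 \<le> t" "t \<le> u"
    have D: "(?h has_real_derivative (E' t - c * E t) * exp (- c * t) - b) (at t)"
      using t u by (auto intro!: derivative_eq_intros E simp: algebra_simps)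
    have "(E' t - c * E t) * exp (- c * t) \<le> b * exp (- c * t)"
      using E'[of t] t u by (intro mult_right_mono) auto
    also have "\<dots> \<le> b * 1"
      using c t by (intro mult_left_mono) auto
    finally have "(E' t - c * E t) * exp (- c * t) - b \<le> 0" by simp
    with D show "\<exists>y. (?h has_real_derivative y) (at t) \<and> y \<le> 0" by blast
  qed
  then have "E u * exp (- c * u) \<le> E 0 + b * u" by simp
  then have "E u * exp (- c * u) * exp (c * u) \<le> (E 0 + b * u) * exp (c * u)"
    by (intro mult_right_mono) auto
  then show ?thesis by (simp add: mult.assoc flip: exp_add)
qed

text \<open>The equation \<open>(\<phi>' / \<alpha>)' = \<beta> \<phi>\<close> as a first-order system; \<open>\<psi>\<close> is the flux \<open>\<phi>' / \<alpha>\<close>. The initial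
  values single out the solutions that are even when \<open>\<alpha>\<close> and \<open>\<beta>\<close> are.\<close>

definition solves :: "(real \<Rightarrow> real) \<Rightarrow> (real \<Rightarrow> real) \<Rightarrow> (real \<Rightarrow> real) \<Rightarrow> (real \<Rightarrow> real) \<Rightarrow> bool" where
  "solves \<alpha> \<beta> \<phi> \<psi> \<longleftrightarrow> \<phi> 0 = 1 \<and> \<psi> 0 = 0 \<and> (\<forall>u. (\<phi> has_real_derivative \<alpha> u * \<psi> u) (at u)) \<and>
    (\<forall>u. (\<psi> has_real_derivative \<beta> u * \<phi> u) (at u))"

text \<open>Continuous dependence on the coefficient, from the Gronwall inequality applied first to
  \<open>\<phi>1\<^sup>2 + \<psi>1\<^sup>2\<close> and then to the squared distance of the two solutions.\<close>

lemma solves_perturbation: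
  assumes s1: "solves \<alpha> \<beta>1 \<phi>1 \<psi>1" and s2: "solves \<alpha> \<beta>2 \<phi>2 \<psi>2" and R: "R \<ge> 0"
    and K: "\<And>u. 0 \<le> u \<Longrightarrow> u \<le> R \<Longrightarrow> \<bar>\<alpha> u\<bar> \<le> K \<and> \<bar>\<beta>1 u\<bar> \<le> K \<and> \<bar>\<beta>2 u\<bar> \<le> K"
    and \<eta>: "\<And>u. 0 \<le> u \<Longrightarrow> u \<le> R \<Longrightarrow> \<bar>\<beta>1 u - \<beta>2 u\<bar> \<le> \<eta>"
  shows "(\<phi>1 R - \<phi>2 R)\<^sup>2 \<le> \<eta>\<^sup>2 * (exp (2 * K * R) * R * exp ((2 * K + 1) * R))"
proof -
  have K0: "K \<ge> 0" using K[of 0] R by force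
  have cross: "2 * x * y * z \<le> 2 * K * (x\<^sup>2 + y\<^sup>2)" if "\<bar>z\<bar> \<le> 2 * K" for x y z :: real
  proof -
    have "2 * x * y * z \<le> \<bar>2 * x * y\<bar> * \<bar>z\<bar>" by (metis abs_ge_self abs_mult)
    also have "\<dots> \<le> (x\<^sup>2 + y\<^sup>2) * (2 * K)"
    proof (rule mult_mono)
      show "\<bar>2 * x * y\<bar> \<le> x\<^sup>2 + y\<^sup>2"
        using sum_squares_bound[of x y] sum_squares_bound[of "-x" y] by (simp add: abs_le_iff)
    qed (use that in auto)
    finally show ?thesis by (simp add: mult.commute)
  qed
  have D1: "(\<phi>1 has_real_derivative \<alpha> u * \<psi>1 u) (at u)" "(\<psi>1 has_real_derivative \<beta>1 u * \<phi>1 u) (at u)"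
    and D2: "(\<phi>2 has_real_derivative \<alpha> u * \<psi>2 u) (at u)" "(\<psi>2 has_real_derivative \<beta>2 u * \<phi>2 u) (at u)" for u
    using s1 s2 by (auto simp: solves_def)
  define E1 where "E1 t = (\<phi>1 t)\<^sup>2 + (\<psi>1 t)\<^sup>2" for t
  have E1: "E1 t \<le> exp (2 * K * R)" if t: "0 \<le> t" "t \<le> R" for t
  proof -
    have "E1 t \<le> (E1 0 + 0 * t) * exp (2 * K * t)"
    proof (rule gronwall_interval[where R = R])
      fix t assume t: "0 \<le> t" "t \<le> R"
      show "(E1 has_real_derivative 2 * \<phi>1 t * \<psi>1 t * (\<alpha> t + \<beta>1 t)) (at t)"
        unfolding E1_def by (auto intro!: derivative_eq_intros D1 simp: algebra_simps)
      have "\<bar>\<alpha> t + \<beta>1 t\<bar> \<le> 2 * K" using K[OF t] by linarith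
      from cross[OF this] show "2 * \<phi>1 t * \<psi>1 t * (\<alpha> t + \<beta>1 t) \<le> 2 * K * E1 t + 0"
        by (simp add: E1_def)
    qed (use K0 t in auto)
    also have "\<dots> \<le> exp (2 * K * R)"
      using t K0 s1 by (auto simp: E1_def solves_def intro!: mult_left_mono)
    finally show ?thesis .
  qed
  define E where "E t = (\<phi>1 t - \<phi>2 t)\<^sup>2 + (\<psi>1 t - \<psi>2 t)\<^sup>2" for t
  have "E R \<le> (E 0 + (\<eta>\<^sup>2 * exp (2 * K * R)) * R) * exp ((2 * K + 1) * R)"
  proof (rule gronwall_interval[where R = R])
    fix t assume t: "0 \<le> t" "t \<le> R"
    let ?d = "\<phi>1 t - \<phi>2 t" and ?e = "\<psi>1 t - \<psi>2 t" and ?b = "(\<beta>1 t - \<beta>2 t) * \<phi>1 t"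
    show "(E has_real_derivative 2 * ?d * ?e * (\<alpha> t + \<beta>2 t) + 2 * ?e * ?b) (at t)"
      unfolding E_def by (auto intro!: derivative_eq_intros D1 D2 simp: algebra_simps)
    have "\<bar>\<alpha> t + \<beta>2 t\<bar> \<le> 2 * K" using K[OF t] by linarith
    note a = cross[OF this, of ?d ?e]
    have b: "2 * ?e * ?b \<le> ?e\<^sup>2 + ?b\<^sup>2" by (rule sum_squares_bound)
    have "?b\<^sup>2 = \<bar>\<beta>1 t - \<beta>2 t\<bar>\<^sup>2 * (\<phi>1 t)\<^sup>2" by (simp add: power_mult_distrib)
    also have "\<dots> \<le> \<eta>\<^sup>2 * exp (2 * K * R)"
    proof (rule mult_mono)
      show "\<bar>\<beta>1 t - \<beta>2 t\<bar>\<^sup>2 \<le> \<eta>\<^sup>2" using \<eta>[OF t] by (intro power_mono) auto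
      have "(\<phi>1 t)\<^sup>2 \<le> E1 t" by (simp add: E1_def)
      then show "(\<phi>1 t)\<^sup>2 \<le> exp (2 * K * R)" using E1[OF t] by linarith
    qed auto
    finally have c: "?b\<^sup>2 \<le> \<eta>\<^sup>2 * exp (2 * K * R)" .
    have d: "?e\<^sup>2 \<le> E t" by (simp add: E_def)
    show "2 * ?d * ?e * (\<alpha> t + \<beta>2 t) + 2 * ?e * ?b \<le> (2 * K + 1) * E t + \<eta>\<^sup>2 * exp (2 * K * R)"
      using a b c d unfolding E_def[symmetric] by (simp add: algebra_simps)
  qed (use K0 R in auto)
  moreover have "E 0 = 0" using s1 s2 by (simp add: E_def solves_def)
  moreover have "(\<phi>1 R - \<phi>2 R)\<^sup>2 \<le> E R" by (simp add: E_def)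
  ultimately show ?thesis by (simp add: mult.assoc)
qed

lemma solves_even:
  assumes s: "solves \<alpha> \<beta> \<phi> \<psi>" and ev: "\<And>u. \<alpha> (- u) = \<alpha> u" "\<And>u. \<beta> (- u) = \<beta> u"
  shows "solves \<alpha> \<beta> (\<lambda>u. (\<phi> u + \<phi> (- u)) / 2) (\<lambda>u. (\<psi> u - \<psi> (- u)) / 2)"
proof -
  have D: "(\<phi> has_real_derivative \<alpha> u * \<psi> u) (at u)" "(\<psi> has_real_derivative \<beta> u * \<phi> u) (at u)" for u
    using s by (auto simp: solves_def)
  have "((\<lambda>u. \<phi> (- u)) has_real_derivative - (\<alpha> u * \<psi> (- u))) (at u)"
    "((\<lambda>u. \<psi> (- u)) has_real_derivative - (\<beta> u * \<phi> (- u))) (at u)" for u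
    using D(1)[of "- u"] D(2)[of "- u"] by (simp_all add: DERIV_mirror ev)
  note D' = this
  show ?thesis
    using s unfolding solves_def
    by (auto intro!: derivative_eq_intros D D' simp: algebra_simps add_divide_distrib diff_divide_distrib)
qed

text \<open>With nonnegative coefficients \<open>\<phi> \<psi>\<close> and hence \<open>\<phi>\<^sup>2\<close> are nondecreasing, so \<open>\<phi>\<close> cannot reach \<open>0\<close>.\<close>

lemma solves_positive:
  assumes s: "solves \<alpha> \<beta> \<phi> \<psi>" and "\<And>u. 0 \<le> u \<Longrightarrow> u \<le> R \<Longrightarrow> \<alpha> u \<ge> 0 \<and> \<beta> u \<ge> 0" and R: "R \<ge> 0"
  shows "\<phi> R > 0"
proof -
  have D: "(\<phi> has_real_derivative \<alpha> u * \<psi> u) (at u)" "(\<psi> has_real_derivative \<beta> u * \<phi> u) (at u)" for u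
    using s by (auto simp: solves_def)
  have i: "\<phi> 0 = 1" "\<psi> 0 = 0"
    using s by (auto simp: solves_def)
  have pq: "\<phi> u * \<psi> u \<ge> 0" if u: "0 \<le> u" "u \<le> R" for u
  proof -
    have "(\<lambda>t. \<phi> t * \<psi> t) 0 \<le> (\<lambda>t. \<phi> t * \<psi> t) u"
    proof (rule DERIV_nonneg_imp_nondecreasing[OF u(1)])
      fix t assume t: "0 \<le> t" "t \<le> u"
      have "((\<lambda>t. \<phi> t * \<psi> t) has_real_derivative \<alpha> t * (\<psi> t)\<^sup>2 + \<beta> t * (\<phi> t)\<^sup>2) (at t)"
        by (auto intro!: derivative_eq_intros D simp: power2_eq_square)
      then show "\<exists>y. ((\<lambda>t. \<phi> t * \<psi> t) has_real_derivative y) (at t) \<and> 0 \<le> y"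
        using assms(2)[of t] t u by (intro exI[of _ "\<alpha> t * (\<psi> t)\<^sup>2 + \<beta> t * (\<phi> t)\<^sup>2"]) auto
    qed
    then show ?thesis by (simp add: i)
  qed
  have sq: "(\<phi> u)\<^sup>2 \<ge> 1" if u: "0 \<le> u" "u \<le> R" for u
  proof -
    have "(\<lambda>t. (\<phi> t)\<^sup>2) 0 \<le> (\<lambda>t. (\<phi> t)\<^sup>2) u"
    proof (rule DERIV_nonneg_imp_nondecreasing[OF u(1)])
      fix t assume t: "0 \<le> t" "t \<le> u"
      have "((\<lambda>t. (\<phi> t)\<^sup>2) has_real_derivative 2 * \<alpha> t * (\<phi> t * \<psi> t)) (at t)"
        by (auto intro!: derivative_eq_intros D simp: power2_eq_square)
      moreover have "0 \<le> 2 * \<alpha> t * (\<phi> t * \<psi> t)"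
        using assms(2)[of t] pq[of t] t u by simp
      ultimately show "\<exists>y. ((\<lambda>t. (\<phi> t)\<^sup>2) has_real_derivative y) (at t) \<and> 0 \<le> y"
        by blast
    qed
    then show ?thesis by (simp add: i)
  qed
  show ?thesis
  proof (rule ccontr)
    assume "\<not> \<phi> R > 0"
    then obtain x where "0 \<le> x" "x \<le> R" "\<phi> x = 0"
      using IVT2[of \<phi> R 0 0] R DERIV_isCont[OF D(1)] i by force
    then show False using sq[of x] by simp
  qed
qed

text \<open>For the Jacobi operator of a helicoid \<open>\<alpha> = 1 / w\<close> and \<open>b = w V\<close>; then \<open>\<mu>\<close> is a spectral parameter and \<open>\<epsilon>\<close> the square of a frequency in the second variable. If the solution with \<open>\<mu> = \<epsilon> = 0\<close>
  is negative at \<open>R\<close>, so is the one with \<open>\<mu> = 0\<close> and small \<open>\<epsilon>\<close>; for very negative \<open>\<mu>\<close> the value at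
  \<open>R\<close> is positive; and it depends continuously on \<open>\<mu>\<close>. So some negative \<open>\<mu>\<close> is a Dirichlet eigenvalue
  on \<open>[- R, R]\<close>.\<close>

lemma dirichlet_shooting:
  fixes \<alpha> b w :: "real \<Rightarrow> real"
  assumes cont: "continuous_on UNIV \<alpha>" "continuous_on UNIV b" "continuous_on UNIV w"
    and ev: "\<And>u. \<alpha> (- u) = \<alpha> u" "\<And>u. b (- u) = b u" "\<And>u. w (- u) = w u"
    and pos: "\<And>u. \<alpha> u \<ge> 0" "\<And>u. w u \<ge> 1"
    and s0: "solves \<alpha> b \<phi>0 \<psi>0" and R: "R > 0" "\<phi>0 R < 0"
  shows "\<exists>\<epsilon>0>0. \<forall>\<epsilon>. 0 \<le> \<epsilon> \<and> \<epsilon> \<le> \<epsilon>0 \<longrightarrow> (\<exists>\<mu><0. \<exists>\<phi> \<psi>.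
    solves \<alpha> (\<lambda>u. b u + \<epsilon> * \<alpha> u - \<mu> * w u) \<phi> \<psi> \<and> \<phi> R = 0 \<and> \<phi> (- R) = 0)"
proof -
  obtain A0 B0 W0 where K0: "\<forall>u\<in>{0..R}. \<bar>\<alpha> u\<bar> \<le> A0" "\<forall>u\<in>{0..R}. \<bar>b u\<bar> \<le> B0" "\<forall>u\<in>{0..R}. \<bar>w u\<bar> \<le> W0"
    using continuous_bounded_on_interval cont by metis
  have nn: "A0 \<ge> 0" "B0 \<ge> 0" "W0 \<ge> 0"
    using K0 R abs_ge_zero order_trans by (metis atLeastAtMost_iff less_imp_le order_refl)+
  \<comment> \<open>As \<open>w \<ge> 1\<close>, this value of \<open>\<mu>\<close> makes the coefficient nonnegative on \<open>[0, R]\<close>.\<close>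
  define \<mu>0 where "\<mu>0 = - B0 - 1"
  define \<beta> where "\<beta> \<epsilon> \<mu> u = b u + \<epsilon> * \<alpha> u - \<mu> * w u" for \<epsilon> \<mu> u
  define K where "K = A0 + B0 + A0 - \<mu>0 * W0"
  have cont\<beta>: "continuous_on UNIV (\<beta> \<epsilon> \<mu>)" for \<epsilon> \<mu>
    unfolding \<beta>_def using cont by (intro continuous_intros)
  have "\<exists>S. \<forall>\<epsilon> \<mu>. solves \<alpha> (\<beta> \<epsilon> \<mu>) (fst (S \<epsilon> \<mu>)) (snd (S \<epsilon> \<mu>))"
  proof -
    have "\<exists>s. solves \<alpha> (\<beta> \<epsilon> \<mu>) (fst s) (snd s)" for \<epsilon> \<mu>
      using linear_system_solution_exists[OF cont(1) cont\<beta>] unfolding solves_def by simp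
    then show ?thesis by metis
  qed
  then obtain S where S: "\<And>\<epsilon> \<mu>. solves \<alpha> (\<beta> \<epsilon> \<mu>) (fst (S \<epsilon> \<mu>)) (snd (S \<epsilon> \<mu>))" by blast
  define \<Phi> where "\<Phi> \<epsilon> \<mu> = fst (S \<epsilon> \<mu>) R" for \<epsilon> \<mu>
  have K: "\<bar>\<alpha> u\<bar> \<le> K \<and> \<bar>\<beta> \<epsilon> \<mu> u\<bar> \<le> K" if "0 \<le> u" "u \<le> R" "0 \<le> \<epsilon>" "\<epsilon> \<le> 1" "\<mu>0 \<le> \<mu>" "\<mu> \<le> 0" for u \<epsilon> \<mu>
  proof -
    have u: "\<bar>\<alpha> u\<bar> \<le> A0" "\<bar>b u\<bar> \<le> B0" "\<bar>w u\<bar> \<le> W0" using K0 that by auto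
    have "\<bar>\<epsilon> * \<alpha> u\<bar> \<le> 1 * A0" unfolding abs_mult using that u by (intro mult_mono) auto
    moreover have "\<bar>\<mu> * w u\<bar> \<le> (- \<mu>0) * W0" unfolding abs_mult using that u by (intro mult_mono) auto
    ultimately show ?thesis using u nn unfolding \<beta>_def K_def by linarith
  qed
  define C where "C = exp (2 * K * R) * R * exp ((2 * K + 1) * R)"
  have C: "C > 0" using R by (simp add: C_def)
  have pert: "\<bar>\<Phi> \<epsilon> \<mu> - \<phi> R\<bar> \<le> \<eta> * sqrt C"
    if "solves \<alpha> \<beta>' \<phi> \<psi>" "0 \<le> \<epsilon>" "\<epsilon> \<le> 1" "\<mu>0 \<le> \<mu>" "\<mu> \<le> 0"
      "\<And>u. 0 \<le> u \<Longrightarrow> u \<le> R \<Longrightarrow> \<bar>\<beta>' u\<bar> \<le> K \<and> \<bar>\<beta> \<epsilon> \<mu> u - \<beta>' u\<bar> \<le> \<eta>" for \<epsilon> \<mu> \<phi> \<psi> \<beta>' \<eta>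
  proof -
    have "0 \<le> \<eta>" using that(6)[of 0] R by force
    have "(\<Phi> \<epsilon> \<mu> - \<phi> R)\<^sup>2 \<le> \<eta>\<^sup>2 * C"
      unfolding \<Phi>_def C_def using K that R
      by (intro solves_perturbation[OF S that(1)]) auto
    then have "sqrt ((\<Phi> \<epsilon> \<mu> - \<phi> R)\<^sup>2) \<le> sqrt (\<eta>\<^sup>2 * C)" by (rule real_sqrt_le_mono)
    then show ?thesis using \<open>0 \<le> \<eta>\<close> by (simp add: real_sqrt_mult)
  qed
  \<comment> \<open>For \<open>\<epsilon> \<le> \<epsilon>0\<close> the value at \<open>R\<close> moves by at most half of \<open>- \<phi>0 R\<close>.\<close>
  define \<epsilon>0 where "\<epsilon>0 = min 1 (- \<phi>0 R / (2 * (A0 + 1) * sqrt C))"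
  have "(A0 + 1) * sqrt C > 0" using nn C by simp
  then have \<epsilon>0: "\<epsilon>0 > 0" using R by (simp add: \<epsilon>0_def field_simps)
  have neg: "\<Phi> \<epsilon> 0 < 0" if \<epsilon>: "0 \<le> \<epsilon>" "\<epsilon> \<le> \<epsilon>0" for \<epsilon>
  proof -
    have "\<bar>\<Phi> \<epsilon> 0 - \<phi>0 R\<bar> \<le> (\<epsilon> * (A0 + 1)) * sqrt C"
    proof (rule pert[OF s0])
      fix u assume u: "0 \<le> u" "u \<le> R"
      have "\<bar>b u\<bar> \<le> K" using K0 u nn unfolding K_def \<mu>0_def
        by (smt (verit) atLeastAtMost_iff mult_nonneg_nonneg mult_minus_left)
      moreover have "\<bar>\<epsilon> * \<alpha> u\<bar> \<le> \<epsilon> * (A0 + 1)"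
        unfolding abs_mult using \<epsilon> K0(1) u by (intro mult_mono) force+
      ultimately show "\<bar>b u\<bar> \<le> K \<and> \<bar>\<beta> \<epsilon> 0 u - b u\<bar> \<le> \<epsilon> * (A0 + 1)" by (simp add: \<beta>_def)
    qed (use \<epsilon> nn in \<open>auto simp: \<epsilon>0_def \<mu>0_def\<close>)
    also have "\<dots> \<le> - \<phi>0 R / 2"
    proof -
      have "\<epsilon> \<le> - \<phi>0 R / (2 * (A0 + 1) * sqrt C)" using \<epsilon> by (simp add: \<epsilon>0_def)
      moreover have "(A0 + 1) * sqrt C > 0" using nn C by simp
      ultimately show ?thesis by (simp add: field_simps)
    qed
    finally show ?thesis using R by linarith
  qed
  have "\<exists>\<mu><0. \<exists>\<phi> \<psi>. solves \<alpha> (\<beta> \<epsilon> \<mu>) \<phi> \<psi> \<and> \<phi> R = 0 \<and> \<phi> (- R) = 0" if \<epsilon>: "0 \<le> \<epsilon>" "\<epsilon> \<le> \<epsilon>0" for \<epsilon>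
  proof -
    have \<epsilon>1: "\<epsilon> \<le> 1" using \<epsilon> by (simp add: \<epsilon>0_def)
    have p: "\<Phi> \<epsilon> \<mu>0 > 0"
      unfolding \<Phi>_def
    proof (rule solves_positive[OF S])
      fix u assume u: "0 \<le> u" "u \<le> R"
      have "- B0 \<le> b u" using K0(2) u by force
      moreover have "\<epsilon> * \<alpha> u \<ge> 0" using \<epsilon> pos by simp
      moreover have "(B0 + 1) * 1 \<le> (B0 + 1) * w u" using nn pos by (intro mult_left_mono) auto
      ultimately show "0 \<le> \<alpha> u \<and> 0 \<le> \<beta> \<epsilon> \<mu>0 u"
        using pos by (simp add: \<beta>_def \<mu>0_def algebra_simps)
    qed (use R in auto)
    have lip: "\<bar>\<Phi> \<epsilon> \<mu> - \<Phi> \<epsilon> \<nu>\<bar> \<le> (W0 * sqrt C) * \<bar>\<mu> - \<nu>\<bar>"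
      if "\<mu>0 \<le> \<mu>" "\<mu> \<le> 0" "\<mu>0 \<le> \<nu>" "\<nu> \<le> 0" for \<mu> \<nu>
    proof -
      have "\<bar>\<Phi> \<epsilon> \<mu> - fst (S \<epsilon> \<nu>) R\<bar> \<le> (\<bar>\<mu> - \<nu>\<bar> * W0) * sqrt C"
      proof (rule pert[OF S])
        fix u assume u: "0 \<le> u" "u \<le> R"
        have "\<bar>(\<nu> - \<mu>) * w u\<bar> \<le> \<bar>\<mu> - \<nu>\<bar> * W0"
          unfolding abs_mult using K0(3) u by (intro mult_mono) auto
        moreover have "\<beta> \<epsilon> \<mu> u - \<beta> \<epsilon> \<nu> u = (\<nu> - \<mu>) * w u" by (simp add: \<beta>_def algebra_simps)
        ultimately show "\<bar>\<beta> \<epsilon> \<nu> u\<bar> \<le> K \<and> \<bar>\<beta> \<epsilon> \<mu> u - \<beta> \<epsilon> \<nu> u\<bar> \<le> \<bar>\<mu> - \<nu>\<bar> * W0"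
          using K[of u \<epsilon> \<nu>] u that \<epsilon> \<epsilon>1 by simp
      qed (use that \<epsilon> \<epsilon>1 in auto)
      then show ?thesis by (simp add: \<Phi>_def mult_ac)
    qed
    have "continuous_on {\<mu>0..0} (\<Phi> \<epsilon>)"
      by (rule lipschitz_on_continuous_on[of "W0 * sqrt C"])
        (use lip nn C in \<open>auto simp: lipschitz_on_def dist_real_def\<close>)
    then obtain \<mu> where \<mu>: "\<mu>0 \<le> \<mu>" "\<mu> \<le> 0" "\<Phi> \<epsilon> \<mu> = 0"
      using IVT2'[of "\<Phi> \<epsilon>" 0 0 \<mu>0] p neg[OF \<epsilon>] nn by (auto simp: \<mu>0_def)
    have "\<mu> \<noteq> 0" using neg[OF \<epsilon>] \<mu>(3) by auto
    have ev\<beta>: "\<beta> \<epsilon> \<mu> (- u) = \<beta> \<epsilon> \<mu> u" for u by (simp add: \<beta>_def ev)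
    obtain \<phi> \<psi> where \<phi>\<psi>: "\<phi> = (\<lambda>u. (fst (S \<epsilon> \<mu>) u + fst (S \<epsilon> \<mu>) (- u)) / 2)"
      "solves \<alpha> (\<beta> \<epsilon> \<mu>) \<phi> \<psi>"
      using solves_even[OF S ev(1) ev\<beta>] by blast
    have "\<bar>\<Phi> \<epsilon> \<mu> - \<phi> R\<bar> \<le> 0 * sqrt C"
      by (rule pert[OF \<phi>\<psi>(2)]) (use \<mu> \<epsilon> \<epsilon>1 K in auto)
    then have "\<phi> R = 0" using \<mu> by simp
    moreover have "\<phi> (- R) = \<phi> R" by (simp add: \<phi>\<psi>(1) add.commute)
    ultimately show ?thesis using \<phi>\<psi>(2) \<mu> \<open>\<mu> \<noteq> 0\<close> by (intro exI[of _ \<mu>]) auto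
  qed
  then show ?thesis using \<epsilon>0 unfolding \<beta>_def by blast
qed

section \<open>Jacobi functions of a helicoid that depend on one variable\<close>

text \<open>The helicoid has the metric \<open>du\<^sup>2 + w(u)\<^sup>2 dv\<^sup>2\<close> with this \<open>w\<close>.\<close>

definition hel_w :: "real \<Rightarrow> real \<Rightarrow> real" where
  "hel_w A u = sqrt ((cosh u)\<^sup>2 + A\<^sup>2 * (sinh u)\<^sup>2)"

lemma cosh_sq: "(cosh (u::real))\<^sup>2 = 1 + (sinh u)\<^sup>2"
  using hyperbolic_pythagoras[of u] by simp

lemma hel_w_sq: "(hel_w A u)\<^sup>2 = (cosh u)\<^sup>2 + A\<^sup>2 * (sinh u)\<^sup>2"
  by (simp add: hel_w_def)

lemma hel_w_ge_1: "hel_w A u \<ge> 1"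
  unfolding hel_w_def by (simp add: cosh_sq)

lemma hel_w_pos: "hel_w A u > 0"
  using hel_w_ge_1[of A u] by linarith

lemma hel_w_even: "hel_w A (- u) = hel_w A u"
  by (simp add: hel_w_def)

lemma hel_w_0: "hel_w A 0 = 1"
  by (simp add: hel_w_def)

lemma hel_w_deriv:
  "(hel_w A has_real_derivative (1 + A\<^sup>2) * sinh u * cosh u / hel_w A u) (at u)"
proof -
  have "(cosh u)\<^sup>2 + A\<^sup>2 * (sinh u)\<^sup>2 > 0"
    using hel_w_pos[of A u] unfolding hel_w_def by simp
  then show ?thesis unfolding hel_w_def
    by (auto intro!: derivative_eq_intros simp: field_simps)
qed

lemma hel_w_cont: "continuous_on S (hel_w A)"
  unfolding hel_w_def by (intro continuous_intros)

text \<open>Minus the zeroth-order coefficient of the Jacobi operator: \<open>\<bar>A\<bar>\<^sup>2 = 2 a\<^sup>2 / w\<^sup>4\<close> for the second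
  fundamental form and the Ricci curvature is \<open>- 2\<close>.\<close>

definition hel_V :: "real \<Rightarrow> real \<Rightarrow> real" where
  "hel_V A u = 2 - 2 * A\<^sup>2 / hel_w A u ^ 4"

lemma hel_V_cont: "continuous_on S (hel_V A)"
  unfolding hel_V_def using hel_w_pos by (intro continuous_intros hel_w_cont) (auto simp: less_imp_neq[symmetric])

definition ell_integrand :: "real \<Rightarrow> real \<Rightarrow> real" where
  "ell_integrand A \<theta> = (A\<^sup>2 - 1 - 2 * A\<^sup>2 * (sin \<theta>)\<^sup>2) / sqrt (1 + A\<^sup>2 * (sin \<theta>)\<^sup>2)"

definition ell :: "real \<Rightarrow> real \<Rightarrow> real" where
  "ell A = antiderivative (ell_integrand A)"

lemma one_plus_sq_pos: "1 + (A::real)\<^sup>2 * x\<^sup>2 > 0"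
  by (meson add_pos_nonneg mult_nonneg_nonneg zero_le_power2 zero_less_one)

lemma ell_integrand_cont: "continuous_on S (ell_integrand A)"
  unfolding ell_integrand_def
  using one_plus_sq_pos by (intro continuous_intros) (auto simp: less_imp_neq[symmetric])

lemma ell_0: "ell A 0 = 0" and ell_deriv: "(ell A has_real_derivative ell_integrand A \<theta>) (at \<theta>)"
  unfolding ell_def using antiderivative[OF ell_integrand_cont] by auto

text \<open>In terms of the complete elliptic integrals with \<open>k\<^sup>2 = A\<^sup>2 / (1 + A\<^sup>2)\<close> this is
  \<open>sqrt (1 + A\<^sup>2) * (K(k) - 2 E(k))\<close>. The helicoid is stable exactly as long as it is not positive.\<close>

definition ell_complete :: "real \<Rightarrow> real" where
  "ell_complete A = ell A (pi / 2)"

text \<open>The substitution \<open>sin \<theta> = tanh u\<close> turns the elliptic integral into a function on the helicoid.\<close>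

definition jac_N :: "real \<Rightarrow> real \<Rightarrow> real" where
  "jac_N A u = ell A (arctan (sinh u))"

lemma jac_N_0: "jac_N A 0 = 0"
  by (simp add: jac_N_def ell_0)

lemma jac_N_deriv:
  "(jac_N A has_real_derivative (A\<^sup>2 - 1 - 2 * A\<^sup>2 * (sinh u / cosh u)\<^sup>2) / hel_w A u) (at u)"
proof -
  have sin: "sin (arctan (sinh u)) = sinh u / cosh u"
    by (simp add: sin_arctan flip: cosh_sq)
  have w: "hel_w A u = cosh u * sqrt (1 + A\<^sup>2 * (sinh u / cosh u)\<^sup>2)"
  proof -
    have "(cosh u)\<^sup>2 + A\<^sup>2 * (sinh u)\<^sup>2 = (cosh u)\<^sup>2 * (1 + A\<^sup>2 * (sinh u / cosh u)\<^sup>2)"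
      by (simp add: field_simps)
    then show ?thesis by (simp add: hel_w_def real_sqrt_mult)
  qed
  have "((\<lambda>u. arctan (sinh u)) has_real_derivative inverse (1 + (sinh u)\<^sup>2) * cosh u) (at u)"
    by (auto intro!: derivative_eq_intros)
  moreover have "inverse (1 + (sinh u)\<^sup>2) * cosh u = 1 / cosh u"
    unfolding cosh_sq[symmetric] by (simp add: power2_eq_square divide_inverse)
  ultimately have "((\<lambda>u. arctan (sinh u)) has_real_derivative 1 / cosh u) (at u)"
    by simp
  from DERIV_chain2[OF ell_deriv this] show ?thesis
    unfolding jac_N_def ell_integrand_def sin by (simp add: w mult.commute)
qed

lemma jac_N_odd: "jac_N A (- u) = - jac_N A u"
proof -
  have "((\<lambda>u. jac_N A u + jac_N A (- u)) has_real_derivative 0) (at u)" for u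
    using DERIV_add[OF jac_N_deriv[of A u] jac_N_deriv[of A "- u", unfolded DERIV_mirror]]
    by (simp add: hel_w_even)
  then have "jac_N A u + jac_N A (- u) = jac_N A 0 + jac_N A (- 0)"
    using DERIV_isconst_all by blast
  then show ?thesis by (simp add: jac_N_0)
qed

lemma jac_N_tendsto: "(jac_N A \<longlongrightarrow> ell_complete A) at_top"
proof -
  have "filterlim (sinh :: real \<Rightarrow> real) at_top at_top" by (rule sinh_real_at_top)
  then have "((\<lambda>u::real. arctan (sinh u)) \<longlongrightarrow> pi / 2) at_top"
    by (rule filterlim_compose[OF tendsto_arctan_at_top])
  moreover have "isCont (ell A) (pi / 2)" using ell_deriv DERIV_isCont by blast
  ultimately show ?thesis unfolding jac_N_def ell_complete_def by (rule isCont_tendsto_compose[rotated])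
qed

text \<open>The Killing field of translations along the axis of the helicoid has normal component
  \<open>sinh u cosh u / w\<close>, an odd Jacobi function. Reduction of order yields the second solution; this is
  the even one with value \<open>1\<close> at \<open>0\<close>, in a form that is regular at \<open>u = 0\<close>. Geometrically it comes
  from varying the parameter of the conjugate catenoids.\<close>

definition jac :: "real \<Rightarrow> real \<Rightarrow> real" where
  "jac A u = 1 - sinh u * cosh u / hel_w A u * jac_N A u"

text \<open>The flux \<open>w jac'\<close>.\<close>

definition jac_flux :: "real \<Rightarrow> real \<Rightarrow> real" where
  "jac_flux A u = - ((cosh u)\<^sup>2 + (sinh u)\<^sup>2 - (1 + A\<^sup>2) * (sinh u)\<^sup>2 * (cosh u)\<^sup>2 / (hel_w A u)\<^sup>2) * jac_N A u
     - sinh u * ((A\<^sup>2 - 1) * (cosh u)\<^sup>2 - 2 * A\<^sup>2 * (sinh u)\<^sup>2) / (cosh u * hel_w A u)"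

lemma jac_deriv: "(jac A has_real_derivative 1 / hel_w A u * jac_flux A u) (at u)"
proof -
  define s c w N where "s = sinh u" and "c = cosh u" and "w = hel_w A u" and "N = jac_N A u"
  have pos: "w > 0" "c > 0" by (auto simp: w_def c_def hel_w_pos)
  have "(jac A has_real_derivative
     0 - (((c * c + s * s) * w - s * c * ((1 + A\<^sup>2) * s * c / w)) / (w * w) * N
        + s * c / w * ((A\<^sup>2 - 1 - 2 * A\<^sup>2 * (s / c)\<^sup>2) / w))) (at u)"
    unfolding jac_def s_def c_def w_def N_def
    by (rule derivative_eq_intros hel_w_deriv jac_N_deriv refl | use hel_w_pos[of A u] in \<open>simp add: field_simps\<close>)+
  moreover have "0 - (((c * c + s * s) * w - s * c * ((1 + A\<^sup>2) * s * c / w)) / (w * w) * N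
        + s * c / w * ((A\<^sup>2 - 1 - 2 * A\<^sup>2 * (s / c)\<^sup>2) / w)) = 1 / w * jac_flux A u"
    using pos unfolding jac_flux_def s_def[symmetric] c_def[symmetric] w_def[symmetric] N_def[symmetric]
    by (simp add: field_simps power2_eq_square)
  ultimately show ?thesis by (simp add: w_def)
qed

lemma jac_flux_deriv: "(jac_flux A has_real_derivative hel_w A u * hel_V A u * jac A u) (at u)"
proof -
  define s c w N where "s = sinh u" and "c = cosh u" and "w = hel_w A u" and "N = jac_N A u"
  have pos: "w > 0" "c > 0" by (auto simp: w_def c_def hel_w_pos)
  have rel: "c\<^sup>2 = 1 + s\<^sup>2" "w\<^sup>2 = 1 + (1 + A\<^sup>2) * s\<^sup>2"
    by (auto simp: c_def s_def w_def cosh_sq hel_w_sq algebra_simps)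
  define N' w' where "N' = (A\<^sup>2 - 1 - 2 * A\<^sup>2 * (s / c)\<^sup>2) / w" and "w' = (1 + A\<^sup>2) * s * c / w"
  define g where "g = c\<^sup>2 + s\<^sup>2 - (1 + A\<^sup>2) * s\<^sup>2 * c\<^sup>2 / w\<^sup>2"
  define g' where "g' = 2 * c * s + 2 * s * c
    - ((1 + A\<^sup>2) * (2 * s * c * c\<^sup>2 + s\<^sup>2 * (2 * c * s)) * w\<^sup>2 - (1 + A\<^sup>2) * s\<^sup>2 * c\<^sup>2 * (2 * w * w')) / (w\<^sup>2 * w\<^sup>2)"
  define r where "r = s * ((A\<^sup>2 - 1) * c\<^sup>2 - 2 * A\<^sup>2 * s\<^sup>2)"
  define r' where "r' = c * ((A\<^sup>2 - 1) * c\<^sup>2 - 2 * A\<^sup>2 * s\<^sup>2) + s * ((A\<^sup>2 - 1) * (2 * c * s) - 2 * A\<^sup>2 * (2 * s * c))"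
  have D: "(jac_flux A has_real_derivative
     - g' * N - g * N' - (r' * (c * w) - r * (s * w + c * w')) / ((c * w) * (c * w))) (at u)"
    unfolding jac_flux_def s_def c_def w_def N_def g_def g'_def r_def r'_def w'_def N'_def
    by (rule derivative_eq_intros hel_w_deriv jac_N_deriv refl | (use hel_w_pos[of A u] in simp; fail)
        | (use hel_w_pos[of A u] in \<open>simp add: algebra_simps power2_eq_square\<close>))+
  have V: "hel_V A u = 2 - 2 * A\<^sup>2 / w ^ 4" by (simp add: hel_V_def w_def)
  have g'V: "g' = hel_V A u * s * c"
  proof -
    have "g' * w ^ 4 = hel_V A u * s * c * w ^ 4"
    proof -
      have "g' * w ^ 4 = 4 * s * c * w ^ 4 - (1 + A\<^sup>2) * 2 * s * c * (c\<^sup>2 + s\<^sup>2) * w\<^sup>2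
          + (1 + A\<^sup>2) * s\<^sup>2 * c\<^sup>2 * (2 * w * w')"
        unfolding g'_def using pos by (simp add: field_simps power2_eq_square power4_eq_xxxx)
      also have "2 * w * w' = 2 * (1 + A\<^sup>2) * s * c" using pos by (simp add: w'_def)
      also have "4 * s * c * w ^ 4 - (1 + A\<^sup>2) * 2 * s * c * (c\<^sup>2 + s\<^sup>2) * w\<^sup>2
          + (1 + A\<^sup>2) * s\<^sup>2 * c\<^sup>2 * (2 * (1 + A\<^sup>2) * s * c)
        = s * c * (4 * (w\<^sup>2)\<^sup>2 - 2 * (1 + A\<^sup>2) * (c\<^sup>2 + s\<^sup>2) * w\<^sup>2 + 2 * (1 + A\<^sup>2)\<^sup>2 * s\<^sup>2 * c\<^sup>2)"
        by (simp add: algebra_simps power2_eq_square power4_eq_xxxx)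
      also have "\<dots> = s * c * (2 * (w\<^sup>2)\<^sup>2 - 2 * A\<^sup>2)"
        unfolding rel by (simp add: algebra_simps power2_eq_square)
      also have "\<dots> = hel_V A u * s * c * w ^ 4"
        unfolding V using pos by (simp add: field_simps)
      finally show ?thesis .
    qed
    then show ?thesis using pos by simp
  qed
  have "- g * N' - (r' * (c * w) - r * (s * w + c * w')) / ((c * w) * (c * w)) = w * hel_V A u"
  proof -
    have "(- g * N' - (r' * (c * w) - r * (s * w + c * w')) / ((c * w) * (c * w))) * (c\<^sup>2 * w ^ 3)
      = - ((c\<^sup>2 + s\<^sup>2) * w\<^sup>2 - (1 + A\<^sup>2) * s\<^sup>2 * c\<^sup>2) * ((A\<^sup>2 - 1) * c\<^sup>2 - 2 * A\<^sup>2 * s\<^sup>2)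
        - (r' * c * w\<^sup>2 - r * (s * w\<^sup>2 + c * (w * w')))"
      unfolding g_def N'_def using pos by (simp add: field_simps power2_eq_square power3_eq_cube)
    also have "w * w' = (1 + A\<^sup>2) * s * c" using pos by (simp add: w'_def)
    also have "- ((c\<^sup>2 + s\<^sup>2) * w\<^sup>2 - (1 + A\<^sup>2) * s\<^sup>2 * c\<^sup>2) * ((A\<^sup>2 - 1) * c\<^sup>2 - 2 * A\<^sup>2 * s\<^sup>2)
        - (r' * c * w\<^sup>2 - r * (s * w\<^sup>2 + c * ((1 + A\<^sup>2) * s * c)))
      = - ((c\<^sup>2 + s\<^sup>2) * w\<^sup>2 - (1 + A\<^sup>2) * s\<^sup>2 * c\<^sup>2) * ((A\<^sup>2 - 1) * c\<^sup>2 - 2 * A\<^sup>2 * s\<^sup>2)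
        - ((c\<^sup>2 * ((A\<^sup>2 - 1) * c\<^sup>2 - 2 * A\<^sup>2 * s\<^sup>2) + s\<^sup>2 * c\<^sup>2 * (2 * (A\<^sup>2 - 1) - 4 * A\<^sup>2)) * w\<^sup>2
          - s\<^sup>2 * ((A\<^sup>2 - 1) * c\<^sup>2 - 2 * A\<^sup>2 * s\<^sup>2) * (w\<^sup>2 + (1 + A\<^sup>2) * c\<^sup>2))"
      unfolding r_def r'_def by (simp add: algebra_simps power2_eq_square)
    also have "\<dots> = c\<^sup>2 * (2 * (w\<^sup>2)\<^sup>2 - 2 * A\<^sup>2)"
      unfolding rel by (simp add: algebra_simps power2_eq_square)
    also have "\<dots> = w * hel_V A u * (c\<^sup>2 * w ^ 3)"
      unfolding V using pos by (simp add: field_simps power2_eq_square power3_eq_cube power4_eq_xxxx)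
    finally show ?thesis using pos by simp
  qed
  then have "- g' * N - g * N' - (r' * (c * w) - r * (s * w + c * w')) / ((c * w) * (c * w))
      = w * hel_V A u - hel_V A u * s * c * N"
    by (simp add: g'V)
  also have "\<dots> = hel_w A u * hel_V A u * jac A u"
    using pos unfolding jac_def s_def[symmetric] c_def[symmetric] w_def[symmetric] N_def[symmetric]
    by (simp add: field_simps)
  finally show ?thesis using D by simp
qed

lemma jac_solves: "solves (\<lambda>u. 1 / hel_w A u) (\<lambda>u. hel_w A u * hel_V A u) (jac A) (jac_flux A)"
  unfolding solves_def using jac_deriv jac_flux_deriv
  by (auto simp: jac_def jac_flux_def jac_N_0)

lemma jac_even: "jac A (- u) = jac A u"
  by (simp add: jac_def jac_N_odd hel_w_even)

text \<open>The quotient of the even by the odd Jacobi function. Its derivative is minus the constant Wronskian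
  divided by \<open>w\<close> times a square, so it is decreasing, and its limit at infinity decides about the sign of \<open>jac\<close>.\<close>

definition jac_quot :: "real \<Rightarrow> real \<Rightarrow> real" where
  "jac_quot A u = hel_w A u / (sinh u * cosh u) - jac_N A u"

lemma jac_eq_quot: "u > 0 \<Longrightarrow> jac A u = sinh u * cosh u / hel_w A u * jac_quot A u"
  using hel_w_pos[of A u] by (simp add: jac_def jac_quot_def field_simps)

lemma jac_quot_deriv:
  assumes "u > 0"
  shows "(jac_quot A has_real_derivative - (hel_w A u / ((sinh u)\<^sup>2 * (cosh u)\<^sup>2))) (at u)"
proof -
  define s c w where "s = sinh u" and "c = cosh u" and "w = hel_w A u"
  have pos: "w > 0" "c > 0" "s > 0" using assms by (auto simp: w_def c_def s_def hel_w_pos)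
  have rel: "c\<^sup>2 = 1 + s\<^sup>2" "w\<^sup>2 = 1 + (1 + A\<^sup>2) * s\<^sup>2"
    by (auto simp: c_def s_def w_def cosh_sq hel_w_sq algebra_simps)
  have D: "(jac_quot A has_real_derivative
      ((1 + A\<^sup>2) * s * c / w * (s * c) - w * (c * c + s * s)) / ((s * c) * (s * c))
        - (A\<^sup>2 - 1 - 2 * A\<^sup>2 * (s / c)\<^sup>2) / w) (at u)"
    unfolding jac_quot_def using pos
    by (auto intro!: derivative_eq_intros hel_w_deriv jac_N_deriv simp: s_def c_def w_def mult_ac)
  have "(((1 + A\<^sup>2) * s * c / w * (s * c) - w * (c * c + s * s)) / ((s * c) * (s * c))
        - (A\<^sup>2 - 1 - 2 * A\<^sup>2 * (s / c)\<^sup>2) / w) * (w * s\<^sup>2 * c\<^sup>2)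
      = (1 + A\<^sup>2) * s\<^sup>2 * c\<^sup>2 - w\<^sup>2 * (c\<^sup>2 + s\<^sup>2) - s\<^sup>2 * ((A\<^sup>2 - 1) * c\<^sup>2 - 2 * A\<^sup>2 * s\<^sup>2)"
    using pos by (simp add: field_simps power2_eq_square)
  also have "\<dots> = - w\<^sup>2"
    unfolding rel by (simp add: algebra_simps power2_eq_square)
  also have "\<dots> = - (w / (s\<^sup>2 * c\<^sup>2)) * (w * s\<^sup>2 * c\<^sup>2)"
    using pos by (simp add: field_simps power2_eq_square)
  finally have "((1 + A\<^sup>2) * s * c / w * (s * c) - w * (c * c + s * s)) / ((s * c) * (s * c))
        - (A\<^sup>2 - 1 - 2 * A\<^sup>2 * (s / c)\<^sup>2) / w = - (w / (s\<^sup>2 * c\<^sup>2))"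
    by (rule mult_right_cancel[THEN iffD1, rotated]) (use pos in simp)
  with D show ?thesis by (simp add: s_def c_def w_def)
qed

lemma hel_w_le: "hel_w A u \<le> (1 + \<bar>A\<bar>) * cosh u"
proof -
  have "A\<^sup>2 * (sinh u)\<^sup>2 \<le> A\<^sup>2 * (cosh u)\<^sup>2" by (intro mult_left_mono) (auto simp: cosh_sq)
  moreover have "((1 + \<bar>A\<bar>) * cosh u)\<^sup>2 = (cosh u)\<^sup>2 + A\<^sup>2 * (cosh u)\<^sup>2 + 2 * \<bar>A\<bar> * (cosh u)\<^sup>2"
    by (simp add: power_mult_distrib power2_eq_square algebra_simps)
  moreover have "2 * \<bar>A\<bar> * (cosh u)\<^sup>2 \<ge> 0" by simp
  ultimately have "(cosh u)\<^sup>2 + A\<^sup>2 * (sinh u)\<^sup>2 \<le> ((1 + \<bar>A\<bar>) * cosh u)\<^sup>2"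
    by linarith
  then show ?thesis unfolding hel_w_def by (rule real_le_lsqrt[rotated]) simp
qed

lemma jac_quot_tendsto: "(jac_quot A \<longlongrightarrow> - ell_complete A) at_top"
proof -
  have "filterlim (sinh :: real \<Rightarrow> real) at_top at_top" by (rule sinh_real_at_top)
  then have "((\<lambda>u. (1 + \<bar>A\<bar>) * inverse (sinh u)) \<longlongrightarrow> (1 + \<bar>A\<bar>) * 0) at_top"
    by (intro tendsto_intros tendsto_inverse_0_at_top)
  then have lim: "((\<lambda>u. (1 + \<bar>A\<bar>) / sinh u) \<longlongrightarrow> 0) at_top"
    by (simp add: divide_inverse)
  have "((\<lambda>u. hel_w A u / (sinh u * cosh u)) \<longlongrightarrow> 0) at_top"
  proof (rule tendsto_sandwich[OF _ _ tendsto_const lim])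
    show "\<forall>\<^sub>F u in at_top. 0 \<le> hel_w A u / (sinh u * cosh u)"
      using eventually_gt_at_top[of 0] by eventually_elim (simp add: less_imp_le[OF hel_w_pos])
    show "\<forall>\<^sub>F u in at_top. hel_w A u / (sinh u * cosh u) \<le> (1 + \<bar>A\<bar>) / sinh u"
      using eventually_gt_at_top[of 0]
      by eventually_elim (use hel_w_le in \<open>simp add: divide_simps\<close>)
  qed
  from tendsto_diff[OF this jac_N_tendsto] show ?thesis
    unfolding jac_quot_def by simp
qed

lemma strictly_decreasing_above_limit:
  fixes f :: "real \<Rightarrow> real"
  assumes D: "\<And>u. u > 0 \<Longrightarrow> (f has_real_derivative f' u) (at u)" "\<And>u. u > 0 \<Longrightarrow> f' u < 0"
    and lim: "(f \<longlongrightarrow> l) at_top" and u: "u > 0"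
  shows "f u > l"
proof -
  have dec: "f y < f x" if "0 < x" "x < y" for x y
    by (rule DERIV_neg_imp_decreasing[OF that(2)]) (use D that in \<open>meson less_le_trans\<close>)
  have "l \<le> f (u + 1)"
    by (rule tendsto_upperbound[OF lim])
      (use dec[of "u + 1"] u in \<open>auto simp: eventually_at_top_dense intro!: exI[of _ "u + 1"] less_imp_le\<close>)
  also have "\<dots> < f u" using dec u by simp
  finally show ?thesis .
qed

lemma jac_quot_gt: "u > 0 \<Longrightarrow> jac_quot A u > - ell_complete A"
  by (rule strictly_decreasing_above_limit[OF jac_quot_deriv _ jac_quot_tendsto])
    (auto simp: hel_w_pos)

lemma jac_positive:
  assumes "ell_complete A \<le> 0"
  shows "jac A u > 0"
proof -
  have pos: "jac A u > 0" if "u > 0" for u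
    using jac_quot_gt[OF that, of A] assms hel_w_pos[of A u] that by (simp add: jac_eq_quot)
  consider "u > 0" | "u = 0" | "- u > 0" by linarith
  then show ?thesis
    by cases (use pos[of u] pos[of "- u"] in \<open>simp_all only: jac_even\<close>, simp add: jac_def)
qed

lemma jac_negative_somewhere:
  assumes "ell_complete A > 0"
  shows "\<exists>R>0. jac A R < 0"
proof -
  have "\<forall>\<^sub>F u in at_top. jac_quot A u < 0"
    using order_tendstoD(2)[OF jac_quot_tendsto, of A 0] assms by simp
  then have "\<forall>\<^sub>F u in at_top. u > 0 \<and> jac_quot A u < 0"
    using eventually_gt_at_top[of 0] by eventually_elim simp
  then obtain R where "R > 0" "jac_quot A R < 0"
    using eventually_happens'[OF trivial_limit_at_top_linorder] by blast
  then show ?thesis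
    using hel_w_pos[of A R] by (intro exI[of _ R]) (auto simp: jac_eq_quot intro!: divide_neg_pos mult_pos_neg)
qed

text \<open>The quotients \<open>jac_quot\<close> for two parameters agree in the limit \<open>u \<rightarrow> 0\<close>, while their derivatives
  \<open>- w / (sinh\<^sup>2 u cosh\<^sup>2 u)\<close> are strictly ordered because \<open>w\<close> increases with the parameter. So the limits
  at infinity are strictly ordered as well.\<close>

lemma ell_complete_strict_mono:
  assumes "0 \<le> A" "A < B"
  shows "ell_complete A < ell_complete B"
proof -
  define f where "f u = jac_quot B u - jac_quot A u" for u
  have wlt: "hel_w A u < hel_w B u" if "u > 0" for u
  proof -
    have "A\<^sup>2 < B\<^sup>2" using assms by (intro power_strict_mono) auto
    then show ?thesis using that by (simp add: hel_w_def)
  qed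
  have D: "(f has_real_derivative - ((hel_w B u - hel_w A u) / ((sinh u)\<^sup>2 * (cosh u)\<^sup>2))) (at u)" if "u > 0" for u
    unfolding f_def using jac_quot_deriv[OF that, of A] jac_quot_deriv[OF that, of B]
    by (auto intro!: derivative_eq_intros simp: diff_divide_distrib)
  have neg: "- ((hel_w B u - hel_w A u) / ((sinh u)\<^sup>2 * (cosh u)\<^sup>2)) < 0" if "u > 0" for u
    using wlt[OF that] that by simp
  have "f u \<le> 0" if u: "u > 0" for u
  proof -
    have eq: "f x = (B\<^sup>2 - A\<^sup>2) * (sinh x / cosh x) / (hel_w B x + hel_w A x) - jac_N B x + jac_N A x" if "x > 0" for x
    proof -
      have "(hel_w B x - hel_w A x) * (hel_w B x + hel_w A x) = (B\<^sup>2 - A\<^sup>2) * (sinh x)\<^sup>2"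
        using hel_w_sq[of B x] hel_w_sq[of A x] by (simp add: algebra_simps power2_eq_square)
      then have "hel_w B x - hel_w A x = (B\<^sup>2 - A\<^sup>2) * (sinh x)\<^sup>2 / (hel_w B x + hel_w A x)"
        using add_pos_pos[OF hel_w_pos[of B x] hel_w_pos[of A x]] by (simp add: eq_divide_eq)
      then have "(hel_w B x - hel_w A x) / (sinh x * cosh x) = (B\<^sup>2 - A\<^sup>2) * (sinh x / cosh x) / (hel_w B x + hel_w A x)"
        using that by (simp add: power2_eq_square)
      then show ?thesis by (simp add: f_def jac_quot_def diff_divide_distrib)
    qed
    have "isCont (\<lambda>x. (B\<^sup>2 - A\<^sup>2) * (sinh x / cosh x) / (hel_w B x + hel_w A x) - jac_N B x + jac_N A x) 0"
      by (intro isCont_add isCont_diff isCont_mult isCont_divide DERIV_isCont[OF hel_w_deriv]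
          DERIV_isCont[OF jac_N_deriv] DERIV_isCont[OF has_field_derivative_sinh[OF DERIV_ident]]
          DERIV_isCont[OF has_field_derivative_cosh[OF DERIV_ident]] continuous_const) (simp_all add: hel_w_0)
    then have "((\<lambda>x. (B\<^sup>2 - A\<^sup>2) * (sinh x / cosh x) / (hel_w B x + hel_w A x) - jac_N B x + jac_N A x)
        \<longlongrightarrow> 0) (at_right 0)"
      unfolding isCont_def by (rule tendsto_within_subset[OF _ subset_UNIV, THEN tendsto_eq_rhs]) (simp add: jac_N_0)
    then have "(f \<longlongrightarrow> 0) (at_right 0)"
      by (rule Lim_transform_eventually) (auto simp: eventually_at_filter eq)
    moreover have "\<forall>\<^sub>F x in at_right 0. f u \<le> f x"
    proof -
      have "f u \<le> f x" if "0 < x" "x < u" for x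
      proof -
        have "f u < f x"
          by (rule DERIV_neg_imp_decreasing[OF that(2)]) (use D neg that in \<open>meson less_le_trans\<close>)
        then show ?thesis by simp
      qed
      then show ?thesis using u unfolding eventually_at_right_field by blast
    qed
    ultimately show ?thesis by (intro tendsto_lowerbound[of f 0 "at_right 0"]) auto
  qed
  moreover have "(f \<longlongrightarrow> - ell_complete B - - ell_complete A) at_top"
    unfolding f_def by (intro tendsto_diff jac_quot_tendsto)
  from strictly_decreasing_above_limit[OF D neg this, of 1]
  have "f 1 > - ell_complete B - - ell_complete A" by simp
  ultimately have "ell_complete A - ell_complete B < 0"
    by (smt (verit) zero_less_one)
  then show ?thesis by simp
qed

section \<open>Strict subsolutions of the Riccati equation\<close>

text \<open>The primitive of the weight \<open>w jac\<^sup>2\<close>. Bounding it by the weight itself is what turns positivity of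
  \<open>jac\<close> into a spectral gap.\<close>

definition jac_mass :: "real \<Rightarrow> real \<Rightarrow> real" where
  "jac_mass A = antiderivative (\<lambda>u. hel_w A u * (jac A u)\<^sup>2)"

lemma jac_cont: "continuous_on S (jac A)"
  using jac_deriv DERIV_isCont continuous_at_imp_continuous_on by blast

lemma jac_flux_cont: "continuous_on S (jac_flux A)"
  using jac_flux_deriv DERIV_isCont continuous_at_imp_continuous_on by blast

lemma jac_density_cont: "continuous_on S (\<lambda>u. hel_w A u * (jac A u)\<^sup>2)"
  by (intro continuous_intros hel_w_cont jac_cont)

lemma jac_mass_0: "jac_mass A 0 = 0"
  and jac_mass_deriv: "(jac_mass A has_real_derivative hel_w A u * (jac A u)\<^sup>2) (at u)"
  unfolding jac_mass_def using antiderivative[OF jac_density_cont] by auto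

lemma jac_mass_cont: "continuous_on S (jac_mass A)"
  using jac_mass_deriv DERIV_isCont continuous_at_imp_continuous_on by blast

lemma jac_mass_odd: "jac_mass A (- u) = - jac_mass A u"
proof -
  have "((\<lambda>u. jac_mass A u + jac_mass A (- u)) has_real_derivative 0) (at u)" for u
    using DERIV_add[OF jac_mass_deriv[of A u] jac_mass_deriv[of A "- u", unfolded DERIV_mirror]]
    by (simp add: hel_w_even jac_even)
  then have "jac_mass A u + jac_mass A (- u) = jac_mass A 0 + jac_mass A (- 0)"
    using DERIV_isconst_all by blast
  then show ?thesis by (simp add: jac_mass_0)
qed

lemma jac_mass_bound_local:
  assumes "ell_complete A \<le> 0"
  shows "\<exists>K\<ge>1. \<forall>u\<in>{a..b}. \<bar>jac_mass A u\<bar> \<le> K * (hel_w A u * (jac A u)\<^sup>2)"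
proof -
  have pos: "hel_w A u * (jac A u)\<^sup>2 > 0" for u
    using hel_w_pos[of A u] jac_positive[OF assms, of u] by simp
  have "continuous_on UNIV (\<lambda>u. jac_mass A u / (hel_w A u * (jac A u)\<^sup>2))"
    by (intro continuous_on_divide jac_mass_cont jac_density_cont ballI) (use pos in \<open>metis less_irrefl\<close>)
  then obtain K where K: "\<forall>u\<in>{a..b}. \<bar>jac_mass A u / (hel_w A u * (jac A u)\<^sup>2)\<bar> \<le> K"
    using continuous_bounded_on_interval by blast
  have "\<bar>jac_mass A u\<bar> \<le> max K 1 * (hel_w A u * (jac A u)\<^sup>2)" if "u \<in> {a..b}" for u
  proof -
    have "\<bar>jac_mass A u\<bar> / (hel_w A u * (jac A u)\<^sup>2) \<le> max K 1"
    proof -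
      have "\<bar>jac_mass A u\<bar> / (hel_w A u * (jac A u)\<^sup>2) = \<bar>jac_mass A u / (hel_w A u * (jac A u)\<^sup>2)\<bar>"
        using pos[of u] by (simp only: abs_divide abs_of_pos)
      also have "\<dots> \<le> K" using K that by blast
      finally show ?thesis by simp
    qed
    then show ?thesis using pos[of u] by (simp add: pos_divide_le_eq)
  qed
  then show ?thesis by (intro exI[of _ "max K 1"]) auto
qed

text \<open>If \<open>ell_complete A < 0\<close>, then \<open>jac_quot\<close> stays between positive constants on \<open>[1, \<infinity>)\<close>, so the weight
  is comparable to \<open>y = sinh\<^sup>2 u cosh\<^sup>2 u / w\<close>. As \<open>y' \<ge> y\<close>, the primitive of \<open>y\<close> is at most \<open>y\<close> up to a
  constant.\<close>

lemma jac_mass_bound_global: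
  assumes neg: "ell_complete A < 0"
  shows "\<exists>K\<ge>1. \<forall>u. \<bar>jac_mass A u\<bar> \<le> K * (hel_w A u * (jac A u)\<^sup>2)"
proof -
  define c where "c = - ell_complete A"
  have c: "c > 0" using neg by (simp add: c_def)
  define y where "y u = (sinh u)\<^sup>2 * (cosh u)\<^sup>2 / hel_w A u" for u
  have density: "hel_w A u * (jac A u)\<^sup>2 = y u * (jac_quot A u)\<^sup>2" if "u > 0" for u
    using that hel_w_pos[of A u]
    by (simp add: jac_eq_quot y_def power_mult_distrib power_divide) (simp add: power2_eq_square)
  have quot: "jac_quot A u > c" if "u > 0" for u
    using jac_quot_gt[OF that] by (simp add: c_def)
  have quot_le: "jac_quot A u \<le> jac_quot A 1" if "u \<ge> 1" for u
  proof (rule DERIV_nonpos_imp_nonincreasing[OF that])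
    fix x :: real assume "1 \<le> x" "x \<le> u"
    then show "\<exists>y. (jac_quot A has_real_derivative y) (at x) \<and> y \<le> 0"
      using jac_quot_deriv[of x A] hel_w_pos[of A x]
      by (intro exI[of _ "- (hel_w A x / ((sinh x)\<^sup>2 * (cosh x)\<^sup>2))"]) auto
  qed
  have y_pos: "y u > 0" if "u > 0" for u using that hel_w_pos[of A u] by (simp add: y_def)
  have y_deriv: "\<exists>y'. (y has_real_derivative y') (at u) \<and> y' \<ge> y u" if u: "u > 0" for u
  proof -
    define s d w where "s = sinh u" and "d = cosh u" and "w = hel_w A u"
    have pos: "w > 0" "d > 0" "s > 0" using u by (auto simp: w_def d_def s_def hel_w_pos)
    define y' where "y' = s * d / w * (2 * (d\<^sup>2 + s\<^sup>2) - (1 + A\<^sup>2) * s\<^sup>2 * d\<^sup>2 / w\<^sup>2)"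
    have "(y has_real_derivative
        ((2 * s * d * d\<^sup>2 + s\<^sup>2 * (2 * d * s)) * w - s\<^sup>2 * d\<^sup>2 * ((1 + A\<^sup>2) * s * d / w)) / (w * w)) (at u)"
      unfolding y_def using pos
      by (auto intro!: derivative_eq_intros hel_w_deriv simp: s_def d_def w_def algebra_simps)
    also have "((2 * s * d * d\<^sup>2 + s\<^sup>2 * (2 * d * s)) * w - s\<^sup>2 * d\<^sup>2 * ((1 + A\<^sup>2) * s * d / w)) / (w * w) = y'"
      unfolding y'_def using pos by (simp add: field_simps power2_eq_square)
    finally have D: "(y has_real_derivative y') (at u)" .
    have "s < d" using cosh_minus_sinh[of u] exp_gt_zero[of "- u"] unfolding s_def d_def by linarith
    have "(1 + A\<^sup>2) * s\<^sup>2 * d\<^sup>2 / w\<^sup>2 \<le> d\<^sup>2"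
    proof -
      have "(1 + A\<^sup>2) * s\<^sup>2 \<le> w\<^sup>2" by (simp add: w_def s_def hel_w_sq cosh_sq algebra_simps)
      then have "(1 + A\<^sup>2) * s\<^sup>2 * d\<^sup>2 \<le> w\<^sup>2 * d\<^sup>2" by (intro mult_right_mono) auto
      then show ?thesis using pos by (simp add: pos_divide_le_eq mult.commute)
    qed
    moreover have "s * d \<le> d * d" using pos \<open>s < d\<close> by (intro mult_right_mono) auto
    moreover have "s\<^sup>2 \<ge> 0" by simp
    ultimately have "s * d \<le> 2 * (d\<^sup>2 + s\<^sup>2) - (1 + A\<^sup>2) * s\<^sup>2 * d\<^sup>2 / w\<^sup>2"
      unfolding power2_eq_square[of d] by argo
    then have "s * d / w * (s * d) \<le> y'"
      unfolding y'_def using pos by (intro mult_left_mono) auto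
    moreover have "y u = s * d / w * (s * d)"
      by (simp add: y_def s_def d_def w_def power2_eq_square)
    ultimately show ?thesis using D by auto
  qed
  have y_mono: "y 1 \<le> y u" if "u \<ge> 1" for u
  proof (rule DERIV_nonneg_imp_nondecreasing[OF that])
    fix x :: real assume "1 \<le> x" "x \<le> u"
    then have x: "x > 0" by simp
    show "\<exists>z. (y has_real_derivative z) (at x) \<and> 0 \<le> z"
      using y_deriv[OF x] y_pos[OF x] by force
  qed
  obtain K0 where K0: "K0 \<ge> 1" "\<forall>u\<in>{0..1}. \<bar>jac_mass A u\<bar> \<le> K0 * (hel_w A u * (jac A u)\<^sup>2)"
    using jac_mass_bound_local[of A 0 1] neg by auto
  define K1 where "K1 = (\<bar>jac_mass A 1\<bar> / y 1 + (jac_quot A 1)\<^sup>2) / c\<^sup>2"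
  have upper: "jac_mass A u \<le> K1 * (hel_w A u * (jac A u)\<^sup>2)" if u: "u \<ge> 1" for u
  proof -
    have "jac_mass A u - (jac_quot A 1)\<^sup>2 * y u \<le> jac_mass A 1 - (jac_quot A 1)\<^sup>2 * y 1"
    proof (rule DERIV_nonpos_imp_nonincreasing[OF u])
      fix x assume x: "1 \<le> x" "x \<le> u"
      then obtain y' where y': "(y has_real_derivative y') (at x)" "y' \<ge> y x"
        using y_deriv[of x] by auto
      have D: "((\<lambda>u. jac_mass A u - (jac_quot A 1)\<^sup>2 * y u) has_real_derivative
          hel_w A x * (jac A x)\<^sup>2 - (jac_quot A 1)\<^sup>2 * y') (at x)"
        by (auto intro!: derivative_eq_intros jac_mass_deriv y')
      have "y x * (jac_quot A x)\<^sup>2 \<le> y' * (jac_quot A 1)\<^sup>2"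
        using y' y_pos[of x] x quot[of x] c quot_le[of x] by (intro mult_mono power_mono) auto
      then have "hel_w A x * (jac A x)\<^sup>2 - (jac_quot A 1)\<^sup>2 * y' \<le> 0"
        using x by (simp add: density mult.commute)
      with D show "\<exists>z. ((\<lambda>u. jac_mass A u - (jac_quot A 1)\<^sup>2 * y u) has_real_derivative z) (at x) \<and> z \<le> 0"
        by blast
    qed
    moreover have "(jac_quot A 1)\<^sup>2 * y 1 \<ge> 0" using y_pos[of 1] by simp
    ultimately have "jac_mass A u \<le> \<bar>jac_mass A 1\<bar> + (jac_quot A 1)\<^sup>2 * y u" by linarith
    also have "\<bar>jac_mass A 1\<bar> \<le> \<bar>jac_mass A 1\<bar> / y 1 * y u"
      using y_mono[OF u] y_pos[of 1] mult_left_mono[OF y_mono[OF u], of "\<bar>jac_mass A 1\<bar>"]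
      by (simp add: pos_le_divide_eq)
    also have "\<bar>jac_mass A 1\<bar> / y 1 * y u + (jac_quot A 1)\<^sup>2 * y u = K1 * (y u * c\<^sup>2)"
      using c by (simp add: K1_def field_simps)
    also have "\<dots> \<le> K1 * (y u * (jac_quot A u)\<^sup>2)"
    proof (rule mult_left_mono)
      show "y u * c\<^sup>2 \<le> y u * (jac_quot A u)\<^sup>2"
        using y_pos[of u] u quot[of u] c by (intro mult_left_mono power_mono) auto
      show "0 \<le> K1" using y_pos[of 1] c by (simp add: K1_def)
    qed
    finally show ?thesis using u by (simp add: density)
  qed
  have lower: "jac_mass A u \<ge> 0" if "u \<ge> 0" for u
  proof -
    have "jac_mass A 0 \<le> jac_mass A u"
    proof (rule DERIV_nonneg_imp_nondecreasing[OF that])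
      fix x show "\<exists>z. (jac_mass A has_real_derivative z) (at x) \<and> 0 \<le> z"
        using jac_mass_deriv hel_w_pos[of A x]
        by (intro exI[of _ "hel_w A x * (jac A x)\<^sup>2"]) auto
    qed
    then show ?thesis by (simp add: jac_mass_0)
  qed
  define K where "K = max K0 K1"
  have dens_nonneg: "hel_w A u * (jac A u)\<^sup>2 \<ge> 0" for u using hel_w_pos[of A u] by simp
  have pos_case: "\<bar>jac_mass A u\<bar> \<le> K * (hel_w A u * (jac A u)\<^sup>2)" if u: "u \<ge> 0" for u
  proof (cases "u \<le> 1")
    case True
    then have "\<bar>jac_mass A u\<bar> \<le> K0 * (hel_w A u * (jac A u)\<^sup>2)" using K0 u by auto
    also have "\<dots> \<le> K * (hel_w A u * (jac A u)\<^sup>2)"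
      by (intro mult_right_mono dens_nonneg) (simp add: K_def)
    finally show ?thesis .
  next
    case False
    then have "jac_mass A u \<le> K1 * (hel_w A u * (jac A u)\<^sup>2)" using upper by simp
    also have "\<dots> \<le> K * (hel_w A u * (jac A u)\<^sup>2)"
      by (intro mult_right_mono dens_nonneg) (simp add: K_def)
    finally show ?thesis using lower[OF u] by simp
  qed
  have "\<bar>jac_mass A u\<bar> \<le> K * (hel_w A u * (jac A u)\<^sup>2)" for u
    using pos_case[of u] pos_case[of "- u"] by (cases "u \<ge> 0") (simp_all add: jac_mass_odd hel_w_even jac_even)
  then show ?thesis using K0 by (intro exI[of _ K]) (auto simp: K_def)
qed

text \<open>With \<open>Z = jac_mass\<close>, the function \<open>P\<close> is \<open>w\<close> times the logarithmic derivative of \<open>jac * exp (- e h)\<close>,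
  where \<open>h' = Z / (w jac\<^sup>2)\<close>. For \<open>e = 0\<close> it solves the Riccati equation. The perturbation gains
  \<open>e w\<close> and loses \<open>e\<^sup>2 Z\<^sup>2 / (w jac\<^sup>4) \<le> e\<^sup>2 K\<^sup>2 w\<close>, and \<open>e = 1 / (2 K\<^sup>2)\<close> makes the difference
  \<open>w / (4 K\<^sup>2)\<close>.\<close>

lemma riccati_subsolution:
  assumes neg: "ell_complete A \<le> 0" and K: "K \<ge> 1"
    and S: "\<And>u. u \<in> S \<Longrightarrow> \<bar>jac_mass A u\<bar> \<le> K * (hel_w A u * (jac A u)\<^sup>2)"
  shows "\<exists>P P'. (\<forall>u. (P has_real_derivative P' u) (at u)) \<and> continuous_on UNIV P' \<and>
    (\<forall>u\<in>S. P' u + (P u)\<^sup>2 / hel_w A u \<le> (hel_V A u - 1 / (4 * K\<^sup>2)) * hel_w A u)"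
proof -
  define e where "e = 1 / (2 * K\<^sup>2)"
  define P where "P u = jac_flux A u / jac A u - e * (jac_mass A u / (jac A u)\<^sup>2)" for u
  define P' where "P' u = hel_w A u * hel_V A u - (jac_flux A u)\<^sup>2 / (hel_w A u * (jac A u)\<^sup>2)
      - e * (hel_w A u - 2 * jac_mass A u * jac_flux A u / (hel_w A u * (jac A u) ^ 3))" for u
  have pos: "jac A u > 0" for u by (rule jac_positive[OF neg])
  note w = hel_w_pos
  have "(P has_real_derivative P' u) (at u)" for u
  proof -
    have "(P has_real_derivative
       (hel_w A u * hel_V A u * jac A u * jac A u - jac_flux A u * (1 / hel_w A u * jac_flux A u)) / (jac A u * jac A u)
       - e * ((hel_w A u * (jac A u)\<^sup>2 * (jac A u)\<^sup>2 - jac_mass A u * (2 * jac A u * (1 / hel_w A u * jac_flux A u)))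
          / ((jac A u)\<^sup>2 * (jac A u)\<^sup>2))) (at u)"
      unfolding P_def using pos[of u]
      by (auto intro!: derivative_eq_intros jac_deriv jac_flux_deriv jac_mass_deriv simp: algebra_simps)
    also have "(hel_w A u * hel_V A u * jac A u * jac A u - jac_flux A u * (1 / hel_w A u * jac_flux A u)) / (jac A u * jac A u)
       - e * ((hel_w A u * (jac A u)\<^sup>2 * (jac A u)\<^sup>2 - jac_mass A u * (2 * jac A u * (1 / hel_w A u * jac_flux A u)))
          / ((jac A u)\<^sup>2 * (jac A u)\<^sup>2)) = P' u"
      unfolding P'_def using pos[of u] w[of A u]
      by (simp add: diff_divide_distrib power2_eq_square power3_eq_cube mult_ac)
    finally show ?thesis .
  qed
  moreover have "continuous_on UNIV P'"
    unfolding P'_def using pos w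
    by (intro continuous_intros hel_w_cont hel_V_cont jac_flux_cont jac_cont jac_mass_cont)
      (auto simp: less_imp_neq[symmetric])
  moreover have "P' u + (P u)\<^sup>2 / hel_w A u \<le> (hel_V A u - 1 / (4 * K\<^sup>2)) * hel_w A u" if "u \<in> S" for u
  proof -
    define Z f p ww where "Z = jac_mass A u" and "f = jac_flux A u" and "p = jac A u" and "ww = hel_w A u"
    have pw: "p > 0" "ww > 0" using pos w by (auto simp: p_def ww_def)
    have "P' u + (P u)\<^sup>2 / ww = ww * hel_V A u - e * ww + e\<^sup>2 * (Z\<^sup>2 / (ww * p ^ 4))"
      unfolding P'_def P_def Z_def[symmetric] f_def[symmetric] p_def[symmetric] ww_def[symmetric]
      using pw by (simp add: field_simps power2_eq_square power3_eq_cube power4_eq_xxxx)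
    also have "e\<^sup>2 * (Z\<^sup>2 / (ww * p ^ 4)) \<le> e\<^sup>2 * (K\<^sup>2 * ww)"
    proof (rule mult_left_mono)
      have "\<bar>Z\<bar>\<^sup>2 \<le> (K * (ww * p\<^sup>2))\<^sup>2"
        using S[OF that] by (intro power_mono) (auto simp: Z_def p_def ww_def)
      then show "Z\<^sup>2 / (ww * p ^ 4) \<le> K\<^sup>2 * ww"
        using pw by (simp add: pos_divide_le_eq power_mult_distrib power2_eq_square power4_eq_xxxx mult_ac)
    qed simp
    also have "ww * hel_V A u - e * ww + e\<^sup>2 * (K\<^sup>2 * ww) = (hel_V A u - 1 / (4 * K\<^sup>2)) * ww"
      using K by (simp add: e_def field_simps power2_eq_square)
    finally show ?thesis by (simp add: ww_def)
  qed
  ultimately show ?thesis by blast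
qed

section \<open>The Ricci curvature of the hyperboloid\<close>

lemma vector_4 [simp]:
  "(vector [x, y, z, w] :: 'a::zero^4) $ 1 = x"
  "(vector [x, y, z, w] :: 'a::zero^4) $ 2 = y"
  "(vector [x, y, z, w] :: 'a::zero^4) $ 3 = z"
  "(vector [x, y, z, w] :: 'a::zero^4) $ 4 = w"
  unfolding vector_def by simp_all

lemma matrix_inv_eq:
  fixes M B :: "real^'n^'n"
  assumes "M ** B = mat 1" "B ** M = mat 1"
  shows "matrix_inv M = B"
proof -
  have inv: "M ** matrix_inv M = mat 1"
    using someI[of "\<lambda>B. M ** B = mat 1 \<and> B ** M = mat 1" B] assms unfolding matrix_inv_def by auto
  have "B = B ** (M ** matrix_inv M)" by (simp add: inv)
  also have "\<dots> = matrix_inv M" by (simp add: matrix_mul_assoc assms(2))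
  finally show ?thesis by simp
qed

lemma inner_3: "(x::real^3) \<bullet> y = x$1 * y$1 + x$2 * y$2 + x$3 * y$3"
  by (simp add: inner_vec_def sum_3)

definition hyp_r :: "real^3 \<Rightarrow> real" where
  "hyp_r q = 1 / (1 + q \<bullet> q)"

lemma one_plus_inner_pos: "1 + q \<bullet> q > (0::real)"
  by (meson add_pos_nonneg inner_ge_zero zero_less_one)

lemma hyp_r_mult: "(q \<bullet> q) * hyp_r q = 1 - hyp_r q"
  using one_plus_inner_pos[of q] by (simp add: hyp_r_def field_simps)

definition kronecker :: "'a \<Rightarrow> 'a \<Rightarrow> real" where
  "kronecker i j = (if i = j then 1 else 0)"

lemma kronecker_refl: "kronecker i i = 1"
  by (simp add: kronecker_def)

lemma inner_self_deriv: "((\<lambda>q::real^3. q \<bullet> q) has_derivative (\<lambda>h. 2 * (p \<bullet> h))) (at p)"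
  by (auto intro!: derivative_eq_intros simp: inner_commute)

lemma pd_inner_self: "pd i (\<lambda>q::real^3. q \<bullet> q) p = 2 * p $ i"
  "(\<lambda>q::real^3. q \<bullet> q) differentiable at p"
  using has_derivative_pd[OF inner_self_deriv] inner_self_deriv
  by (auto simp: inner_axis differentiable_def)

lemma pd_hyp_r: "pd i hyp_r p = - 2 * p $ i * (hyp_r p)\<^sup>2" "hyp_r differentiable at p"
proof -
  have "((\<lambda>x. 1 / (1 + x)) has_real_derivative - ((hyp_r p)\<^sup>2)) (at (p \<bullet> p))"
    using one_plus_inner_pos[of p]
    by (auto intro!: derivative_eq_intros simp: hyp_r_def power2_eq_square)
  from pd_compose[OF pd_inner_self(2) this]
  show "pd i hyp_r p = - 2 * p $ i * (hyp_r p)\<^sup>2" "hyp_r differentiable at p"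
    by (simp_all add: pd_inner_self hyp_r_def[abs_def] mult_ac)
qed

lemma pd_hyp_chart_first:
  "pd i (\<lambda>q::real^3. sqrt (1 + q \<bullet> q)) p = p $ i / sqrt (1 + p \<bullet> p)"
  "(\<lambda>q::real^3. sqrt (1 + q \<bullet> q)) differentiable at p"
proof -
  have "((\<lambda>x. sqrt (1 + x)) has_real_derivative 1 / (2 * sqrt (1 + p \<bullet> p))) (at (p \<bullet> p))"
    using one_plus_inner_pos[of p] by (auto intro!: derivative_eq_intros simp: field_simps)
  from pd_compose[OF pd_inner_self(2) this]
  show "pd i (\<lambda>q::real^3. sqrt (1 + q \<bullet> q)) p = p $ i / sqrt (1 + p \<bullet> p)"
    "(\<lambda>q::real^3. sqrt (1 + q \<bullet> q)) differentiable at p"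
    by (simp_all add: pd_inner_self)
qed

text \<open>The coefficients of the metric in the graph chart.\<close>

definition hyp_G :: "3 \<Rightarrow> 3 \<Rightarrow> real^3 \<Rightarrow> real" where
  "hyp_G i j q = kronecker i j - q $ i * q $ j * hyp_r q"

lemma hyp_chart_metric:
  "induced_metric hyp_chart p = (\<chi> i j. hyp_G i j p)"
proof -
  have diff: "hyp_chart differentiable at p"
  proof (rule differentiable_components)
    fix k :: 4
    show "(\<lambda>q. hyp_chart q $ k) differentiable at p"
      using exhaust_4[of k]
      by (auto simp: hyp_chart_def coord_differentiable pd_hyp_chart_first(2))
  qed
  have comp: "pd i hyp_chart p $ 1 = p $ i / sqrt (1 + p \<bullet> p)" "pd i hyp_chart p $ 2 = kronecker i 1"
    "pd i hyp_chart p $ 3 = kronecker i 2" "pd i hyp_chart p $ 4 = kronecker i 3" for i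
    by (simp_all add: pd_component[OF diff] hyp_chart_def pd_hyp_chart_first pd_coord kronecker_def)
  have "p $ i / sqrt (1 + p \<bullet> p) * (p $ j / sqrt (1 + p \<bullet> p)) = p $ i * p $ j * hyp_r p" for i j
    using one_plus_inner_pos[of p] by (simp add: hyp_r_def)
  moreover have "kronecker i 1 * kronecker j 1 + kronecker i 2 * kronecker j 2 + kronecker i 3 * kronecker j 3 = kronecker i j" for i j :: 3
    using exhaust_3[of i] exhaust_3[of j] by (auto simp: kronecker_def)
  ultimately show ?thesis
    by (simp add: induced_metric_def lorentz_def comp vec_eq_iff hyp_G_def add.assoc)
qed

lemma hyp_metric_inverse:
  "matrix_inv (induced_metric hyp_chart p) = (\<chi> i j. kronecker i j + p $ i * p $ j)"
proof (rule matrix_inv_eq)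
  define y1 y2 y3 r where "y1 = p$1" "y2 = p$2" "y3 = p$3" "r = hyp_r p"
  have r: "(y1 * y1 + y2 * y2 + y3 * y3) * r = 1 - r"
    using hyp_r_mult[of p] by (simp add: inner_3 y1_y2_y3_r_def)
  have "(\<Sum>k\<in>UNIV. hyp_G i k p * (kronecker k j + p $ k * p $ j)) = kronecker i j" for i j
  proof -
    have "(\<Sum>k\<in>UNIV. hyp_G i k p * (kronecker k j + p $ k * p $ j))
      = kronecker i j + p $ i * p $ j * (1 - r - (y1 * y1 + y2 * y2 + y3 * y3) * r)"
      using exhaust_3[of i] exhaust_3[of j]
      by (elim disjE) (simp_all add: sum_3 hyp_G_def kronecker_def y1_y2_y3_r_def algebra_simps)
    then show ?thesis by (simp add: r)
  qed
  then show "induced_metric hyp_chart p ** (\<chi> i j. kronecker i j + p $ i * p $ j) = mat 1"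
    by (simp add: hyp_chart_metric matrix_matrix_mult_def vec_eq_iff mat_def kronecker_def)
  have "(\<Sum>k\<in>UNIV. (kronecker i k + p $ i * p $ k) * hyp_G k j p) = kronecker i j" for i j
  proof -
    have "(\<Sum>k\<in>UNIV. (kronecker i k + p $ i * p $ k) * hyp_G k j p)
      = kronecker i j + p $ i * p $ j * (1 - r - (y1 * y1 + y2 * y2 + y3 * y3) * r)"
      using exhaust_3[of i] exhaust_3[of j]
      by (elim disjE) (simp_all add: sum_3 hyp_G_def kronecker_def y1_y2_y3_r_def algebra_simps)
    then show ?thesis by (simp add: r)
  qed
  then show "(\<chi> i j. kronecker i j + p $ i * p $ j) ** induced_metric hyp_chart p = mat 1"
    by (simp add: hyp_chart_metric matrix_matrix_mult_def vec_eq_iff mat_def kronecker_def)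
qed

text \<open>The partial derivatives of the metric coefficients.\<close>

definition hyp_D :: "3 \<Rightarrow> 3 \<Rightarrow> 3 \<Rightarrow> real^3 \<Rightarrow> real" where
  "hyp_D l i j p = - (kronecker l i * p $ j + kronecker l j * p $ i) * hyp_r p + 2 * p $ i * p $ j * p $ l * (hyp_r p)\<^sup>2"

lemma hyp_G_differentiable: "hyp_G i j differentiable at p"
  unfolding hyp_G_def[abs_def]
  by (intro differentiable_diff differentiable_mult coord_differentiable pd_hyp_r differentiable_const)

lemma pd_hyp_G: "pd l (hyp_G i j) p = hyp_D l i j p"
proof -
  have "hyp_G i j = (\<lambda>q. kronecker i j + (- 1) * (q $ i * q $ j) * hyp_r q)" by (rule ext) (simp add: hyp_G_def)
  moreover have "pd l (\<lambda>q. kronecker i j + (- 1) * (q $ i * q $ j) * hyp_r q) p = hyp_D l i j p"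
    by (subst pd_add pd_mult;
        (intro differentiable_mult coord_differentiable pd_hyp_r differentiable_const differentiable_minus)?)+
      (simp add: pd_coord pd_hyp_r hyp_D_def kronecker_def algebra_simps)
  ultimately show ?thesis by simp
qed

text \<open>The second derivatives of the chart have the normal part \<open>G\<^sub>i\<^sub>j x\<close>, where \<open>x\<close> is the position vector;
  since their last three components vanish, the tangential part must cancel it in these components.\<close>

lemma hyp_christoffel:
  "christoffel (induced_metric hyp_chart) k i j p = - p $ k * hyp_G i j p"
proof -
  define y1 y2 y3 r where "y1 = p$1" "y2 = p$2" "y3 = p$3" "r = hyp_r p"
  have r: "(y1 * y1 + y2 * y2 + y3 * y3) * r = 1 - r"
    using hyp_r_mult[of p] by (simp add: inner_3 y1_y2_y3_r_def)
  have D: "hyp_D i j l p + hyp_D j i l p - hyp_D l i j p = - 2 * p $ l * (hyp_G i j p * r)" for l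
    by (auto simp: hyp_D_def hyp_G_def kronecker_def y1_y2_y3_r_def algebra_simps power2_eq_square)
  have "christoffel (induced_metric hyp_chart) k i j p
      = (1/2) * (\<Sum>l\<in>UNIV. (kronecker k l + p $ k * p $ l) * (- 2 * p $ l * (hyp_G i j p * r)))"
    unfolding christoffel_def hyp_metric_inverse by (simp add: hyp_chart_metric pd_hyp_G D)
  also have "\<dots> = (1/2) * ((- 2 * (hyp_G i j p * r)) * (\<Sum>l\<in>UNIV. (kronecker k l + p $ k * p $ l) * p $ l))"
    by (simp add: sum_distrib_left mult_ac)
  also have "(\<Sum>l\<in>UNIV. (kronecker k l + p $ k * p $ l) * p $ l) = p $ k * (1 + (y1 * y1 + y2 * y2 + y3 * y3))"
    using exhaust_3[of k]
    by (elim disjE) (simp_all add: sum_3 kronecker_def y1_y2_y3_r_def algebra_simps)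
  also have "(1/2) * ((- 2 * (hyp_G i j p * r)) * (p $ k * (1 + (y1 * y1 + y2 * y2 + y3 * y3))))
    = - p $ k * hyp_G i j p * (r + (y1 * y1 + y2 * y2 + y3 * y3) * r)"
    by (simp add: algebra_simps)
  finally show ?thesis by (simp add: r)
qed

text \<open>The hyperboloid has constant sectional curvature \<open>- 1\<close>.\<close>

lemma hyp_ricci:
  "ricci (induced_metric hyp_chart) p $ j $ k = - 2 * hyp_G j k p"
proof -
  define y1 y2 y3 r where "y1 = p$1" "y2 = p$2" "y3 = p$3" "r = hyp_r p"
  define Q where "Q = y1 * y1 + y2 * y2 + y3 * y3"
  have r: "Q * r = 1 - r"
    using hyp_r_mult[of p] by (simp add: inner_3 y1_y2_y3_r_def Q_def)
  have chr: "christoffel (induced_metric hyp_chart) k i j = (\<lambda>p. - p $ k * hyp_G i j p)" for k i j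
    by (rule ext) (rule hyp_christoffel)
  have pdchr: "pd l (\<lambda>p. - p $ k * hyp_G i j p) p = - kronecker l k * hyp_G i j p - p $ k * hyp_D l i j p" for l k i j
  proof -
    have "pd l (\<lambda>p. (- 1 * p $ k) * hyp_G i j p) p = (- 1 * p $ k) * pd l (hyp_G i j) p + pd l (\<lambda>p. - 1 * p $ k) p * hyp_G i j p"
      by (rule pd_mult) (intro differentiable_mult coord_differentiable differentiable_const hyp_G_differentiable)+
    moreover have "pd l (\<lambda>p::real^3. - 1 * p $ k) p = - kronecker l k"
      by (subst pd_mult) (auto simp: coord_differentiable pd_coord kronecker_def)
    ultimately show ?thesis by (simp add: pd_hyp_G)
  qed
  have a: "(\<Sum>i\<in>UNIV. p $ i * hyp_D i j k p) = - 2 * (p $ j * p $ k) * r + 2 * Q * (p $ j * p $ k) * r\<^sup>2"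
    using exhaust_3[of j] exhaust_3[of k]
    by (elim disjE) (simp_all add: sum_3 hyp_D_def kronecker_def y1_y2_y3_r_def Q_def algebra_simps power2_eq_square)
  have b: "(\<Sum>i\<in>UNIV. p $ i * hyp_D j i k p) = - (p $ j * p $ k + kronecker j k * Q) * r + 2 * Q * (p $ j * p $ k) * r\<^sup>2"
    using exhaust_3[of j] exhaust_3[of k]
    by (elim disjE) (simp_all add: sum_3 hyp_D_def kronecker_def y1_y2_y3_r_def Q_def algebra_simps power2_eq_square)
  have c: "(\<Sum>l\<in>UNIV. hyp_G i l p * p $ l) = p $ i * r" for i
  proof -
    have "(\<Sum>l\<in>UNIV. hyp_G i l p * p $ l) = p $ i * (1 - Q * r)"
      using exhaust_3[of i]
      by (elim disjE) (simp_all add: sum_3 hyp_G_def kronecker_def y1_y2_y3_r_def Q_def algebra_simps)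
    then show ?thesis by (simp add: r)
  qed
  have c': "(\<Sum>i\<in>UNIV. p $ i * hyp_G i l p) = p $ l * r" for l
    using c[of l] by (simp add: mult_ac hyp_G_def kronecker_def eq_commute[of l])
  have d: "(\<Sum>i\<in>UNIV. kronecker j i * hyp_G i k p) = hyp_G j k p"
    using exhaust_3[of j] by (elim disjE) (simp_all add: sum_3 kronecker_def)
  have q: "(\<Sum>i\<in>UNIV. p $ i * p $ i) = Q" by (simp add: sum_3 Q_def y1_y2_y3_r_def)
  have "ricci (induced_metric hyp_chart) p $ j $ k =
    (\<Sum>i\<in>UNIV. - hyp_G j k p - p $ i * hyp_D i j k p + kronecker j i * hyp_G i k p + p $ i * hyp_D j i k p
       + (\<Sum>l\<in>UNIV. p $ i * (hyp_G i l p * p $ l) * hyp_G j k p - (p $ i * hyp_G i k p) * (hyp_G j l p * p $ l)))"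
    unfolding ricci_def vec_lambda_beta chr pdchr by (intro sum.cong refl) (simp add: kronecker_refl mult_ac)
  also have "\<dots> = (\<Sum>i\<in>UNIV. - hyp_G j k p - p $ i * hyp_D i j k p + kronecker j i * hyp_G i k p + p $ i * hyp_D j i k p
       + (p $ i * p $ i * r * hyp_G j k p - (p $ i * hyp_G i k p) * (p $ j * r)))"
  proof (intro sum.cong refl arg_cong2[of _ _ _ _ "(+)"])
    fix i
    have "(\<Sum>l\<in>UNIV. p $ i * (hyp_G i l p * p $ l) * hyp_G j k p - (p $ i * hyp_G i k p) * (hyp_G j l p * p $ l))
      = (p $ i * hyp_G j k p) * (\<Sum>l\<in>UNIV. hyp_G i l p * p $ l) - (p $ i * hyp_G i k p) * (\<Sum>l\<in>UNIV. hyp_G j l p * p $ l)"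
      by (simp add: sum_subtractf sum_distrib_left mult_ac)
    then show "(\<Sum>l\<in>UNIV. p $ i * (hyp_G i l p * p $ l) * hyp_G j k p - (p $ i * hyp_G i k p) * (hyp_G j l p * p $ l))
      = p $ i * p $ i * r * hyp_G j k p - (p $ i * hyp_G i k p) * (p $ j * r)"
      unfolding c by (simp add: mult_ac)
  qed
  also have "\<dots> = - 3 * hyp_G j k p - (\<Sum>i\<in>UNIV. p $ i * hyp_D i j k p) + hyp_G j k p + (\<Sum>i\<in>UNIV. p $ i * hyp_D j i k p)
       + (Q * r * hyp_G j k p - (p $ k * r) * (p $ j * r))"
    by (simp add: sum.distrib sum_subtractf sum_negf d q sum_distrib_right[symmetric] c' mult.assoc[symmetric])
  also have "\<dots> = - 2 * hyp_G j k p"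
  proof -
    have "Q * (r * kronecker j k) = kronecker j k - r * kronecker j k"
      by (simp add: r mult.assoc[symmetric] left_diff_distrib)
    moreover have "p $ j * p $ k * r * (Q * r) = p $ j * p $ k * r * (1 - r)" by (simp add: r)
    ultimately show ?thesis
      unfolding a b hyp_G_def y1_y2_y3_r_def(4)[symmetric] by (simp add: r algebra_simps power2_eq_square)
  qed
  finally show ?thesis .
qed

lemma ric_hyp_unit_tangent:
  assumes x: "x \<in> hyperboloid" and n: "lorentz n x = 0" "lorentz n n = 1"
  shows "ric_hyp x n = - 2"
proof -
  define q y where "q = hyp_coords x" and "y = hyp_coords n"
  have x1: "x$1 * x$1 = 1 + q \<bullet> q" "x$1 > 0"
    using x by (auto simp: hyperboloid_def lorentz_def q_def hyp_coords_def inner_3)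
  have n1: "n$1 * x$1 = q \<bullet> y"
    using n(1) by (simp add: lorentz_def q_def y_def hyp_coords_def inner_3 mult_ac)
  have nn: "y \<bullet> y - n$1 * n$1 = 1"
    using n(2) by (simp add: lorentz_def y_def hyp_coords_def inner_3)
  have "(q \<bullet> y)\<^sup>2 * hyp_r q = n$1 * n$1"
    unfolding hyp_r_def x1(1)[symmetric] n1[symmetric] using x1(2) by (simp add: power2_eq_square)
  moreover have "ric_hyp x n = - 2 * (y \<bullet> y - (q \<bullet> y)\<^sup>2 * hyp_r q)"
    unfolding ric_hyp_def q_def[symmetric] y_def[symmetric]
    by (simp add: inner_3 matrix_vector_mult_def sum_3 hyp_ricci hyp_G_def kronecker_def algebra_simps power2_eq_square)
  ultimately show ?thesis using nn by simp
qed

section \<open>Geometry of the helicoids\<close>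

lemma smooth_cosh_sinh:
  fixes f :: "real^'n \<Rightarrow> real"
  assumes "smooth f"
  shows "smooth (\<lambda>p. cosh (f p))" "smooth (\<lambda>p. sinh (f p))"
proof -
  have D: "((\<lambda>x::real. if even n then cosh x else sinh x) has_real_derivative
      (if even (Suc n) then cosh x else sinh x)) (at x)" for n x
    by (cases "even n") (auto intro!: derivative_eq_intros)
  note s = smooth_compose[where g = "\<lambda>n x. if even n then cosh x else sinh x", OF assms D]
  from s[of 0] s[of 1]
  show "smooth (\<lambda>p. cosh (f p))" "smooth (\<lambda>p. sinh (f p))" by simp_all
qed

lemma smooth_cos_sin:
  fixes f :: "real^'n \<Rightarrow> real"
  assumes "smooth f"
  shows "smooth (\<lambda>p. cos (f p))" "smooth (\<lambda>p. sin (f p))"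
proof -
  have D: "((\<lambda>x::real. cos (x + real n * (pi / 2))) has_real_derivative cos (x + real (Suc n) * (pi / 2))) (at x)"
    for n x
  proof -
    have "cos (x + real (Suc n) * (pi / 2)) = - sin (x + real n * (pi / 2))"
      using cos_add[of "x + real n * (pi / 2)" "pi / 2"] by (simp add: algebra_simps add_divide_distrib)
    then show ?thesis by (auto intro!: derivative_eq_intros)
  qed
  have "cos (x + real 3 * (pi / 2)) = sin x" for x
  proof -
    have "cos (x + real 3 * (pi / 2)) = cos ((x + pi / 2) + pi)" by (simp add: algebra_simps)
    also have "\<dots> = - cos (x + pi / 2)" by (rule cos_periodic_pi)
    also have "\<dots> = sin x" using cos_add[of x "pi / 2"] by simp
    finally show ?thesis .
  qed
  moreover note s = smooth_compose[where g = "\<lambda>n x. cos (x + real n * (pi / 2))", OF assms D]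
  note s[of 0] s[of 3]
  ultimately
  show "smooth (\<lambda>p. cos (f p))" "smooth (\<lambda>p. sin (f p))" by simp_all
qed

lemma vec4_differentiable:
  fixes a b c d :: "real^'n \<Rightarrow> real"
  assumes "a differentiable at p" "b differentiable at p" "c differentiable at p" "d differentiable at p"
  shows "(\<lambda>q. vector [a q, b q, c q, d q] :: real^4) differentiable at p"
proof (rule differentiable_components)
  fix k :: 4
  show "(\<lambda>q. (vector [a q, b q, c q, d q] :: real^4) $ k) differentiable at p"
    using exhaust_4[of k] assms by auto
qed

lemma pd_vec4:
  fixes a b c d :: "real^'n \<Rightarrow> real"
  assumes "a differentiable at p" "b differentiable at p" "c differentiable at p" "d differentiable at p"
  shows "pd i (\<lambda>q. vector [a q, b q, c q, d q] :: real^4) p = vector [pd i a p, pd i b p, pd i c p, pd i d p]"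
  by (simp add: vec_eq_iff forall_4 pd_component[OF vec4_differentiable[OF assms]])

lemma pd_separated:
  fixes f g :: "real \<Rightarrow> real" and p :: "real^2"
  assumes f: "(f has_real_derivative f') (at (p $ 1))" and g: "(g has_real_derivative g') (at (p $ 2))"
  shows "pd 1 (\<lambda>q. f (q $ 1) * g (q $ 2)) p = f' * g (p $ 2)"
    and "pd 2 (\<lambda>q. f (q $ 1) * g (q $ 2)) p = f (p $ 1) * g'"
    and "(\<lambda>q. f (q $ 1) * g (q $ 2)) differentiable at p"
  using pd_of_coord[OF f] pd_of_coord[OF g] by (simp_all add: pd_mult differentiable_mult)

text \<open>\<open>hel_u\<close> and \<open>hel_v\<close> are the coordinate derivatives of the helicoid.\<close>

definition hel_u :: "real \<Rightarrow> real^2 \<Rightarrow> real^4" where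
  "hel_u A p = vector [sinh (p$1) * cosh (p$2), sinh (p$1) * sinh (p$2),
     cosh (p$1) * cos (A * p$2), cosh (p$1) * sin (A * p$2)]"

definition hel_v :: "real \<Rightarrow> real^2 \<Rightarrow> real^4" where
  "hel_v A p = vector [cosh (p$1) * sinh (p$2), cosh (p$1) * cosh (p$2),
     sinh (p$1) * (- A * sin (A * p$2)), sinh (p$1) * (A * cos (A * p$2))]"

lemma basic_derivatives:
  "(cosh has_real_derivative sinh x) (at x)"
  "(sinh has_real_derivative cosh x) (at x)"
  "((\<lambda>v. cos (A * v)) has_real_derivative - A * sin (A * x)) (at x)"
  "((\<lambda>v. sin (A * v)) has_real_derivative A * cos (A * x)) (at x)"
  "((\<lambda>v. B * sin (A * v)) has_real_derivative B * (A * cos (A * x))) (at x)"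
  "((\<lambda>v. A * cos (A * v)) has_real_derivative A * (- A * sin (A * x))) (at x)"
  by (auto intro!: derivative_eq_intros)

lemmas pd_separated_basic = pd_separated[OF basic_derivatives(1) basic_derivatives(1)] pd_separated[OF basic_derivatives(1) basic_derivatives(2)]
  pd_separated[OF basic_derivatives(2) basic_derivatives(1)] pd_separated[OF basic_derivatives(2) basic_derivatives(2)]
  pd_separated[OF basic_derivatives(1) basic_derivatives(3)] pd_separated[OF basic_derivatives(1) basic_derivatives(4)]
  pd_separated[OF basic_derivatives(2) basic_derivatives(3)] pd_separated[OF basic_derivatives(2) basic_derivatives(4)]
  pd_separated[OF basic_derivatives(1) basic_derivatives(5)] pd_separated[OF basic_derivatives(1) basic_derivatives(6)]
  pd_separated[OF basic_derivatives(2) basic_derivatives(5)] pd_separated[OF basic_derivatives(2) basic_derivatives(6)]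

lemma pd_helicoid:
  "pd 1 (helicoid A) = hel_u A" "pd 2 (helicoid A) = hel_v A"
  unfolding helicoid_def[abs_def] by (rule ext, subst pd_vec4; simp add: pd_separated_basic hel_u_def hel_v_def)+

lemma helicoid_differentiable: "helicoid A differentiable at p"
  unfolding helicoid_def[abs_def] by (rule vec4_differentiable; simp add: pd_separated_basic)

text \<open>The factor \<open>B\<close> stands for \<open>- A\<close>; leaving it symbolic keeps the sign out of the product rule.\<close>

lemma pd_hel_v_aux:
  fixes p :: "real^2" and A B :: real
  defines "F \<equiv> (\<lambda>p::real^2. vector [cosh (p$1) * sinh (p$2), cosh (p$1) * cosh (p$2),
     sinh (p$1) * (B * sin (A * p$2)), sinh (p$1) * (A * cos (A * p$2))] :: real^4)"
  shows "pd 1 F p = vector [sinh (p$1) * sinh (p$2), sinh (p$1) * cosh (p$2),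
       cosh (p$1) * (B * sin (A * p$2)), cosh (p$1) * (A * cos (A * p$2))]"
    and "pd 2 F p = vector [cosh (p$1) * cosh (p$2), cosh (p$1) * sinh (p$2),
       sinh (p$1) * (B * (A * cos (A * p$2))), sinh (p$1) * (A * (- A * sin (A * p$2)))]"
  unfolding F_def by (subst pd_vec4; simp add: pd_separated_basic)+

lemma pd_hel_u_v:
  "pd 1 (hel_u A) p = helicoid A p"
  "pd 2 (hel_u A) p = vector [sinh (p$1) * sinh (p$2), sinh (p$1) * cosh (p$2),
     cosh (p$1) * (- A * sin (A * p$2)), cosh (p$1) * (A * cos (A * p$2))]"
  "pd 1 (hel_v A) p = vector [sinh (p$1) * sinh (p$2), sinh (p$1) * cosh (p$2),
     cosh (p$1) * (- A * sin (A * p$2)), cosh (p$1) * (A * cos (A * p$2))]"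
  "pd 2 (hel_v A) p = vector [cosh (p$1) * cosh (p$2), cosh (p$1) * sinh (p$2),
     sinh (p$1) * (- A * (A * cos (A * p$2))), sinh (p$1) * (A * (- A * sin (A * p$2)))]"
     apply (unfold hel_u_def[abs_def] helicoid_def)[2]
     apply (subst pd_vec4; simp add: pd_separated_basic)+
  by (unfold hel_v_def[abs_def]) (rule pd_hel_v_aux)+

lemma lorentz_hel:
  "lorentz (helicoid A p) (helicoid A p) = - 1"
  "lorentz (hel_u A p) (hel_u A p) = 1" "lorentz (hel_u A p) (hel_v A p) = 0"
  "lorentz (hel_v A p) (hel_u A p) = 0" "lorentz (hel_v A p) (hel_v A p) = (hel_w A (p $ 1))\<^sup>2"
proof -
  define s c S C x y where "s = sinh (p$1)" "c = cosh (p$1)" "S = sinh (p$2)" "C = cosh (p$2)"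
    "x = cos (A * p$2)" "y = sin (A * p$2)"
  note defs = s_c_S_C_x_y_def[symmetric]
  have r: "c * c = 1 + s * s" "C * C = 1 + S * S" "x * x = 1 - y * y"
    using cosh_sq[of "p$1"] cosh_sq[of "p$2"] sin_cos_squared_add[of "A * p$2"]
    by (simp_all add: s_c_S_C_x_y_def power2_eq_square)
  have "lorentz (helicoid A p) (helicoid A p) = c * c * (S * S - C * C) + s * s * (x * x + y * y)"
    unfolding helicoid_def lorentz_def defs by (simp add: algebra_simps)
  then show "lorentz (helicoid A p) (helicoid A p) = - 1" by (simp add: r)
  have "lorentz (hel_u A p) (hel_u A p) = s * s * (S * S - C * C) + c * c * (x * x + y * y)"
    unfolding hel_u_def lorentz_def defs by (simp add: algebra_simps)
  then show "lorentz (hel_u A p) (hel_u A p) = 1" by (simp add: r)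
  show "lorentz (hel_u A p) (hel_v A p) = 0" "lorentz (hel_v A p) (hel_u A p) = 0"
    unfolding hel_u_def hel_v_def lorentz_def defs by (simp_all add: algebra_simps)
  have "lorentz (hel_v A p) (hel_v A p) = c * c * (C * C - S * S) + A * A * (s * s * (x * x + y * y))"
    unfolding hel_v_def lorentz_def defs by (simp add: algebra_simps)
  moreover have "(hel_w A (p $ 1))\<^sup>2 = c * c + A * A * (s * s)"
    unfolding hel_w_sq defs by (simp add: power2_eq_square)
  ultimately show "lorentz (hel_v A p) (hel_v A p) = (hel_w A (p $ 1))\<^sup>2"
    by (simp add: r)
qed

definition diag2 :: "real \<Rightarrow> real \<Rightarrow> real^2^2" where
  "diag2 a b = (\<chi> i j. if i = j then if i = 1 then a else b else 0)"

lemma diag2_nth [simp]: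
  "diag2 a b $ 1 $ 1 = a" "diag2 a b $ 1 $ 2 = 0" "diag2 a b $ 2 $ 1 = 0" "diag2 a b $ 2 $ 2 = b"
  by (simp_all add: diag2_def)

lemma matrix_inv_diag2:
  assumes "a \<noteq> 0" "b \<noteq> 0"
  shows "matrix_inv (diag2 a b) = diag2 (1 / a) (1 / b)"
  by (rule matrix_inv_eq)
    (use assms in \<open>simp_all add: matrix_matrix_mult_def vec_eq_iff mat_def forall_2 sum_2\<close>)

lemma helicoid_metric: "induced_metric (helicoid A) p = diag2 1 ((hel_w A (p $ 1))\<^sup>2)"
  by (simp add: induced_metric_def vec_eq_iff forall_2 pd_helicoid lorentz_hel)

lemma helicoid_metric_inv:
  "matrix_inv (induced_metric (helicoid A) p) = diag2 1 (1 / (hel_w A (p $ 1))\<^sup>2)"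
  using hel_w_pos[of A "p $ 1"] by (simp add: helicoid_metric matrix_inv_diag2)

lemma helicoid_sqrt_det: "sqrt (det (induced_metric (helicoid A) p)) = hel_w A (p $ 1)"
  using hel_w_pos[of A "p $ 1"] by (simp add: helicoid_metric det_2)

lemma helicoid_laplacian:
  "laplacian (induced_metric (helicoid A)) f p = (1 / hel_w A (p $ 1)) *
     (pd 1 (\<lambda>q. hel_w A (q $ 1) * pd 1 f q) p + pd 2 (\<lambda>q. (1 / hel_w A (q $ 1)) * pd 2 f q) p)"
proof -
  have "hel_w A (q $ 1) * (1 / (hel_w A (q $ 1))\<^sup>2 * pd 2 f q) = 1 / hel_w A (q $ 1) * pd 2 f q" for q
    using hel_w_pos[of A "q $ 1"] by (simp add: power2_eq_square)
  then show ?thesis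
    unfolding laplacian_def by (simp add: sum_2 helicoid_metric_inv helicoid_sqrt_det)
qed

text \<open>The chosen normal is only known through these equations, so a vector \<open>m\<close> satisfying them is exhibited.\<close>

lemma unit_normal_props:
  fixes A :: real
  defines "n \<equiv> unit_normal (helicoid A)"
  shows "lorentz (n p) (n p) = 1" "lorentz (n p) (helicoid A p) = 0"
    "lorentz (n p) (hel_u A p) = 0" "lorentz (n p) (hel_v A p) = 0"
proof -
  define w where "w = hel_w A (p$1)"
  have w: "w > 0" "w * w = cosh (p$1) * cosh (p$1) + A * A * (sinh (p$1) * sinh (p$1))"
    using hel_w_sq[of A "p$1"] by (auto simp: w_def hel_w_pos power2_eq_square)
  define m :: "real^4" where "m = vector
    [- A * sinh (p$1) * sinh (p$2) / w, - A * sinh (p$1) * cosh (p$2) / w,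
     - cosh (p$1) * sin (A * p$2) / w, cosh (p$1) * cos (A * p$2) / w]"
  have r: "cosh (p$2) * cosh (p$2) = 1 + sinh (p$2) * sinh (p$2)"
    "cos (A * p$2) * cos (A * p$2) = 1 - sin (A * p$2) * sin (A * p$2)"
    using cosh_sq[of "p$2"] sin_cos_squared_add[of "A * p$2"] by (simp_all add: power2_eq_square)
  have "lorentz m m = (A * A * (sinh (p$1) * sinh (p$1)) * (cosh (p$2) * cosh (p$2) - sinh (p$2) * sinh (p$2))
      + cosh (p$1) * cosh (p$1) * (cos (A * p$2) * cos (A * p$2) + sin (A * p$2) * sin (A * p$2))) / (w * w)"
    unfolding m_def lorentz_def by (simp add: algebra_simps add_divide_distrib diff_divide_distrib
        del: sin_cos_squared_add3)
  moreover have "cosh (p$2) * cosh (p$2) - sinh (p$2) * sinh (p$2) = 1"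
    "cos (A * p$2) * cos (A * p$2) + sin (A * p$2) * sin (A * p$2) = 1"
    using r by simp_all
  ultimately have "lorentz m m = (w * w) / (w * w)"
    by (simp only: w(2)) (simp add: add.commute)
  then have "lorentz m m = 1" using w(1) by simp
  moreover have "lorentz m (helicoid A p) = 0" "lorentz m (hel_u A p) = 0"
    unfolding m_def lorentz_def helicoid_def hel_u_def by (simp_all add: algebra_simps)
  moreover have "lorentz m (hel_v A p) = A * sinh (p$1) * cosh (p$1)
      * (sinh (p$2) * sinh (p$2) - cosh (p$2) * cosh (p$2)
        + cos (A * p$2) * cos (A * p$2) + sin (A * p$2) * sin (A * p$2)) / w"
    unfolding m_def lorentz_def hel_v_def by (simp add: algebra_simps add_divide_distrib diff_divide_distrib
        del: sin_cos_squared_add3)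
  then have "lorentz m (hel_v A p) = 0" by (simp add: r)
  ultimately have ex: "lorentz m m = 1 \<and> lorentz m (helicoid A p) = 0 \<and> (\<forall>i. lorentz m (pd i (helicoid A) p) = 0)"
    by (simp add: forall_2 pd_helicoid)
  have "lorentz (n p) (n p) = 1 \<and> lorentz (n p) (helicoid A p) = 0 \<and> (\<forall>i. lorentz (n p) (pd i (helicoid A) p) = 0)"
    unfolding n_def unit_normal_def by (rule someI[where P = "\<lambda>n. lorentz n n = 1 \<and> lorentz n (helicoid A p) = 0
        \<and> (\<forall>i. lorentz n (pd i (helicoid A) p) = 0)", OF ex])
  then show "lorentz (n p) (n p) = 1" "lorentz (n p) (helicoid A p) = 0"
    "lorentz (n p) (hel_u A p) = 0" "lorentz (n p) (hel_v A p) = 0"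
    by (auto simp: forall_2 pd_helicoid)
qed

lemma helicoid_in_hyperboloid: "helicoid A p \<in> hyperboloid"
proof -
  have "1 * 1 \<le> cosh (p$1) * cosh (p$2)"
    by (intro mult_mono) (auto simp: cosh_real_ge_1)
  then show ?thesis
    unfolding hyperboloid_def using lorentz_hel(1)[of A p] by (simp add: helicoid_def)
qed

text \<open>The normal lies in the span of two spacelike unit vectors, in which it is orthogonal to
  \<open>(cosh u, A sinh u)\<close>; the mixed coefficient is its product with \<open>(sinh u, A cosh u)\<close>. Only the
  square is determined, as the normal is unique up to sign.\<close>

lemma helicoid_second_form:
  "second_form (helicoid A) p $ 1 $ 1 = 0" "second_form (helicoid A) p $ 2 $ 2 = 0"
  "second_form (helicoid A) p $ 2 $ 1 = second_form (helicoid A) p $ 1 $ 2"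
  "(second_form (helicoid A) p $ 1 $ 2)\<^sup>2 = A\<^sup>2 / (hel_w A (p $ 1))\<^sup>2"
proof -
  define n where "n = unit_normal (helicoid A) p"
  note n = unit_normal_props[of A p, folded n_def]
  define s c S C x y where "s = sinh (p$1)" "c = cosh (p$1)" "S = sinh (p$2)" "C = cosh (p$2)"
    "x = cos (A * p$2)" "y = sin (A * p$2)"
  note defs = s_c_S_C_x_y_def[symmetric]
  have r: "c * c = 1 + s * s" "C * C = 1 + S * S" "x * x = 1 - y * y"
    using cosh_sq[of "p$1"] cosh_sq[of "p$2"] sin_cos_squared_add[of "A * p$2"]
    by (simp_all add: s_c_S_C_x_y_def power2_eq_square)
  \<comment> \<open>The products of the normal with an orthonormal frame whose first vector is timelike.\<close>
  define e1 e2 e3 e4 where "e1 = - n$1 * C + n$2 * S" and "e2 = - n$1 * S + n$2 * C"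
    and "e3 = n$3 * x + n$4 * y" and "e4 = - n$3 * y + n$4 * x"
  have 1: "c * e1 + s * e3 = 0"
    using n(2) unfolding helicoid_def lorentz_def defs e1_def e3_def by (simp add: algebra_simps)
  have 2: "s * e1 + c * e3 = 0"
    using n(3) unfolding hel_u_def lorentz_def defs e1_def e3_def by (simp add: algebra_simps)
  have 3: "c * e2 + A * s * e4 = 0"
    using n(4) unfolding hel_v_def lorentz_def defs e2_def e4_def by (simp add: algebra_simps)
  have e1: "e1 = 0"
  proof -
    have "c * (c * e1 + s * e3) - s * (s * e1 + c * e3) = (c * c - s * s) * e1" by (simp add: algebra_simps)
    then show ?thesis unfolding 1 2 by (simp add: r)
  qed
  have e3: "e3 = 0"
  proof -
    have "c * (s * e1 + c * e3) - s * (c * e1 + s * e3) = (c * c - s * s) * e3" by (simp add: algebra_simps)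
    then show ?thesis unfolding 1 2 by (simp add: r)
  qed
  have "- (e1 * e1) + e2 * e2 + e3 * e3 + e4 * e4
    = (n$2 * n$2 - n$1 * n$1) * (C * C - S * S) + (n$3 * n$3 + n$4 * n$4) * (x * x + y * y)"
    unfolding e1_def e2_def e3_def e4_def by (simp add: algebra_simps)
  also have "\<dots> = 1" using n(1) by (simp add: lorentz_def r)
  finally have 4: "e2 * e2 + e4 * e4 = 1" by (simp add: e1 e3)
  have h12: "second_form (helicoid A) p $ 1 $ 2 = s * e2 + A * c * e4"
    unfolding second_form_def by (simp add: pd_helicoid pd_hel_u_v n_def[symmetric])
      (simp add: lorentz_def defs e2_def e4_def algebra_simps)
  show "second_form (helicoid A) p $ 2 $ 1 = second_form (helicoid A) p $ 1 $ 2"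
    unfolding second_form_def by (simp add: pd_helicoid pd_hel_u_v)
  show "second_form (helicoid A) p $ 1 $ 1 = 0"
    unfolding second_form_def using n(2)
    by (simp add: pd_helicoid pd_hel_u_v n_def[symmetric]) (simp add: lorentz_def mult_ac)
  have "second_form (helicoid A) p $ 2 $ 2 = c * e1 - A * A * s * e3"
    unfolding second_form_def by (simp add: pd_helicoid pd_hel_u_v n_def[symmetric])
      (simp add: lorentz_def defs e1_def e3_def algebra_simps)
  then show "second_form (helicoid A) p $ 2 $ 2 = 0" by (simp add: e1 e3)
  define W where "W = c * c + A * A * (s * s)"
  have W: "(hel_w A (p $ 1))\<^sup>2 = W" unfolding hel_w_sq defs W_def by (simp add: power2_eq_square)
  have ce2: "c * e2 = - (A * s * e4)" using 3 by linarith
  have "(s * e2 + A * c * e4)\<^sup>2 * W = A\<^sup>2"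
  proof -
    have "(c * e2 + A * s * e4)\<^sup>2 + (A * s * e2 - c * e4)\<^sup>2 = W * (e2 * e2 + e4 * e4)"
      unfolding W_def by (simp add: algebra_simps power2_eq_square)
    then have a: "(A * s * e2 - c * e4)\<^sup>2 = W" by (simp add: 3 4)
    have "(s * e2 + A * c * e4) * W = - A * (A * s * e2 - c * e4)"
    proof -
      have "(s * e2 + A * c * e4) * W = s * c * (c * e2) + A * A * s * s * s * e2 + A * c * c * c * e4 + A * A * A * c * s * s * e4"
        unfolding W_def by (simp add: algebra_simps)
      also have "\<dots> = s * c * (- (A * s * e4)) + A * A * s * s * s * e2 + A * c * c * c * e4 + A * A * A * c * s * s * e4"
        by (simp only: ce2)
      also have "\<dots> = A * c * e4 * (c * c - s * s) + A * A * s * s * (s * e2) + A * A * s * c * (A * s * e4)"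
        by (simp add: algebra_simps)
      also have "A * s * e4 = - (c * e2)" using ce2 by simp
      also have "A * c * e4 * (c * c - s * s) + A * A * s * s * (s * e2) + A * A * s * c * (- (c * e2))
        = (c * c - s * s) * (A * c * e4 - A * A * s * e2)"
        by (simp add: algebra_simps)
      also have "\<dots> = - A * (A * s * e2 - c * e4)" by (simp add: r algebra_simps)
      finally show ?thesis .
    qed
    then have "((s * e2 + A * c * e4) * W)\<^sup>2 = A\<^sup>2 * W"
      using a by (simp add: power_mult_distrib)
    moreover have "W > 0" using hel_w_pos[of A "p$1"] W[symmetric] by simp
    ultimately show ?thesis by (simp add: power2_eq_square)
  qed
  moreover have "W > 0" using hel_w_pos[of A "p$1"] W[symmetric] by simp
  ultimately show "(second_form (helicoid A) p $ 1 $ 2)\<^sup>2 = A\<^sup>2 / (hel_w A (p $ 1))\<^sup>2"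
    unfolding h12 W by (simp add: eq_divide_eq)
qed

lemma helicoid_second_form_sq: "second_form_sq (helicoid A) p = 2 * A\<^sup>2 / hel_w A (p $ 1) ^ 4"
  using helicoid_second_form[of A p]
  by (simp add: second_form_sq_def Let_def helicoid_metric_inv sum_2 power2_eq_square power4_eq_xxxx)

lemma helicoid_jacobi_op:
  "jacobi_op (helicoid A) f p = (1 / hel_w A (p $ 1)) *
     (pd 1 (\<lambda>q. hel_w A (q $ 1) * pd 1 f q) p + pd 2 (\<lambda>q. (1 / hel_w A (q $ 1)) * pd 2 f q) p)
     - hel_V A (p $ 1) * f p"
  unfolding jacobi_op_def helicoid_laplacian helicoid_second_form_sq
    ric_hyp_unit_tangent[OF helicoid_in_hyperboloid unit_normal_props(2,1)] hel_V_def
  by (simp add: algebra_simps)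

lemma helicoid_surface_integral:
  "surface_integral (helicoid A) \<Omega> F = (LINT p:\<Omega>|lborel. F p * hel_w A (p $ 1))"
  unfolding surface_integral_def helicoid_sqrt_det ..

lemma smooth_helicoid: "smooth (helicoid A)"
proof (rule smooth_components)
  fix k :: 4
  have "smooth (\<lambda>p::real^2. A * p $ 2)" by (intro smooth_mult smooth_const smooth_coord)
  note s = smooth_cosh_sinh[OF smooth_coord] smooth_cos_sin[OF this]
  show "smooth (\<lambda>p. helicoid A p $ k)"
    using exhaust_4[of k] by (elim disjE) (simp_all add: helicoid_def smooth_mult s)
qed

lemma helicoid_injective_derivative: "inj (frechet_derivative (helicoid A) (at p))"
proof -
  let ?D = "frechet_derivative (helicoid A) (at p)"
  have D: "(helicoid A has_derivative ?D) (at p)"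
    using helicoid_differentiable frechet_derivative_works by blast
  have lin: "linear ?D" by (rule has_derivative_linear[OF D])
  have D_eq: "?D h = h $ 1 *\<^sub>R hel_u A p + h $ 2 *\<^sub>R hel_v A p" for h
  proof -
    have h: "h = h $ 1 *\<^sub>R axis 1 1 + h $ 2 *\<^sub>R axis 2 1"
      by (simp add: vec_eq_iff forall_2 axis_def)
    have "?D h = h $ 1 *\<^sub>R ?D (axis 1 1) + h $ 2 *\<^sub>R ?D (axis 2 1)"
      by (subst h) (simp add: linear_add[OF lin] linear_scale[OF lin])
    then show ?thesis
      using has_derivative_pd[OF D, of 1] has_derivative_pd[OF D, of 2] by (simp add: pd_helicoid)
  qed
  show ?thesis
    unfolding linear_injective_0[OF lin]
  proof (intro allI impI)
    fix h assume "?D h = 0"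
    then have 0: "h $ 1 *\<^sub>R hel_u A p + h $ 2 *\<^sub>R hel_v A p = 0" by (simp add: D_eq)
    have bil: "lorentz (a *\<^sub>R x + b *\<^sub>R y) z = a * lorentz x z + b * lorentz y z" for a b x y z
      by (simp add: lorentz_def algebra_simps)
    have z: "lorentz 0 z = 0" for z by (simp add: lorentz_def)
    have "h $ 1 = 0" using bil[of "h$1" "hel_u A p" "h$2" "hel_v A p" "hel_u A p"]
      by (simp add: 0 z lorentz_hel)
    moreover have "h $ 2 = 0" using bil[of "h$1" "hel_u A p" "h$2" "hel_v A p" "hel_v A p"] hel_w_pos[of A "p$1"]
      by (simp add: 0 z lorentz_hel)
    ultimately show "h = 0" by (simp add: vec_eq_iff forall_2)
  qed
qed

text \<open>The inverse reads off \<open>v\<close> from \<open>x\<^sub>2 / x\<^sub>1 = tanh v\<close> and then \<open>u\<close> by undoing the rotation in the last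
  two coordinates.\<close>

lemma helicoid_homeomorphism: "\<exists>Y. homeomorphism UNIV (range (helicoid A)) (helicoid A) Y"
proof -
  define V :: "real^4 \<Rightarrow> real" where "V x = artanh (x$2 / x$1)" for x
  define Y :: "real^4 \<Rightarrow> real^2" where
    "Y x = (\<chi> i. if i = 1 then arsinh (x$3 * cos (A * V x) + x$4 * sin (A * V x)) else V x)" for x
  have ratio: "helicoid A p $ 2 / helicoid A p $ 1 = tanh (p $ 2)" for p
    by (simp add: helicoid_def tanh_def)
  have V: "V (helicoid A p) = p $ 2" for p
    unfolding V_def ratio by (rule artanh_tanh_real)
  have third: "helicoid A p $ 3 * cos (A * p $ 2) + helicoid A p $ 4 * sin (A * p $ 2) = sinh (p $ 1)" for p
  proof -
    have "helicoid A p $ 3 * cos (A * p $ 2) + helicoid A p $ 4 * sin (A * p $ 2)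
      = sinh (p $ 1) * ((sin (A * p $ 2))\<^sup>2 + (cos (A * p $ 2))\<^sup>2)"
      by (simp add: helicoid_def algebra_simps power2_eq_square
          del: sin_cos_squared_add sin_cos_squared_add2 sin_cos_squared_add3)
    then show ?thesis by simp
  qed
  have inv: "Y (helicoid A p) = p" for p
    by (simp add: Y_def V third arsinh_sinh_real vec_eq_iff forall_2)
  have contV: "continuous_on (range (helicoid A)) V"
    unfolding V_def
  proof (rule continuous_on_compose2[OF continuous_on_artanh[OF order_refl]])
    show "continuous_on (range (helicoid A)) (\<lambda>x. x$2 / x$1)"
      by (intro continuous_intros) (auto simp: helicoid_def)
    show "(\<lambda>x. x$2 / x$1) ` range (helicoid A) \<subseteq> {-1<..<1}"
      using tanh_real_gt_neg1 tanh_real_lt_1 by (auto simp: ratio)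
  qed
  have "continuous_on (range (helicoid A)) Y"
    unfolding Y_def
  proof (rule continuous_on_vec_lambda)
    fix i :: 2
    have "continuous_on (range (helicoid A)) (\<lambda>x. arsinh (x$3 * cos (A * V x) + x$4 * sin (A * V x)))"
      by (rule continuous_on_compose2[OF continuous_on_arsinh[of UNIV]])
        (auto intro!: continuous_intros contV)
    then show "continuous_on (range (helicoid A))
        (\<lambda>x. if i = 1 then arsinh (x$3 * cos (A * V x) + x$4 * sin (A * V x)) else V x)"
      using contV by (cases "i = 1") auto
  qed
  then have "homeomorphism UNIV (range (helicoid A)) (helicoid A) Y"
    unfolding homeomorphism_def using inv smooth_continuous[OF smooth_helicoid]
    by (auto simp: image_iff)
  then show ?thesis by blast
qed

lemma helicoid_minimal: "minimal_surface (helicoid A)"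
  unfolding minimal_surface_def mean_curvature_def
  using smooth_helicoid helicoid_in_hyperboloid helicoid_injective_derivative helicoid_homeomorphism
  by (auto simp: sum_2 helicoid_metric_inv helicoid_second_form)

section \<open>Lower bounds for the first eigenvalue\<close>

lemma smooth_hel_w:
  "smooth (\<lambda>q::real^2. hel_w A (q $ 1))" "smooth (\<lambda>q::real^2. 1 / hel_w A (q $ 1))"
proof -
  let ?w = "\<lambda>q::real^2. hel_w A (q $ 1)" and ?v = "\<lambda>q::real^2. 1 / hel_w A (q $ 1)"
  define d where "d = (\<lambda>q::real^2. (1 + A\<^sup>2) * (sinh (q $ 1) * cosh (q $ 1)))"
  have d: "smooth d" unfolding d_def by (intro smooth_mult smooth_const smooth_cosh_sinh smooth_coord)
  let ?B = "{?w, ?v} \<union> {h. smooth h}"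
  have D1: "(hel_w A has_real_derivative d q * (1 / hel_w A (q $ 1))) (at (q $ 1))" for q
    using hel_w_deriv[of A "q $ 1"] by (simp add: d_def mult_ac)
  have D2: "((\<lambda>u. 1 / hel_w A u) has_real_derivative
      - 1 * (d q * (1 / hel_w A (q $ 1)) * (1 / hel_w A (q $ 1)) * (1 / hel_w A (q $ 1)))) (at (q $ 1))" for q
    using hel_w_pos[of A "q $ 1"] by (auto intro!: derivative_eq_intros D1 simp: power2_eq_square)
  have pdw: "pd i ?w = (\<lambda>q. (if i = 1 then 1 else 0) * (d q * ?v q))" for i
    by (rule ext) (simp add: pd_of_coord[OF D1])
  have pdv: "pd i ?v = (\<lambda>q. (if i = 1 then - 1 else 0) * (d q * ?v q * ?v q * ?v q))" for i
    by (rule ext) (subst pd_of_coord[OF D2], simp)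
  have diff: "b differentiable at p" if "b \<in> ?B" for b p
    using that pd_of_coord(2)[OF D1] pd_of_coord(2)[OF D2] smooth_differentiable by auto
  have "pd i ?w \<in> function_algebra ?B" "pd i ?v \<in> function_algebra ?B" for i
    unfolding pdw pdv by (intro function_algebra.intros; use d in simp)+
  then have pd: "pd i b \<in> function_algebra ?B" if "b \<in> ?B" for b i
    using that by (auto intro: function_algebra.base smooth_pd)
  show "smooth ?w" by (rule function_algebra_smooth[OF diff pd]) (auto intro: function_algebra.base)
  show "smooth ?v" by (rule function_algebra_smooth[OF diff pd]) (auto intro: function_algebra.base)
qed

lemma smooth_hel_V: "smooth (\<lambda>q::real^2. hel_V A (q $ 1))"
proof -
  have "(\<lambda>q::real^2. hel_V A (q $ 1)) = (\<lambda>q. 2 + (- 2 * A\<^sup>2) *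
     ((1 / hel_w A (q $ 1)) * (1 / hel_w A (q $ 1)) * ((1 / hel_w A (q $ 1)) * (1 / hel_w A (q $ 1)))))"
    by (rule ext) (simp add: hel_V_def power4_eq_xxxx)
  moreover have "smooth \<dots>"
    by (intro smooth_add smooth_mult smooth_const smooth_hel_w)
  ultimately show ?thesis by simp
qed

lemma smooth_uminus: "smooth f \<Longrightarrow> smooth (\<lambda>p::real^'n. - f p :: real)"
  using smooth_mult[OF smooth_const[of "-1"]] by simp

lemma smooth_jacobi_op: "smooth f \<Longrightarrow> smooth (jacobi_op (helicoid A) f)"
proof -
  assume f: "smooth f"
  have "jacobi_op (helicoid A) f = (\<lambda>p. (1 / hel_w A (p $ 1)) *
     (pd 1 (\<lambda>q. hel_w A (q $ 1) * pd 1 f q) p + pd 2 (\<lambda>q. (1 / hel_w A (q $ 1)) * pd 2 f q) p)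
     + - (hel_V A (p $ 1) * f p))"
    by (rule ext) (simp add: helicoid_jacobi_op)
  moreover have "smooth \<dots>"
    by (intro smooth_add smooth_mult smooth_hel_w smooth_hel_V smooth_uminus smooth_pd f)
  ultimately show ?thesis by simp
qed

text \<open>The quadratic form of \<open>- L\<close> on compactly supported functions, over the whole parameter plane instead
  of a subdomain containing the support.\<close>

definition hel_energy :: "real \<Rightarrow> (real^2 \<Rightarrow> real) \<Rightarrow> real" where
  "hel_energy A f = - (LINT p|lborel. f p * jacobi_op (helicoid A) f p * hel_w A (p $ 1))"

definition hel_mass :: "real \<Rightarrow> (real^2 \<Rightarrow> real) \<Rightarrow> real" where
  "hel_mass A f = (LINT p|lborel. (f p)\<^sup>2 * hel_w A (p $ 1))"

lemma test_function_support:
  assumes "f \<in> test_functions \<Omega>" "compact \<Omega>"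
  shows "\<exists>K. compact K \<and> K \<subseteq> \<Omega> \<and> (\<forall>p. p \<notin> K \<longrightarrow> f p = 0)"
proof (intro exI conjI allI impI)
  let ?K = "closure {p. f p \<noteq> 0}"
  have "?K \<subseteq> interior \<Omega>" using assms(1) by (simp add: test_functions_def)
  then show "?K \<subseteq> \<Omega>" by (rule order_trans[OF _ interior_subset])
  from this have "bounded ?K" by (rule bounded_subset[OF compact_imp_bounded[OF assms(2)]])
  then show "compact ?K" by (simp add: compact_eq_bounded_closed)
  fix p assume "p \<notin> ?K"
  then show "f p = 0" using closure_subset[of "{p. f p \<noteq> 0}"] by auto
qed

lemma surface_integral_supported:
  assumes "\<And>p. p \<notin> \<Omega> \<Longrightarrow> F p = 0"
  shows "surface_integral (helicoid A) \<Omega> F = (LINT p|lborel. F p * hel_w A (p $ 1))"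
  unfolding helicoid_surface_integral set_lebesgue_integral_def
  by (rule Bochner_Integration.integral_cong) (use assms in \<open>auto simp: indicator_def\<close>)

lemma first_eigenvalue_on_helicoid:
  assumes "compact \<Omega>"
  shows "first_eigenvalue_on (helicoid A) \<Omega>
    = Inf {hel_energy A f | f. f \<in> test_functions \<Omega> \<and> hel_mass A f = 1}"
proof -
  have E: "- surface_integral (helicoid A) \<Omega> (\<lambda>p. f p * jacobi_op (helicoid A) f p) = hel_energy A f"
    "surface_integral (helicoid A) \<Omega> (\<lambda>p. (f p)\<^sup>2) = hel_mass A f"
    if f: "f \<in> test_functions \<Omega>" for f
  proof -
    obtain K where "compact K" "K \<subseteq> \<Omega>" "\<And>p. p \<notin> K \<Longrightarrow> f p = 0"
      using test_function_support[OF f assms] by blast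
    then have "f p = 0" if "p \<notin> \<Omega>" for p using that by blast
    then show "- surface_integral (helicoid A) \<Omega> (\<lambda>p. f p * jacobi_op (helicoid A) f p) = hel_energy A f"
      "surface_integral (helicoid A) \<Omega> (\<lambda>p. (f p)\<^sup>2) = hel_mass A f"
      unfolding hel_energy_def hel_mass_def by (simp_all add: surface_integral_supported)
  qed
  show ?thesis unfolding first_eigenvalue_on_def setcompr_eq_image
    by (intro arg_cong[of _ _ Inf] image_cong) (auto simp: E)
qed

lemma smooth_integrable:
  fixes f :: "real^'n \<Rightarrow> real"
  assumes "smooth f" "compact K" "\<And>p. p \<notin> K \<Longrightarrow> f p = 0"
  shows "integrable lborel f"
  using integrable_compact_support[OF assms(2) smooth_continuous[OF assms(1)]] assms(3) by blast

text \<open>Up to the divergence of a compactly supported field the integrand of the energy is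
  \<open>w f\<^sub>u\<^sup>2 + f\<^sub>v\<^sup>2 / w + w V f\<^sup>2\<close>. Adding the divergence \<open>- (P f\<^sup>2)\<^sub>u\<close> completes the square
  \<open>(w f\<^sub>u - P f)\<^sup>2 / w\<close>, and the Riccati inequality bounds the rest below by \<open>\<delta> w f\<^sup>2\<close>.\<close>

lemma energy_lower_bound:
  assumes P: "\<And>u. (P has_real_derivative P' u) (at u)" "continuous_on UNIV P'"
    and ric: "\<And>u. u \<in> S \<Longrightarrow> P' u + (P u)\<^sup>2 / hel_w A u \<le> (hel_V A u - \<delta>) * hel_w A u"
    and f: "smooth f" and K: "compact K" "\<And>p. p \<notin> K \<Longrightarrow> f p = 0" "\<And>p. p \<in> K \<Longrightarrow> p $ 1 \<in> S"
  shows "\<delta> * hel_mass A f \<le> hel_energy A f"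
proof -
  define w where "w = (\<lambda>p::real^2. hel_w A (p $ 1))"
  have wpos: "w p > 0" for p by (simp add: w_def hel_w_pos)
  define F1 where "F1 p = f p * (w p * pd 1 f p)" for p
  define F2 where "F2 p = f p * (1 / w p * pd 2 f p)" for p
  define G where "G p = P (p $ 1) * (f p * f p)" for p
  have smw: "smooth w" "smooth (\<lambda>p. 1 / w p)" unfolding w_def by (rule smooth_hel_w)+
  have sF: "smooth F1" "smooth F2" unfolding F1_def F2_def
    by (intro smooth_mult f smw smooth_pd)+
  note closed = compact_imp_closed[OF K(1)]
  have out: "pd i f p = 0" if "p \<notin> K" for i p by (rule pd_outside[OF closed K(2) that])
  have int: "integrable lborel (pd i F)" "(LINT p|lborel. pd i F p) = 0"
    if "smooth F" "\<And>p. p \<notin> K \<Longrightarrow> F p = 0" for i and F :: "real^2 \<Rightarrow> real"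
    using integral_pd_eq_0[where F = F and i = i and K = K] smooth_differentiable[OF that(1)]
      smooth_continuous[OF smooth_pd[OF that(1)]] K(1) that(2) by simp_all
  have F0: "F1 p = 0" "F2 p = 0" "G p = 0" if "p \<notin> K" for p
    using K(2)[OF that] by (auto simp: F1_def F2_def G_def)
  note fd = smooth_differentiable[OF f]
  have Pd: "(\<lambda>q::real^2. P (q $ 1)) differentiable at p" "pd 1 (\<lambda>q::real^2. P (q $ 1)) p = P' (p $ 1)" for p
    by (simp_all add: pd_of_coord[OF P(1)])
  have pdG: "pd 1 G p = P (p $ 1) * (2 * (f p * pd 1 f p)) + P' (p $ 1) * (f p * f p)" for p
    unfolding G_def by (simp add: pd_mult fd Pd differentiable_mult)
  have contP: "continuous_on UNIV (\<lambda>q::real^2. P (q $ 1))" "continuous_on UNIV (\<lambda>q::real^2. P' (q $ 1))"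
  proof -
    have "continuous_on UNIV P" using P(1) DERIV_isCont continuous_at_imp_continuous_on by blast
    then show "continuous_on UNIV (\<lambda>q::real^2. P (q $ 1))" "continuous_on UNIV (\<lambda>q::real^2. P' (q $ 1))"
      using P(2) by (auto intro!: continuous_on_compose2[of UNIV _ UNIV "\<lambda>q::real^2. q $ 1"] continuous_intros)
  qed
  have "continuous_on UNIV (pd 1 G)"
    unfolding pdG[abs_def]
    by (intro continuous_intros contP smooth_continuous f smooth_pd)
  then have intG: "integrable lborel (pd 1 G)" "(LINT p|lborel. pd 1 G p) = 0"
    using integral_pd_eq_0[where F = G and i = 1 and K = K] K(1) F0(3)
    by (simp_all add: G_def[abs_def] fd Pd differentiable_mult)
  define J where "J p = f p * jacobi_op (helicoid A) f p * w p" for p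
  have smJ: "smooth J" unfolding J_def by (intro smooth_mult f smw smooth_jacobi_op)
  have intJ: "integrable lborel J"
    by (rule smooth_integrable[OF smJ K(1)]) (simp add: J_def K(2))
  have intM: "integrable lborel (\<lambda>p. (f p)\<^sup>2 * w p)"
    by (rule smooth_integrable[OF _ K(1)]) (simp_all add: power2_eq_square smooth_mult f smw K(2))
  have pointwise: "0 \<le> - J p - \<delta> * ((f p)\<^sup>2 * w p) + pd 1 F1 p + pd 2 F2 p - pd 1 G p" for p
  proof (cases "p \<in> K")
    case True
    have d1: "pd 1 F1 p = f p * pd 1 (\<lambda>q. w q * pd 1 f q) p + w p * (pd 1 f p)\<^sup>2"
      using pd_mult[OF fd smooth_differentiable[OF smooth_mult[OF smw(1) smooth_pd[OF f]]]]
      by (simp add: F1_def[abs_def] power2_eq_square)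
    have d2: "pd 2 F2 p = f p * pd 2 (\<lambda>q. 1 / w q * pd 2 f q) p + 1 / w p * (pd 2 f p)\<^sup>2"
      using pd_mult[OF fd smooth_differentiable[OF smooth_mult[OF smw(2) smooth_pd[OF f]]]]
      by (simp add: F2_def[abs_def] power2_eq_square)
    have J: "J p = f p * pd 1 (\<lambda>q. w q * pd 1 f q) p + f p * pd 2 (\<lambda>q. 1 / w q * pd 2 f q) p
        - w p * hel_V A (p $ 1) * (f p)\<^sup>2"
      using wpos[of p] unfolding J_def helicoid_jacobi_op w_def
      by (simp add: field_simps power2_eq_square)
    have "(P' (p $ 1) + (P (p $ 1))\<^sup>2 / w p) * (f p)\<^sup>2 \<le> ((hel_V A (p $ 1) - \<delta>) * w p) * (f p)\<^sup>2"
      using ric[OF K(3)[OF True]] unfolding w_def by (intro mult_right_mono) auto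
    moreover have "(w p * pd 1 f p - P (p $ 1) * f p)\<^sup>2 / w p
       = w p * (pd 1 f p)\<^sup>2 - 2 * P (p $ 1) * f p * pd 1 f p + (P (p $ 1))\<^sup>2 / w p * (f p)\<^sup>2"
      using wpos[of p] by (simp add: field_simps power2_eq_square)
    moreover have "(w p * pd 1 f p - P (p $ 1) * f p)\<^sup>2 / w p \<ge> 0" "1 / w p * (pd 2 f p)\<^sup>2 \<ge> 0"
      using wpos[of p] by simp_all
    ultimately show ?thesis
      unfolding d1 d2 J pdG by (simp add: algebra_simps power2_eq_square)
  next
    case False
    have "pd 1 F1 p = 0" "pd 2 F2 p = 0" "pd 1 G p = 0"
      by (rule pd_outside[OF closed _ False]; simp add: F0)+
    then show ?thesis using K(2)[OF False] by (simp add: J_def)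
  qed
  note ints = intJ intM int(1)[OF sF(1), of 1] int(1)[OF sF(2), of 2] intG(1) F0
  have "0 \<le> (LINT p|lborel. - J p - \<delta> * ((f p)\<^sup>2 * w p) + pd 1 F1 p + pd 2 F2 p - pd 1 G p)"
    by (rule Bochner_Integration.integral_nonneg) (rule pointwise)
  also have "\<dots> = - (LINT p|lborel. J p) - \<delta> * (LINT p|lborel. (f p)\<^sup>2 * w p)
      + (LINT p|lborel. pd 1 F1 p) + (LINT p|lborel. pd 2 F2 p) - (LINT p|lborel. pd 1 G p)"
    using ints by simp
  also have "\<dots> = hel_energy A f - \<delta> * hel_mass A f"
    using int(2)[OF sF(1) F0(1), of 1] int(2)[OF sF(2) F0(2), of 2] intG(2)
    unfolding hel_energy_def hel_mass_def J_def w_def by simp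
  finally show ?thesis by simp
qed

lemma hel_V_ge: "hel_V A u \<ge> 2 - 2 * A\<^sup>2"
proof -
  have "1 \<le> hel_w A u ^ 4" using hel_w_ge_1 by (rule one_le_power)
  then have "2 * A\<^sup>2 / hel_w A u ^ 4 \<le> 2 * A\<^sup>2"
    by (simp add: divide_le_eq mult_left_le_one_le) (simp add: mult_le_cancel_left1)
  then show ?thesis by (simp add: hel_V_def)
qed

text \<open>The case \<open>P = 0\<close>: the potential is at least \<open>- 2 A\<^sup>2\<close>.\<close>

lemma energy_ge:
  assumes "f \<in> test_functions \<Omega>" "compact \<Omega>"
  shows "- (2 * A\<^sup>2) * hel_mass A f \<le> hel_energy A f"
proof -
  obtain K where K: "compact K" "K \<subseteq> \<Omega>" "\<And>p. p \<notin> K \<Longrightarrow> f p = 0"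
    using test_function_support[OF assms] by blast
  show ?thesis
  proof (rule energy_lower_bound[where P = "\<lambda>u. 0" and P' = "\<lambda>u. 0" and S = UNIV, OF _ _ _ _ K(1,3)])
    fix u show "0 + 0\<^sup>2 / hel_w A u \<le> (hel_V A u - - (2 * A\<^sup>2)) * hel_w A u"
      using hel_V_ge[of A u] hel_w_pos[of A u] by simp
  qed (use assms in \<open>auto simp: test_functions_def\<close>)
qed

lemma jacobi_op_scale:
  assumes f: "smooth f"
  shows "jacobi_op (helicoid A) (\<lambda>p. c * f p) p = c * jacobi_op (helicoid A) f p"
proof -
  have pd: "pd i (\<lambda>p. c * g p) q = c * pd i g q" if "smooth g" for i g q
    by (simp add: pd_mult smooth_differentiable[OF that])
  have 1: "pd i (\<lambda>p. c * f p) = (\<lambda>q. c * pd i f q)" for i by (rule ext) (rule pd[OF f])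
  have a: "(\<lambda>q. hel_w A (q $ 1) * (c * pd 1 f q)) = (\<lambda>q. c * (hel_w A (q $ 1) * pd 1 f q))"
    and b: "(\<lambda>q. 1 / hel_w A (q $ 1) * (c * pd 2 f q)) = (\<lambda>q. c * (1 / hel_w A (q $ 1) * pd 2 f q))"
    by (auto simp: mult_ac)
  have s1: "smooth (\<lambda>q. hel_w A (q $ 1) * pd 1 f q)" and s2: "smooth (\<lambda>q. 1 / hel_w A (q $ 1) * pd 2 f q)"
    by (rule smooth_mult[OF smooth_hel_w(1) smooth_pd[OF f]] smooth_mult[OF smooth_hel_w(2) smooth_pd[OF f]])+
  show ?thesis
    unfolding helicoid_jacobi_op 1 a b pd[OF s1] pd[OF s2] by (simp add: algebra_simps)
qed

lemma normalised_energy: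
  assumes f: "f \<in> test_functions \<Omega>" and m: "hel_mass A f > 0"
  shows "hel_energy A f / hel_mass A f \<in> {hel_energy A g | g. g \<in> test_functions \<Omega> \<and> hel_mass A g = 1}"
proof -
  define c where "c = 1 / sqrt (hel_mass A f)"
  have c: "c \<noteq> 0" "c\<^sup>2 = 1 / hel_mass A f" using m by (auto simp: c_def power_divide)
  have sf: "smooth f" using f by (simp add: test_functions_def)
  have "(\<lambda>p. c * f p) \<in> test_functions \<Omega>"
    using f c by (simp add: test_functions_def smooth_mult[OF smooth_const])
  moreover have "hel_mass A (\<lambda>p. c * f p) = c\<^sup>2 * hel_mass A f"
    unfolding hel_mass_def by (simp add: power_mult_distrib mult.assoc)
  moreover have "hel_energy A (\<lambda>p. c * f p) = c\<^sup>2 * hel_energy A f"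
  proof -
    have E: "(c * f p) * (c * jacobi_op (helicoid A) f p) * hel_w A (p $ 1)
      = c\<^sup>2 * (f p * jacobi_op (helicoid A) f p * hel_w A (p $ 1))" for p
      by (simp add: power2_eq_square mult_ac)
    then show ?thesis
      unfolding hel_energy_def jacobi_op_scale[OF sf] by (simp only: E) simp
  qed
  ultimately have "(\<lambda>p. c * f p) \<in> test_functions \<Omega>" "hel_mass A (\<lambda>p. c * f p) = 1"
      "hel_energy A (\<lambda>p. c * f p) = hel_energy A f / hel_mass A f"
    using m by (auto simp: c)
  then show ?thesis by force
qed

lemma integral_pos_of_pos_at:
  fixes F :: "real^'n \<Rightarrow> real"
  assumes int: "integrable lborel F" and cont: "continuous_on UNIV F"
    and nonneg: "\<And>p. F p \<ge> 0" and c: "F c > 0"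
  shows "(LINT p|lborel. F p) > 0"
proof -
  have "isCont F c" using cont by (simp add: continuous_on_eq_continuous_at)
  then have "\<forall>\<^sub>F p in nhds c. F p > F c / 2"
    using order_tendstoD(1)[of F "F c" "nhds c" "F c / 2"] c
    by (simp add: isCont_def tendsto_nhds_iff)
  then obtain e where e: "e > 0" "\<And>p. dist p c < e \<Longrightarrow> F p > F c / 2"
    unfolding eventually_nhds_metric by blast
  have "0 < F c / 2 * measure lborel (ball c e)"
    using c content_ball_pos[OF e(1)] by simp
  also have "\<dots> = (LINT p|lborel. F c / 2 * indicator (ball c e) p)"
    by simp
  also have "\<dots> \<le> (LINT p|lborel. F p)"
  proof (rule integral_mono[OF _ int])
    show "integrable lborel (\<lambda>p. F c / 2 * indicator (ball c e) p)"
      by (intro integrable_mult_right integrable_real_indicator) (auto simp: emeasure_bounded_finite[OF bounded_ball, unfolded infinity_ennreal_def])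
    show "F c / 2 * indicator (ball c e) p \<le> F p" for p
      using e(2)[of p] nonneg[of p] by (auto simp: indicator_def dist_commute less_imp_le)
  qed
  finally show ?thesis .
qed

lemma hel_mass_pos:
  assumes f: "smooth f" and K: "compact K" "\<And>p. p \<notin> K \<Longrightarrow> f p = 0" and c: "f c \<noteq> 0"
  shows "hel_mass A f > 0"
proof -
  have s: "smooth (\<lambda>p. (f p)\<^sup>2 * hel_w A (p $ 1))"
    unfolding power2_eq_square by (intro smooth_mult f smooth_hel_w)
  show ?thesis
    unfolding hel_mass_def
  proof (rule integral_pos_of_pos_at[OF smooth_integrable[OF s K(1)] smooth_continuous[OF s]])
    show "0 < (f c)\<^sup>2 * hel_w A (c $ 1)" using c hel_w_pos by simp
  qed (use K(2) hel_w_pos in \<open>auto simp: less_imp_le\<close>)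
qed

lemma bump_function:
  fixes \<Omega> :: "(real^'n) set"
  assumes "c \<in> interior \<Omega>"
  shows "\<exists>f\<in>{f. smooth f \<and> closure {p. f p \<noteq> 0} \<subseteq> interior \<Omega>}. f c \<noteq> (0::real)"
proof -
  obtain r where r: "r > 0" "cball c r \<subseteq> interior \<Omega>"
    using open_contains_cball[of "interior \<Omega>"] assms by auto
  define f where "f p = flat_exp 0 (r\<^sup>2 + - 1 * ((\<Sum>i\<in>UNIV. (p $ i - c $ i) * (p $ i - c $ i))))" for p
  have norm: "(\<Sum>i\<in>UNIV. (p $ i - c $ i) * (p $ i - c $ i)) = (dist p c)\<^sup>2" for p
    unfolding dist_norm power2_norm_eq_inner by (simp add: inner_vec_def)
  have "smooth (\<lambda>p::real^'n. \<Sum>i\<in>I. (p $ i - c $ i) * (p $ i - c $ i))" if "finite I" for I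
    using that
  proof induction
    case (insert i I)
    have "smooth (\<lambda>p::real^'n. p $ i - c $ i)"
      using smooth_add[OF smooth_coord[of i] smooth_const[of "- (c $ i)"]] by simp
    then show ?case using insert by (simp add: smooth_add smooth_mult)
  qed (simp add: smooth_const)
  then have "smooth f"
    unfolding f_def by (intro smooth_flat_exp smooth_add smooth_mult smooth_const) simp
  moreover have "{p. f p \<noteq> 0} \<subseteq> cball c r"
  proof
    fix p assume "p \<in> {p. f p \<noteq> 0}"
    then have "(dist p c)\<^sup>2 < r\<^sup>2" by (auto simp: f_def norm flat_exp_def split: if_splits)
    then have "dist p c < r" using r power_less_imp_less_base by (metis less_imp_le)
    then show "p \<in> cball c r" by (simp add: dist_commute)
  qed
  then have "closure {p. f p \<noteq> 0} \<subseteq> cball c r" by (rule closure_minimal) simp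
  then have "closure {p. f p \<noteq> 0} \<subseteq> interior \<Omega>" using r(2) by blast
  moreover have "f c \<noteq> 0" using r by (simp add: f_def norm flat_exp_def)
  ultimately show ?thesis by blast
qed

text \<open>Both facts are needed before anything can be said about the infimum in the definition of the first
  eigenvalue, since the infimum of reals is only meaningful for nonempty sets that are bounded below.\<close>

lemma eigenvalue_set:
  assumes \<Omega>: "compact_subdomain \<Omega>"
  shows "{hel_energy A f | f. f \<in> test_functions \<Omega> \<and> hel_mass A f = 1} \<noteq> {}"
    and "bdd_below {hel_energy A f | f. f \<in> test_functions \<Omega> \<and> hel_mass A f = 1}"
proof -
  have comp: "compact \<Omega>" using \<Omega> by (simp add: compact_subdomain_def)
  have "interior \<Omega> \<noteq> {}" using \<Omega> unfolding compact_subdomain_def by auto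
  then obtain c where "c \<in> interior \<Omega>" by auto
  then obtain f where f: "f \<in> test_functions \<Omega>" "f c \<noteq> 0"
    using bump_function[of c \<Omega>] unfolding test_functions_def by blast
  obtain K where K: "compact K" "K \<subseteq> \<Omega>" "\<And>p. p \<notin> K \<Longrightarrow> f p = 0"
    using test_function_support[OF f(1) comp] by blast
  have "hel_mass A f > 0"
    by (rule hel_mass_pos[where K = K and c = c]) (use f K in \<open>simp_all add: test_functions_def\<close>)
  from normalised_energy[OF f(1) this]
  show "{hel_energy A f | f. f \<in> test_functions \<Omega> \<and> hel_mass A f = 1} \<noteq> {}" by blast
  show "bdd_below {hel_energy A f | f. f \<in> test_functions \<Omega> \<and> hel_mass A f = 1}"
    by (rule bdd_belowI[of _ "- (2 * A\<^sup>2)"]) (use energy_ge[OF _ comp, of _ A] in force)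
qed

lemma first_eigenvalue_on_ge:
  assumes \<Omega>: "compact_subdomain \<Omega>"
    and lb: "\<And>f. f \<in> test_functions \<Omega> \<Longrightarrow> \<delta> * hel_mass A f \<le> hel_energy A f"
  shows "\<delta> \<le> first_eigenvalue_on (helicoid A) \<Omega>"
proof -
  have comp: "compact \<Omega>" using \<Omega> by (simp add: compact_subdomain_def)
  show ?thesis
    unfolding first_eigenvalue_on_helicoid[OF comp]
    by (rule cInf_greatest[OF eigenvalue_set(1)[OF \<Omega>]]) (use lb in force)
qed

lemma first_eigenvalue_on_le:
  assumes \<Omega>: "compact_subdomain \<Omega>" and f: "f \<in> test_functions \<Omega>" "hel_mass A f > 0"
  shows "first_eigenvalue_on (helicoid A) \<Omega> \<le> hel_energy A f / hel_mass A f"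
proof -
  have comp: "compact \<Omega>" using \<Omega> by (simp add: compact_subdomain_def)
  show ?thesis
    unfolding first_eigenvalue_on_helicoid[OF comp]
    by (rule cInf_lower[OF normalised_energy[OF f] eigenvalue_set(2)[OF \<Omega>]])
qed

lemma first_eigenvalue_on_antimono:
  assumes "compact_subdomain \<Omega>" "compact_subdomain \<Omega>'" "\<Omega> \<subseteq> \<Omega>'"
  shows "first_eigenvalue_on (helicoid A) \<Omega>' \<le> first_eigenvalue_on (helicoid A) \<Omega>"
proof -
  have comp: "compact \<Omega>" "compact \<Omega>'" using assms by (auto simp: compact_subdomain_def)
  have "test_functions \<Omega> \<subseteq> test_functions \<Omega>'"
    using interior_mono[OF assms(3)] unfolding test_functions_def by auto
  then show ?thesis
    unfolding first_eigenvalue_on_helicoid[OF comp(1)] first_eigenvalue_on_helicoid[OF comp(2)]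
    by (intro cInf_superset_mono eigenvalue_set assms) auto
qed

lemma exhaustion_exists: "\<exists>\<Omega>. exhaustion \<Omega>"
proof -
  define B where "B n = cball (0::real^2) (real n + 1)" for n
  have "compact_subdomain (B n)" for n
    unfolding compact_subdomain_def B_def by (auto simp: interior_cball)
  moreover have "B n \<subseteq> interior (B (Suc n))" for n
    unfolding B_def by (auto simp: interior_cball)
  moreover have "(\<Union>n. B n) = UNIV"
  proof -
    have "\<exists>n. p \<in> B n" for p
    proof -
      obtain n where "norm p \<le> real n" using real_arch_simple by blast
      then have "p \<in> B n" by (simp add: B_def)
      then show ?thesis ..
    qed
    then show ?thesis by auto
  qed
  ultimately show ?thesis unfolding exhaustion_def by blast
qed

text \<open>The interiors of the members of an exhaustion form an increasing open cover.\<close>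

lemma exhaustion_absorbs:
  assumes ex: "exhaustion \<Omega>" and K: "compact K"
  shows "\<exists>n. K \<subseteq> \<Omega> n"
proof -
  have sub: "\<Omega> n \<subseteq> interior (\<Omega> (Suc n))" for n using ex by (simp add: exhaustion_def)
  have inc: "incseq (\<lambda>n. interior (\<Omega> n))"
    by (rule incseq_SucI) (rule order_trans[OF interior_subset sub])
  have "K \<subseteq> (\<Union>n\<in>UNIV. interior (\<Omega> n))"
  proof
    fix x
    have "x \<in> (\<Union>n. \<Omega> n)" using ex by (simp add: exhaustion_def)
    then obtain n where "x \<in> \<Omega> n" by blast
    then have "x \<in> interior (\<Omega> (Suc n))" using sub[of n] by (rule rev_subsetD)
    then show "x \<in> (\<Union>n\<in>UNIV. interior (\<Omega> n))" by (rule UN_I[OF UNIV_I])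
  qed
  then obtain C where C: "finite C" "K \<subseteq> (\<Union>n\<in>C. interior (\<Omega> n))"
    by (rule compactE_image[OF K, of UNIV "\<lambda>n. interior (\<Omega> n)", rotated]) auto
  have "interior (\<Omega> n) \<subseteq> \<Omega> (Max (insert 0 C))" if "n \<in> C" for n
    by (rule order_trans[OF incseqD[OF inc] interior_subset]) (use C(1) that in simp)
  then have "(\<Union>n\<in>C. interior (\<Omega> n)) \<subseteq> \<Omega> (Max (insert 0 C))" by (rule UN_least)
  then show ?thesis using C(2) by (intro exI[of _ "Max (insert 0 C)"]) (rule order_trans)
qed

text \<open>First eigenvalues decrease with the domain and every compact subdomain is absorbed by any exhaustion,
  so the limit along an exhaustion is the infimum over all compact subdomains.\<close>

lemma first_eigenvalue_helicoid:
  "first_eigenvalue (helicoid A) = (INF \<Omega>\<in>{\<Omega>. compact_subdomain \<Omega>}. ereal (first_eigenvalue_on (helicoid A) \<Omega>))"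
    (is "_ = ?L")
proof -
  let ?l = "\<lambda>\<Omega>. ereal (first_eigenvalue_on (helicoid A) \<Omega>)"
  have lim: "(\<lambda>n. ?l (\<Omega> n)) \<longlonglongrightarrow> ?L" if ex: "exhaustion \<Omega>" for \<Omega>
  proof -
    have cs: "compact_subdomain (\<Omega> n)" "\<Omega> n \<subseteq> \<Omega> (Suc n)" for n
    proof -
      have "compact_subdomain (\<Omega> n)" "\<Omega> n \<subseteq> interior (\<Omega> (Suc n))"
        using ex by (simp_all add: exhaustion_def)
      then show "compact_subdomain (\<Omega> n)" "\<Omega> n \<subseteq> \<Omega> (Suc n)"
        using interior_subset[of "\<Omega> (Suc n)"] by auto
    qed
    have "decseq (\<lambda>n. ?l (\<Omega> n))"
      by (rule decseq_SucI) (simp add: first_eigenvalue_on_antimono cs)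
    then have "(\<lambda>n. ?l (\<Omega> n)) \<longlonglongrightarrow> (INF n. ?l (\<Omega> n))" by (rule LIMSEQ_INF)
    moreover have "(INF n. ?l (\<Omega> n)) = ?L"
    proof (rule antisym)
      show "(INF n. ?l (\<Omega> n)) \<le> ?L"
      proof (rule INF_greatest)
        fix U assume U: "U \<in> {\<Omega>. compact_subdomain \<Omega>}"
        then obtain n where "U \<subseteq> \<Omega> n"
          using exhaustion_absorbs[OF ex, of U] by (auto simp: compact_subdomain_def)
        then have "?l (\<Omega> n) \<le> ?l U" using U cs by (simp add: first_eigenvalue_on_antimono)
        then show "(INF n. ?l (\<Omega> n)) \<le> ?l U" by (rule INF_lower2[OF UNIV_I])
      qed
      show "?L \<le> (INF n. ?l (\<Omega> n))"
        by (rule INF_greatest) (rule INF_lower, simp add: cs)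
    qed
    ultimately show ?thesis by simp
  qed
  obtain \<Omega>0 where ex0: "exhaustion \<Omega>0" using exhaustion_exists by blast
  show ?thesis
    unfolding first_eigenvalue_def
  proof (rule the_equality)
    fix l assume "\<forall>\<Omega>. exhaustion \<Omega> \<longrightarrow> (\<lambda>n. ?l (\<Omega> n)) \<longlonglongrightarrow> l"
    then show "l = ?L" using LIMSEQ_unique[OF _ lim[OF ex0], of l] ex0 by blast
  qed (use lim in blast)
qed

text \<open>On a compact subdomain only a bounded range of \<open>u\<close> matters, so the local bound on \<open>jac_mass\<close> yields a
  spectral gap, also for the critical helicoid.\<close>

lemma first_eigenvalue_on_pos:
  assumes "ell_complete A \<le> 0" and \<Omega>: "compact_subdomain \<Omega>"
  shows "first_eigenvalue_on (helicoid A) \<Omega> > 0"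
proof -
  have comp: "compact \<Omega>" using \<Omega> by (simp add: compact_subdomain_def)
  have "bounded \<Omega>" by (rule compact_imp_bounded[OF comp])
  then obtain R where R: "\<And>p. p \<in> \<Omega> \<Longrightarrow> norm p \<le> R" unfolding bounded_iff by blast
  obtain K where K: "K \<ge> 1" "\<forall>u\<in>{-R..R}. \<bar>jac_mass A u\<bar> \<le> K * (hel_w A u * (jac A u)\<^sup>2)"
    using jac_mass_bound_local[OF assms(1)] by blast
  obtain P P' where P: "\<And>u. (P has_real_derivative P' u) (at u)" "continuous_on UNIV P'"
    "\<And>u. u \<in> {-R..R} \<Longrightarrow> P' u + (P u)\<^sup>2 / hel_w A u \<le> (hel_V A u - 1 / (4 * K\<^sup>2)) * hel_w A u"
    using riccati_subsolution[OF assms(1) K(1), of "{-R..R}"] K(2) by blast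
  have "1 / (4 * K\<^sup>2) \<le> first_eigenvalue_on (helicoid A) \<Omega>"
  proof (rule first_eigenvalue_on_ge[OF \<Omega>])
    fix f assume f: "f \<in> test_functions \<Omega>"
    obtain C where C: "compact C" "C \<subseteq> \<Omega>" "\<And>p. p \<notin> C \<Longrightarrow> f p = 0"
      using test_function_support[OF f comp] by blast
    show "1 / (4 * K\<^sup>2) * hel_mass A f \<le> hel_energy A f"
    proof (rule energy_lower_bound[where K = C, OF P])
      show "p $ 1 \<in> {-R..R}" if "p \<in> C" for p
        using R[of p] component_le_norm_cart[of p 1] C(2) that by force
    qed (use f C in \<open>auto simp: test_functions_def\<close>)
  qed
  moreover have "1 / (4 * K\<^sup>2) > 0" using K(1) by simp
  ultimately show ?thesis by linarith
qed

lemma helicoid_first_eigenvalue_nonneg: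
  assumes "ell_complete A \<le> 0"
  shows "first_eigenvalue (helicoid A) \<ge> 0"
  unfolding first_eigenvalue_helicoid
  by (rule INF_greatest) (use first_eigenvalue_on_pos[OF assms] in \<open>auto simp: less_imp_le\<close>)

text \<open>Below the critical parameter the bound on \<open>jac_mass\<close> is global, hence so is the spectral gap.\<close>

lemma helicoid_globally_stable:
  assumes neg: "ell_complete A < 0"
  shows "globally_stable (helicoid A)"
proof -
  obtain K where K: "K \<ge> 1" "\<forall>u. \<bar>jac_mass A u\<bar> \<le> K * (hel_w A u * (jac A u)\<^sup>2)"
    using jac_mass_bound_global[OF neg] by blast
  obtain P P' where P: "\<And>u. (P has_real_derivative P' u) (at u)" "continuous_on UNIV P'"
    "\<And>u. u \<in> UNIV \<Longrightarrow> P' u + (P u)\<^sup>2 / hel_w A u \<le> (hel_V A u - 1 / (4 * K\<^sup>2)) * hel_w A u"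
    using riccati_subsolution[of A K UNIV] neg K by auto
  have "1 / (4 * K\<^sup>2) \<le> first_eigenvalue_on (helicoid A) \<Omega>" if \<Omega>: "compact_subdomain \<Omega>" for \<Omega>
  proof (rule first_eigenvalue_on_ge[OF \<Omega>])
    fix f assume f: "f \<in> test_functions \<Omega>"
    have comp: "compact \<Omega>" using \<Omega> by (simp add: compact_subdomain_def)
    obtain C where C: "compact C" "C \<subseteq> \<Omega>" "\<And>p. p \<notin> C \<Longrightarrow> f p = 0"
      using test_function_support[OF f comp] by blast
    show "1 / (4 * K\<^sup>2) * hel_mass A f \<le> hel_energy A f"
      by (rule energy_lower_bound[where K = C, OF P]) (use f C in \<open>auto simp: test_functions_def\<close>)
  qed
  then have "ereal (1 / (4 * K\<^sup>2)) \<le> first_eigenvalue (helicoid A)"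
    unfolding first_eigenvalue_helicoid by (intro INF_greatest) auto
  moreover have "ereal (1 / (4 * K\<^sup>2)) > 0" using K(1) by simp
  ultimately show ?thesis unfolding globally_stable_def by (rule less_le_trans[rotated])
qed

section \<open>Eigenfunctions on rectangles\<close>

definition rectangle :: "real \<Rightarrow> real \<Rightarrow> (real^2) set" where
  "rectangle R L = cbox (vector [- R, 0]) (vector [R, L])"

lemma rectangle_iff: "p \<in> rectangle R L \<longleftrightarrow> - R \<le> p $ 1 \<and> p $ 1 \<le> R \<and> 0 \<le> p $ 2 \<and> p $ 2 \<le> L"
  by (auto simp: rectangle_def mem_box_cart forall_2)

lemma interior_rectangle_iff:
  "p \<in> interior (rectangle R L) \<longleftrightarrow> - R < p $ 1 \<and> p $ 1 < R \<and> 0 < p $ 2 \<and> p $ 2 < L"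
  by (auto simp: rectangle_def mem_box_cart forall_2 interior_cbox)

lemma compact_rectangle: "compact (rectangle R L)"
  by (simp add: rectangle_def)

lemma compact_subdomain_rectangle:
  assumes "R > 0" "L > 0"
  shows "compact_subdomain (rectangle R L)"
proof -
  have "vector [0, L / 2] \<in> interior (rectangle R L)"
    using assms by (simp add: interior_rectangle_iff)
  then have ne: "box (vector [- R, 0]) (vector [R, L] :: real^2) \<noteq> {}"
    by (auto simp: rectangle_def interior_cbox)
  then have "closure (interior (rectangle R L)) = rectangle R L"
    by (simp add: rectangle_def interior_cbox closure_box)
  moreover have "connected (interior (rectangle R L))"
    by (simp add: rectangle_def interior_cbox convex_connected)
  moreover have "vector [0, L / 2] \<in> rectangle R L"
    using assms by (simp add: rectangle_iff)
  ultimately show ?thesis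
    using compact_rectangle unfolding compact_subdomain_def by blast
qed

lemma frontier_rectangle:
  assumes "p \<in> frontier (rectangle R L)"
  shows "p $ 1 = R \<or> p $ 1 = - R \<or> p $ 2 = 0 \<or> p $ 2 = L"
proof -
  have "p \<in> rectangle R L - interior (rectangle R L)"
    using assms compact_imp_closed[OF compact_rectangle] by (simp add: frontier_def)
  then show ?thesis by (auto simp: rectangle_iff interior_rectangle_iff)
qed

text \<open>Separation of variables: the frequency \<open>\<kappa>\<close> in \<open>v\<close> contributes \<open>\<kappa>\<^sup>2 / w\<close> to the equation in \<open>u\<close>.\<close>

lemma separated_eigenfunction:
  assumes s: "solves (\<lambda>u. 1 / hel_w A u)
     (\<lambda>u. hel_w A u * hel_V A u + \<kappa>\<^sup>2 * (1 / hel_w A u) - \<mu> * hel_w A u) \<phi> \<psi>"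
  defines "f \<equiv> (\<lambda>p::real^2. \<phi> (p $ 1) * sin (\<kappa> * p $ 2))"
  shows "smooth f" "- jacobi_op (helicoid A) f p = \<mu> * f p"
proof -
  define \<beta> where "\<beta> u = hel_w A u * hel_V A u + \<kappa>\<^sup>2 * (1 / hel_w A u) - \<mu> * hel_w A u" for u
  have D\<phi>: "(\<phi> has_real_derivative 1 / hel_w A u * \<psi> u) (at u)" for u
    using s by (auto simp: solves_def)
  have D\<psi>: "(\<psi> has_real_derivative \<beta> u * \<phi> u) (at u)" for u
    using s by (auto simp: solves_def \<beta>_def)
  have sb: "smooth (\<lambda>p::real^2. \<beta> (p $ 1))"
  proof -
    have "(\<lambda>p::real^2. \<beta> (p $ 1)) = (\<lambda>p. hel_w A (p $ 1) * hel_V A (p $ 1)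
        + \<kappa>\<^sup>2 * (1 / hel_w A (p $ 1)) + (- \<mu>) * hel_w A (p $ 1))"
      by (rule ext) (simp add: \<beta>_def)
    moreover have "smooth \<dots>"
      by (intro smooth_add smooth_mult smooth_const smooth_hel_w smooth_hel_V)
    ultimately show ?thesis by simp
  qed
  let ?B = "{\<lambda>p::real^2. \<phi> (p $ 1), \<lambda>p. \<psi> (p $ 1)} \<union> {h. smooth h}"
  have pd\<phi>: "pd i (\<lambda>p::real^2. \<phi> (p $ 1)) = (\<lambda>p. (if i = 1 then 1 else 0) * (1 / hel_w A (p $ 1) * \<psi> (p $ 1)))" for i
    by (rule ext) (simp add: pd_of_coord[OF D\<phi>])
  have pd\<psi>: "pd i (\<lambda>p::real^2. \<psi> (p $ 1)) = (\<lambda>p. (if i = 1 then 1 else 0) * (\<beta> (p $ 1) * \<phi> (p $ 1)))" for i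
    by (rule ext) (simp add: pd_of_coord[OF D\<psi>])
  have diff: "b differentiable at p" if "b \<in> ?B" for b p
    using that pd_of_coord(2)[OF D\<phi>] pd_of_coord(2)[OF D\<psi>] smooth_differentiable by auto
  have "pd i (\<lambda>p. \<phi> (p $ 1)) \<in> function_algebra ?B" "pd i (\<lambda>p. \<psi> (p $ 1)) \<in> function_algebra ?B" for i
    unfolding pd\<phi> pd\<psi> by (intro function_algebra.intros; use sb smooth_hel_w in simp)+
  then have pd: "pd i b \<in> function_algebra ?B" if "b \<in> ?B" for b i
    using that by (auto intro: function_algebra.base smooth_pd)
  have ssin: "smooth (\<lambda>p::real^2. sin (\<kappa> * p $ 2))"
    by (intro smooth_cos_sin smooth_mult smooth_const smooth_coord)
  have f_alg: "f \<in> function_algebra ?B"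
    unfolding f_def by (rule function_algebra.mult; rule function_algebra.base) (use ssin in auto)
  show "smooth f"
    by (rule function_algebra_smooth[OF diff pd]) (rule f_alg | assumption)+
  have Dsin: "((\<lambda>v. sin (\<kappa> * v)) has_real_derivative \<kappa> * cos (\<kappa> * v)) (at v)"
    "((\<lambda>v. \<kappa> * cos (\<kappa> * v)) has_real_derivative - (\<kappa>\<^sup>2 * sin (\<kappa> * v))) (at v)" for v
    by (auto intro!: derivative_eq_intros simp: power2_eq_square)
  have "pd 1 f q = 1 / hel_w A (q $ 1) * \<psi> (q $ 1) * sin (\<kappa> * q $ 2)"
    "pd 2 f q = \<phi> (q $ 1) * (\<kappa> * cos (\<kappa> * q $ 2))" for q
    unfolding f_def by (rule pd_separated[OF D\<phi> Dsin(1)])+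
  then have e1: "(\<lambda>q. hel_w A (q $ 1) * pd 1 f q) = (\<lambda>q. \<psi> (q $ 1) * sin (\<kappa> * q $ 2))"
    and e2: "(\<lambda>q. 1 / hel_w A (q $ 1) * pd 2 f q) = (\<lambda>q. (1 / hel_w A (q $ 1) * \<phi> (q $ 1)) * (\<kappa> * cos (\<kappa> * q $ 2)))"
    using less_imp_neq[OF hel_w_pos, symmetric, of A] by (auto simp: fun_eq_iff)
  have p1: "pd 1 (\<lambda>q. hel_w A (q $ 1) * pd 1 f q) p = \<beta> (p $ 1) * \<phi> (p $ 1) * sin (\<kappa> * p $ 2)"
    unfolding e1 by (rule pd_separated(1)[OF D\<psi> Dsin(1)])
  have w': "((\<lambda>u. 1 / hel_w A u * \<phi> u) has_real_derivative
      (0 * hel_w A u - 1 * ((1 + A\<^sup>2) * sinh u * cosh u / hel_w A u)) / (hel_w A u * hel_w A u) * \<phi> u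
        + 1 / hel_w A u * \<psi> u * (1 / hel_w A u)) (at u)" for u
    by (rule DERIV_mult[OF DERIV_divide[OF DERIV_const hel_w_deriv] D\<phi>]) (use hel_w_pos[of A u] in simp)
  have p2: "pd 2 (\<lambda>q. 1 / hel_w A (q $ 1) * pd 2 f q) p
      = (1 / hel_w A (p $ 1) * \<phi> (p $ 1)) * - (\<kappa>\<^sup>2 * sin (\<kappa> * p $ 2))"
    unfolding e2 by (rule pd_separated(2)[OF w' Dsin(2)])
  show "- jacobi_op (helicoid A) f p = \<mu> * f p"
    unfolding helicoid_jacobi_op p1 p2 \<beta>_def using hel_w_pos[of A "p $ 1"]
    by (simp add: f_def field_simps)
qed

text \<open>Applying \<open>d\<^sup>2/dx\<^sup>2 + \<kappa>\<^sub>j\<^sup>2\<close> to a linear relation removes the term with frequency \<open>\<kappa>\<^sub>j\<close> and multiplies the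
  others by nonzero constants.\<close>

lemma sines_independent:
  fixes \<kappa> c :: "'i \<Rightarrow> real"
  assumes "finite I" "inj_on \<kappa> I" "\<And>i. i \<in> I \<Longrightarrow> \<kappa> i > 0" and \<delta>: "\<delta> > 0"
    and "\<And>x. 0 < x \<Longrightarrow> x < \<delta> \<Longrightarrow> (\<Sum>i\<in>I. c i * sin (\<kappa> i * x)) = 0"
  shows "\<forall>i\<in>I. c i = 0"
  using assms(1,2,3,5)
proof (induction I arbitrary: c rule: finite_induct)
  case (insert j I)
  let ?I = "insert j I"
  have zero_deriv: "g' x = 0"
    if "\<And>x. 0 < x \<Longrightarrow> x < \<delta> \<Longrightarrow> g x = 0" "\<And>x. (g has_real_derivative g' x) (at x)" "0 < x" "x < \<delta>" for g g' x
  proof -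
    have "((\<lambda>x. 0) has_real_derivative 0) (at x)" by simp
    then have "(g has_real_derivative 0) (at x)"
      by (rule has_field_derivative_transform_within_open[of _ _ _ "{0<..<\<delta>}"]) (use that in auto)
    then show ?thesis using that(2) DERIV_unique by blast
  qed
  have d1: "(\<Sum>i\<in>?I. c i * (\<kappa> i * cos (\<kappa> i * x))) = 0" if "0 < x" "x < \<delta>" for x
    by (rule zero_deriv[where g = "\<lambda>x. \<Sum>i\<in>?I. c i * sin (\<kappa> i * x)", OF insert.prems(3) _ that])
      (auto intro!: derivative_eq_intros DERIV_sum)
  have d2: "(\<Sum>i\<in>?I. c i * (\<kappa> i * (- (\<kappa> i * sin (\<kappa> i * x))))) = 0" if "0 < x" "x < \<delta>" for x
    by (rule zero_deriv[where g = "\<lambda>x. \<Sum>i\<in>?I. c i * (\<kappa> i * cos (\<kappa> i * x))", OF d1 _ that])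
      (auto intro!: derivative_eq_intros DERIV_sum)
  have "(\<Sum>i\<in>I. (c i * ((\<kappa> j)\<^sup>2 - (\<kappa> i)\<^sup>2)) * sin (\<kappa> i * x)) = 0" if x: "0 < x" "x < \<delta>" for x
  proof -
    have "(\<kappa> j)\<^sup>2 * (\<Sum>i\<in>?I. c i * sin (\<kappa> i * x)) + (\<Sum>i\<in>?I. c i * (\<kappa> i * (- (\<kappa> i * sin (\<kappa> i * x)))))
      = (\<Sum>i\<in>?I. (c i * ((\<kappa> j)\<^sup>2 - (\<kappa> i)\<^sup>2)) * sin (\<kappa> i * x))"
      unfolding sum_distrib_left sum.distrib[symmetric]
      by (rule sum.cong) (simp_all add: algebra_simps power2_eq_square)
    then show ?thesis using insert.hyps insert.prems(3)[OF x] d2[OF x] by simp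
  qed
  then have "\<forall>i\<in>I. c i * ((\<kappa> j)\<^sup>2 - (\<kappa> i)\<^sup>2) = 0"
    by (intro insert.IH) (use insert.prems in auto)
  moreover have "(\<kappa> j)\<^sup>2 - (\<kappa> i)\<^sup>2 \<noteq> 0" if "i \<in> I" for i
  proof -
    have "\<kappa> i \<noteq> \<kappa> j" using insert.prems(1) insert.hyps(2) that by (auto simp: inj_on_def)
    moreover have "\<kappa> i > 0" "\<kappa> j > 0" using insert.prems(2) that by auto
    ultimately show ?thesis by (simp add: power2_eq_iff)
  qed
  ultimately have cI: "\<forall>i\<in>I. c i = 0" by auto
  define x where "x = min (\<delta> / 2) (pi / (2 * \<kappa> j))"
  have kj: "\<kappa> j > 0" using insert.prems by simp
  have x: "0 < x" "x < \<delta>" using \<delta> kj by (auto simp: x_def)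
  have "\<kappa> j * x \<le> \<kappa> j * (pi / (2 * \<kappa> j))" using kj by (intro mult_left_mono) (auto simp: x_def)
  also have "\<dots> < pi" using kj by simp
  finally have "sin (\<kappa> j * x) > 0" using kj x by (intro sin_gt_zero) auto
  moreover have "c j * sin (\<kappa> j * x) = 0"
    using insert.prems(3)[OF x] insert.hyps cI by simp
  ultimately have "c j = 0" by simp
  with cI show ?case by simp
qed simp

definition separated_mode :: "real \<Rightarrow> real \<Rightarrow> real \<Rightarrow> real \<Rightarrow> (real \<Rightarrow> real) \<Rightarrow> bool" where
  "separated_mode A R \<kappa> \<mu> \<phi> \<longleftrightarrow> \<mu> < 0 \<and> \<phi> 0 = 1 \<and> \<phi> R = 0 \<and> \<phi> (- R) = 0 \<and>
    smooth (\<lambda>p::real^2. \<phi> (p $ 1) * sin (\<kappa> * p $ 2)) \<and>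
    (\<forall>p. - jacobi_op (helicoid A) (\<lambda>p. \<phi> (p $ 1) * sin (\<kappa> * p $ 2)) p = \<mu> * (\<phi> (p $ 1) * sin (\<kappa> * p $ 2)))"

lemma negative_eigenfunctions:
  assumes "ell_complete A > 0"
  shows "\<exists>R>0. \<exists>\<epsilon>0>0. \<forall>\<kappa>. \<kappa>\<^sup>2 \<le> \<epsilon>0 \<longrightarrow> (\<exists>\<mu> \<phi>. separated_mode A R \<kappa> \<mu> \<phi>)"
proof -
  obtain R where R: "R > 0" "jac A R < 0" using jac_negative_somewhere[OF assms] by blast
  have nz: "\<forall>u. hel_w A u \<noteq> 0" using hel_w_pos by (metis less_irrefl)
  have "\<exists>\<epsilon>0>0. \<forall>\<epsilon>. 0 \<le> \<epsilon> \<and> \<epsilon> \<le> \<epsilon>0 \<longrightarrow> (\<exists>\<mu><0. \<exists>\<phi> \<psi>.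
    solves (\<lambda>u. 1 / hel_w A u) (\<lambda>u. hel_w A u * hel_V A u + \<epsilon> * (1 / hel_w A u) - \<mu> * hel_w A u) \<phi> \<psi>
      \<and> \<phi> R = 0 \<and> \<phi> (- R) = 0)"
  proof (rule dirichlet_shooting[OF _ _ _ _ _ _ _ _ jac_solves R])
    show "continuous_on UNIV (\<lambda>u. 1 / hel_w A u)"
      using nz by (intro continuous_intros hel_w_cont) simp
    show "continuous_on UNIV (\<lambda>u. hel_w A u * hel_V A u)"
      by (intro continuous_intros hel_w_cont hel_V_cont)
    show "0 \<le> 1 / hel_w A u" for u using hel_w_pos[of A u] by simp
  qed (simp_all add: hel_w_cont hel_w_even hel_V_def hel_w_ge_1)
  then obtain \<epsilon>0 where \<epsilon>0: "\<epsilon>0 > 0" and ex: "\<And>\<epsilon>. 0 \<le> \<epsilon> \<Longrightarrow> \<epsilon> \<le> \<epsilon>0 \<Longrightarrow> (\<exists>\<mu><0. \<exists>\<phi> \<psi>.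
    solves (\<lambda>u. 1 / hel_w A u) (\<lambda>u. hel_w A u * hel_V A u + \<epsilon> * (1 / hel_w A u) - \<mu> * hel_w A u) \<phi> \<psi>
      \<and> \<phi> R = 0 \<and> \<phi> (- R) = 0)" by blast
  have "\<exists>\<mu> \<phi>. separated_mode A R \<kappa> \<mu> \<phi>"
    if \<kappa>: "\<kappa>\<^sup>2 \<le> \<epsilon>0" for \<kappa>
  proof -
    obtain \<mu> \<phi> \<psi> where *: "\<mu> < 0" "\<phi> R = 0" "\<phi> (- R) = 0"
      and s: "solves (\<lambda>u. 1 / hel_w A u) (\<lambda>u. hel_w A u * hel_V A u + \<kappa>\<^sup>2 * (1 / hel_w A u) - \<mu> * hel_w A u) \<phi> \<psi>"
      using ex[OF zero_le_power2 \<kappa>] by blast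
    have "\<phi> 0 = 1" using s by (simp add: solves_def)
    with * separated_eigenfunction[OF s] have "separated_mode A R \<kappa> \<mu> \<phi>"
      unfolding separated_mode_def by blast
    then show ?thesis by blast
  qed
  with R \<epsilon>0 show ?thesis by blast
qed

text \<open>On a rectangle \<open>[- R, R] \<times> [0, L]\<close> with \<open>L\<close> large, the \<open>n\<close> lowest frequencies \<open>(i + 1) \<pi> / L\<close> all admit a
  negative eigenvalue. The eigenfunctions restrict to independent sines on the segment \<open>u = 0\<close>.\<close>

lemma helicoid_infinite_index:
  assumes "ell_complete A > 0"
  shows "morse_index (helicoid A) = \<infinity>"
proof -
  obtain R \<epsilon>0 where R: "R > 0" and \<epsilon>0: "\<epsilon>0 > 0"
    and ex: "\<forall>\<kappa>. \<kappa>\<^sup>2 \<le> \<epsilon>0 \<longrightarrow> (\<exists>\<mu> \<phi>. separated_mode A R \<kappa> \<mu> \<phi>)"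
    using negative_eigenfunctions[OF assms] by blast
  have "enat n \<le> morse_index (helicoid A)" for n
  proof -
    \<comment> \<open>The length for which even the frequency \<open>(n + 1) \<pi> / L\<close> is at most \<open>sqrt \<epsilon>0\<close>.\<close>
    define L where "L = (real n + 1) * pi / sqrt \<epsilon>0"
    define \<kappa> where "\<kappa> i = (real i + 1) * pi / L" for i :: nat
    have L: "L > 0" using \<epsilon>0 by (simp add: L_def)
    have \<kappa>_pos: "\<kappa> i > 0" for i using L by (simp add: \<kappa>_def)
    have "\<kappa> i \<le> sqrt \<epsilon>0" if "i < n" for i
    proof -
      have "\<kappa> i = (real i + 1) / (real n + 1) * sqrt \<epsilon>0" using \<epsilon>0 by (simp add: \<kappa>_def L_def)
      also have "\<dots> \<le> 1 * sqrt \<epsilon>0" using that \<epsilon>0 by (intro mult_right_mono) auto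
      finally show ?thesis by simp
    qed
    then have \<kappa>_sq: "(\<kappa> i)\<^sup>2 \<le> \<epsilon>0" if "i < n" for i
      using power_mono[of "\<kappa> i" "sqrt \<epsilon>0" 2] \<kappa>_pos[of i] \<epsilon>0 that by simp
    have "\<exists>m. i < n \<longrightarrow> separated_mode A R (\<kappa> i) (fst m) (snd m)" for i
      using ex[rule_format, OF \<kappa>_sq[of i]] by auto
    then obtain m where m: "\<And>i. i < n \<Longrightarrow> separated_mode A R (\<kappa> i) (fst (m i)) (snd (m i))"
      by metis
    define \<mu> \<phi> where "\<mu> i = fst (m i)" and "\<phi> i = snd (m i)" for i
    note \<mu>\<phi> = m[folded \<mu>_def \<phi>_def, unfolded separated_mode_def]
    define f where "f i p = \<phi> i (p $ 1) * sin (\<kappa> i * p $ 2)" for i and p :: "real^2"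
    let ?\<Omega> = "rectangle R L"
    have eig: "dirichlet_eigenfunction (helicoid A) ?\<Omega> (\<mu> i) (f i)" if "i < n" for i
      unfolding dirichlet_eigenfunction_def
    proof (intro conjI ballI)
      show "smooth (f i)" using \<mu>\<phi>[OF that] by (simp add: f_def[abs_def])
      show "- jacobi_op (helicoid A) (f i) p = \<mu> i * f i p" for p
        using \<mu>\<phi>[OF that] by (simp add: f_def[abs_def])
      fix p assume "p \<in> frontier ?\<Omega>"
      then consider "p $ 1 = R" | "p $ 1 = - R" | "p $ 2 = 0" | "p $ 2 = L"
        using frontier_rectangle by blast
      then show "f i p = 0"
      proof cases
        case 4
        have "\<kappa> i * L = real (Suc i) * pi" using L by (simp add: \<kappa>_def)
        then show ?thesis using 4 by (simp only: f_def sin_npi mult_zero_right)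
      qed (use \<mu>\<phi>[OF that] in \<open>simp_all add: f_def\<close>)
    qed
    have indep: "\<forall>i<n. c i = 0" if z: "\<forall>p\<in>?\<Omega>. (\<Sum>i<n. c i * f i p) = 0" for c
    proof -
      have "\<forall>i\<in>{..<n}. c i = 0"
      proof (rule sines_independent[OF _ _ _ L])
        show "inj_on \<kappa> {..<n}" using L by (auto simp: inj_on_def \<kappa>_def)
        fix x assume x: "0 < x" "x < L"
        have "vector [0, x] \<in> ?\<Omega>" using x R by (simp add: rectangle_iff)
        with z have "(\<Sum>i<n. c i * f i (vector [0, x])) = 0" by blast
        then show "(\<Sum>i<n. c i * sin (\<kappa> i * x)) = 0" using \<mu>\<phi> by (simp add: f_def)
      qed (use \<kappa>_pos in auto)
      then show ?thesis by simp
    qed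
    have "enat n \<le> morse_index_on (helicoid A) ?\<Omega>"
      unfolding morse_index_on_def
    proof (rule Sup_upper, rule CollectI, intro exI[of _ n] conjI refl exI[of _ \<mu>] exI[of _ f])
      show "\<forall>i<n. \<mu> i < 0 \<and> dirichlet_eigenfunction (helicoid A) ?\<Omega> (\<mu> i) (f i)" using \<mu>\<phi> eig by blast
      show "\<forall>c. (\<forall>p\<in>?\<Omega>. (\<Sum>i<n. c i * f i p) = 0) \<longrightarrow> (\<forall>i<n. c i = 0)" using indep by blast
    qed
    also have "\<dots> \<le> morse_index (helicoid A)"
      unfolding morse_index_def using compact_subdomain_rectangle[OF R L] by (intro SUP_upper) simp
    finally show ?thesis .
  qed
  note ge = this
  show ?thesis
  proof (rule ccontr)
    assume "morse_index (helicoid A) \<noteq> \<infinity>"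
    then obtain m where "morse_index (helicoid A) = enat m" by auto
    with ge[of "Suc m"] show False by simp
  qed
qed

section \<open>Instability\<close>

lemma flat_exp_mono: "s \<le> t \<Longrightarrow> flat_exp 0 s \<le> flat_exp 0 t"
  by (auto simp: flat_exp_def divide_left_mono)

text \<open>With \<open>y = (n + 1) h\<^sup>2\<close> the energy density of the cutoff, weighted by \<open>h\<^sup>2\<close>, is
  \<open>4 (y * flat_exp 2 (y - 1))\<^sup>2\<close> times that of \<open>h\<close>. It is bounded uniformly in \<open>n\<close> and tends to \<open>0\<close> pointwise.\<close>

lemma flat_exp_2_bound:
  assumes "y \<ge> 0"
  shows "0 \<le> y * flat_exp 2 (y - 1)" "y * flat_exp 2 (y - 1) \<le> 3" "y \<ge> 2 \<Longrightarrow> y * flat_exp 2 (y - 1) \<le> 4 / y"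
proof -
  show "0 \<le> y * flat_exp 2 (y - 1)" using assms flat_exp_nonneg by simp
  show "y * flat_exp 2 (y - 1) \<le> 3"
  proof (cases "y > 1")
    case True
    define s where "s = 1 / (y - 1)"
    have s: "s > 0" using True by (simp add: s_def)
    have y: "y = 1 + 1 / s" using True by (simp add: s_def)
    have "s\<^sup>2 + s \<le> 3 * exp s"
      using exp_lower_Taylor_quadratic[of s] s zero_le_square[of s] unfolding power2_eq_square by linarith
    then have "(s\<^sup>2 + s) * exp (- s) \<le> 3 * exp s * exp (- s)" by (intro mult_right_mono) auto
    then have "(s\<^sup>2 + s) * exp (- s) \<le> 3" by (simp add: mult.assoc flip: exp_add)
    moreover have "y * flat_exp 2 (y - 1) = (s\<^sup>2 + s) * exp (- s)"
      using True s unfolding flat_exp_def s_def[symmetric] by (simp add: y power2_eq_square algebra_simps)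
    ultimately show ?thesis by simp
  next
    case False
    then show ?thesis by (simp add: flat_exp_def)
  qed
  show "y * flat_exp 2 (y - 1) \<le> 4 / y" if "y \<ge> 2"
  proof -
    have "flat_exp 2 (y - 1) \<le> (1 / (y - 1))\<^sup>2 * 1"
      using that unfolding flat_exp_def by (simp add: mult_left_le)
    then have "y * flat_exp 2 (y - 1) \<le> y * (1 / (y - 1))\<^sup>2" using that by (simp add: mult_left_mono)
    also have "\<dots> \<le> 4 / y"
    proof -
      have "y * y \<le> (2 * (y - 1)) * (2 * (y - 1))" using that by (intro mult_mono) auto
      then show ?thesis using that by (simp add: field_simps power2_eq_square)
    qed
    finally show ?thesis .
  qed
qed

text \<open>The ground state substitution: if \<open>h\<close> is an eigenfunction, multiplying it by a cutoff \<open>g\<close> costs only the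
  energy of \<open>g\<close> weighted by \<open>h\<^sup>2\<close>.\<close>

lemma product_energy:
  assumes h: "smooth h" and g: "smooth g" and K: "compact K" "\<And>p. p \<notin> K \<Longrightarrow> g p = 0"
    and eig: "\<And>p. p \<in> K \<Longrightarrow> - jacobi_op (helicoid A) h p = \<mu> * h p"
  shows "hel_energy A (\<lambda>p. h p * g p) = \<mu> * hel_mass A (\<lambda>p. h p * g p)
    + (LINT p|lborel. (h p)\<^sup>2 * (hel_w A (p $ 1) * (pd 1 g p)\<^sup>2 + (pd 2 g p)\<^sup>2 / hel_w A (p $ 1)))"
proof -
  define w where "w = (\<lambda>p::real^2. hel_w A (p $ 1))"
  have wpos: "w p > 0" for p by (simp add: w_def hel_w_pos)
  have smw: "smooth w" "smooth (\<lambda>p. 1 / w p)" unfolding w_def by (rule smooth_hel_w)+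
  define a where "a p = w p * pd 1 g p" for p
  define b where "b p = 1 / w p * pd 2 g p" for p
  define hu where "hu p = w p * pd 1 h p" for p
  define hv where "hv p = 1 / w p * pd 2 h p" for p
  have sm: "smooth a" "smooth b" "smooth hu" "smooth hv"
    unfolding a_def b_def hu_def hv_def by (intro smooth_mult smw smooth_pd h g)+
  note d = smooth_differentiable[OF sm(1)] smooth_differentiable[OF sm(2)] smooth_differentiable[OF sm(3)]
    smooth_differentiable[OF sm(4)] smooth_differentiable[OF h] smooth_differentiable[OF g]
  define F1 where "F1 p = h p * h p * g p * a p" for p
  define F2 where "F2 p = h p * h p * g p * b p" for p
  have sF: "smooth F1" "smooth F2" unfolding F1_def F2_def by (intro smooth_mult h g sm)+
  note closed = compact_imp_closed[OF K(1)]
  have gout: "pd i g p = 0" if "p \<notin> K" for i p by (rule pd_outside[OF closed K(2) that])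
  have int: "integrable lborel (pd i F)" "(LINT p|lborel. pd i F p) = 0"
    if "smooth F" "\<And>p. p \<notin> K \<Longrightarrow> F p = 0" for i and F :: "real^2 \<Rightarrow> real"
    using integral_pd_eq_0[where F = F and i = i and K = K] smooth_differentiable[OF that(1)]
      smooth_continuous[OF smooth_pd[OF that(1)]] K(1) that(2) by simp_all
  have F0: "F1 p = 0" "F2 p = 0" if "p \<notin> K" for p using K(2)[OF that] by (auto simp: F1_def F2_def)
  define f where "f p = h p * g p" for p
  have smf: "smooth f" unfolding f_def by (intro smooth_mult h g)
  define J where "J p = f p * jacobi_op (helicoid A) f p * w p" for p
  define M where "M p = (f p)\<^sup>2 * w p" for p
  define E where "E p = (h p)\<^sup>2 * (w p * (pd 1 g p)\<^sup>2 + (pd 2 g p)\<^sup>2 / w p)" for p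
  have f0: "f p = 0" if "p \<notin> K" for p using K(2)[OF that] by (simp add: f_def)
  have intM: "integrable lborel M" unfolding M_def
    by (rule smooth_integrable[OF _ K(1)]) (simp_all add: power2_eq_square smooth_mult smf smw f0)
  have Eeq: "E p = h p * h p * (a p * pd 1 g p + b p * pd 2 g p)" for p
    using wpos[of p] by (simp add: E_def a_def b_def power2_eq_square algebra_simps)
  have "smooth (\<lambda>p. h p * h p * (a p * pd 1 g p + b p * pd 2 g p))"
    by (intro smooth_mult smooth_add h sm smooth_pd g)
  then have intE: "integrable lborel E"
    unfolding Eeq[abs_def] by (rule smooth_integrable[OF _ K(1)]) (simp add: gout)
  have pointwise: "- J p = \<mu> * M p + E p - pd 1 F1 p - pd 2 F2 p" for p
  proof (cases "p \<in> K")
    case True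
    have pf: "pd i f = (\<lambda>q. h q * pd i g q + pd i h q * g q)" for i
      unfolding f_def by (rule ext) (simp add: pd_mult d)
    have "(\<lambda>q. w q * pd 1 f q) = (\<lambda>q. h q * a q + hu q * g q)"
      "(\<lambda>q. 1 / w q * pd 2 f q) = (\<lambda>q. h q * b q + hv q * g q)"
      unfolding pf a_def b_def hu_def hv_def by (auto simp: fun_eq_iff algebra_simps add_divide_distrib)
    note wf = this
    have q1: "pd 1 (\<lambda>q. h q * a q + hu q * g q) p
        = h p * pd 1 a p + pd 1 h p * a p + (hu p * pd 1 g p + pd 1 hu p * g p)"
      "pd 2 (\<lambda>q. h q * b q + hv q * g q) p
        = h p * pd 2 b p + pd 2 h p * b p + (hv p * pd 2 g p + pd 2 hv p * g p)"
      by (simp_all add: pd_add pd_mult d differentiable_mult)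
    have x: "hu p * pd 1 g p = pd 1 h p * a p" "hv p * pd 2 g p = pd 2 h p * b p"
      by (simp_all add: hu_def hv_def a_def b_def)
    have "- (pd 1 hu p + pd 2 hv p - w p * hel_V A (p $ 1) * h p) = \<mu> * h p * w p"
    proof -
      have "jacobi_op (helicoid A) h p = 1 / w p * (pd 1 hu p + pd 2 hv p) - hel_V A (p $ 1) * h p"
        unfolding helicoid_jacobi_op hu_def[abs_def] hv_def[abs_def] w_def ..
      then have "- (1 / w p * (pd 1 hu p + pd 2 hv p) - hel_V A (p $ 1) * h p) * w p = \<mu> * h p * w p"
        using eig[OF True] by simp
      then show ?thesis using wpos[of p] by (simp add: algebra_simps)
    qed
    then have eigw: "pd 1 hu p + pd 2 hv p = w p * hel_V A (p $ 1) * h p - \<mu> * h p * w p" by simp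
    have "w p * jacobi_op (helicoid A) f p = pd 1 (\<lambda>q. w q * pd 1 f q) p + pd 2 (\<lambda>q. 1 / w q * pd 2 f q) p
        - w p * hel_V A (p $ 1) * f p"
      using wpos[of p] unfolding helicoid_jacobi_op w_def by (simp add: algebra_simps)
    also have "\<dots> = h p * (pd 1 a p + pd 2 b p) + 2 * (pd 1 h p * a p + pd 2 h p * b p)
        + g p * (pd 1 hu p + pd 2 hv p) - w p * hel_V A (p $ 1) * f p"
      unfolding wf q1 x by (simp add: algebra_simps)
    also have "\<dots> = h p * (pd 1 a p + pd 2 b p) + 2 * (pd 1 h p * a p + pd 2 h p * b p) - \<mu> * f p * w p"
      unfolding eigw f_def by (simp add: algebra_simps)
    finally have wJ: "w p * jacobi_op (helicoid A) f p
        = h p * (pd 1 a p + pd 2 b p) + 2 * (pd 1 h p * a p + pd 2 h p * b p) - \<mu> * f p * w p" .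
    have "J p = f p * (w p * jacobi_op (helicoid A) f p)" by (simp add: J_def)
    then have Jp: "J p = f p * (h p * (pd 1 a p + pd 2 b p) + 2 * (pd 1 h p * a p + pd 2 h p * b p) - \<mu> * f p * w p)"
      by (simp only: wJ)
    have F: "pd 1 F1 p = h p * h p * g p * pd 1 a p + (h p * h p * pd 1 g p + 2 * h p * pd 1 h p * g p) * a p"
      "pd 2 F2 p = h p * h p * g p * pd 2 b p + (h p * h p * pd 2 g p + 2 * h p * pd 2 h p * g p) * b p"
      unfolding F1_def F2_def by (simp_all add: pd_mult d differentiable_mult algebra_simps)
    show ?thesis unfolding Jp F Eeq M_def f_def by (simp add: algebra_simps power2_eq_square)
  next
    case False
    have "pd 1 F1 p = 0" "pd 2 F2 p = 0"
      by (rule pd_outside[OF closed _ False]; simp add: F0)+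
    then show ?thesis using f0[OF False] gout[OF False] by (simp add: J_def M_def E_def)
  qed
  note ints = intM intE int(1)[OF sF(1), of 1] int(1)[OF sF(2), of 2] F0
  have "hel_energy A f = (LINT p|lborel. - J p)"
    by (simp add: hel_energy_def J_def w_def)
  also have "\<dots> = (LINT p|lborel. \<mu> * M p + E p - pd 1 F1 p - pd 2 F2 p)"
    by (simp only: pointwise)
  also have "\<dots> = \<mu> * (LINT p|lborel. M p) + (LINT p|lborel. E p) - (LINT p|lborel. pd 1 F1 p) - (LINT p|lborel. pd 2 F2 p)"
    using ints by simp
  also have "\<dots> = \<mu> * (LINT p|lborel. M p) + (LINT p|lborel. E p)"
    using int(2)[OF sF(1) F0(1), of 1] int(2)[OF sF(2) F0(2), of 2] by simp
  finally show ?thesis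
    unfolding hel_mass_def M_def E_def f_def w_def .
qed

text \<open>Cutting an eigenfunction off along its own level sets adapts the cutoff to the boundary, where the
  eigenfunction vanishes. The cutoff tends to \<open>1\<close> on \<open>\<Omega>\<close> wherever \<open>h\<close> does not vanish.\<close>

definition level_cutoff :: "(real^2) set \<Rightarrow> (real^2 \<Rightarrow> real) \<Rightarrow> nat \<Rightarrow> real^2 \<Rightarrow> real" where
  "level_cutoff \<Omega> h n p = (if p \<in> \<Omega> then flat_exp 0 (real (Suc n) * (h p * h p) + - 1) else 0)"

definition level_support :: "(real^2) set \<Rightarrow> (real^2 \<Rightarrow> real) \<Rightarrow> nat \<Rightarrow> (real^2) set" where
  "level_support \<Omega> h n = {p \<in> \<Omega>. real (Suc n) * (h p * h p) \<ge> 1}"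

lemma eigenfunction_cutoff:
  assumes \<Omega>: "compact \<Omega>" and h: "smooth h" and bd: "\<forall>p\<in>frontier \<Omega>. h p = 0"
  defines "g \<equiv> level_cutoff \<Omega> h" and "K \<equiv> level_support \<Omega> h"
  shows "compact (K n)" "K n \<subseteq> interior \<Omega>" "\<And>p. p \<notin> K n \<Longrightarrow> g n p = 0" "smooth (g n)"
    "\<And>p i. p \<in> interior \<Omega> \<Longrightarrow> pd i (g n) p
       = flat_exp 2 (real (Suc n) * (h p * h p) + - 1) * (2 * real (Suc n) * h p * pd i h p)"
proof -
  have cont: "continuous_on S h" for S by (rule smooth_continuous[OF h])
  have closed: "closed \<Omega>" by (rule compact_imp_closed[OF \<Omega>])
  have "closed {p. 1 \<le> real (Suc n) * (h p * h p)}"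
    by (intro closed_Collect_le continuous_intros cont)
  then have "compact (\<Omega> \<inter> {p. 1 \<le> real (Suc n) * (h p * h p)})" by (rule compact_Int_closed[OF \<Omega>])
  moreover have K_eq: "K n = \<Omega> \<inter> {p. 1 \<le> real (Suc n) * (h p * h p)}" by (auto simp: K_def level_support_def)
  ultimately show comp: "compact (K n)" by simp
  show sub: "K n \<subseteq> interior \<Omega>"
  proof
    fix p assume p: "p \<in> K n"
    then have "h p \<noteq> 0" by (auto simp: K_def level_support_def)
    then have "p \<notin> frontier \<Omega>" using bd by blast
    then show "p \<in> interior \<Omega>" using p closed by (auto simp: frontier_def K_def level_support_def)
  qed
  show out: "g n p = 0" if "p \<notin> K n" for p
    using that by (auto simp: g_def level_cutoff_def K_def level_support_def flat_exp_def)
  define z where "z p = real (Suc n) * (h p * h p) + - 1" for p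
  have sz: "smooth z" unfolding z_def by (intro smooth_add smooth_mult smooth_const h)
  show "smooth (g n)"
  proof (rule smooth_local)
    fix p
    show "\<exists>U g'. open U \<and> p \<in> U \<and> smooth g' \<and> (\<forall>q\<in>U. g n q = g' q)"
    proof (cases "p \<in> interior \<Omega>")
      case True
      have "\<forall>q\<in>interior \<Omega>. g n q = flat_exp 0 (z q)"
        using interior_subset by (auto simp: g_def level_cutoff_def z_def)
      then show ?thesis using True smooth_flat_exp[OF sz] open_interior by blast
    next
      case False
      have "open (- K n)" using compact_imp_closed[OF comp] by (simp add: open_Compl)
      moreover have "p \<in> - K n" using False sub by blast
      moreover have "\<forall>q\<in>- K n. g n q = 0" using out by blast
      ultimately show ?thesis using smooth_const by blast
    qed
  qed
  fix p i assume p: "p \<in> interior \<Omega>"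
  have "pd i (g n) p = pd i (\<lambda>q. flat_exp 0 (z q)) p"
    by (rule pd_cong_open[OF open_interior p]) (use interior_subset in \<open>auto simp: g_def level_cutoff_def z_def\<close>)
  also have "\<dots> = flat_exp 2 (z p) * pd i z p"
    using pd_compose(1)[OF smooth_differentiable[OF sz] flat_exp_deriv[of 0]] by (simp add: numeral_2_eq_2)
  also have "pd i z p = 2 * real (Suc n) * h p * pd i h p"
  proof -
    define N where "N = real (Suc n)"
    note d = smooth_differentiable[OF h]
    have "pd i (\<lambda>p. N * (h p * h p) + - 1) p = pd i (\<lambda>p. N * (h p * h p)) p + pd i (\<lambda>p. - 1) p"
      by (rule pd_add) (simp_all add: differentiable_mult d)
    also have "\<dots> = N * (h p * pd i h p + pd i h p * h p)"
      by (simp add: pd_mult differentiable_mult d)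
    finally show ?thesis unfolding z_def N_def[symmetric] by simp
  qed
  finally show "pd i (g n) p
       = flat_exp 2 (real (Suc n) * (h p * h p) + - 1) * (2 * real (Suc n) * h p * pd i h p)"
    by (simp add: z_def)
qed

text \<open>Test functions have compact support in the interior, eigenfunctions do not. By dominated convergence
  the cutoff energies tend to \<open>0\<close>, while the mass of the truncated eigenfunction does not decrease, so
  the contribution of \<open>\<mu> < 0\<close> prevails eventually.\<close>

lemma first_eigenvalue_on_neg:
  assumes \<Omega>: "compact_subdomain \<Omega>" and h: "smooth h" and bd: "\<forall>p\<in>frontier \<Omega>. h p = 0"
    and eig: "\<And>p. p \<in> interior \<Omega> \<Longrightarrow> - jacobi_op (helicoid A) h p = \<mu> * h p"
    and \<mu>: "\<mu> < 0" and c: "c \<in> interior \<Omega>" "h c \<noteq> 0"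
  shows "first_eigenvalue_on (helicoid A) \<Omega> < 0"
proof -
  have comp: "compact \<Omega>" using \<Omega> by (simp add: compact_subdomain_def)
  define g where "g = level_cutoff \<Omega> h"
  define K where "K = level_support \<Omega> h"
  note cut = eigenfunction_cutoff[OF comp h bd, folded g_def K_def]
  define f where "f n p = h p * g n p" for n p
  have smf: "smooth (f n)" for n unfolding f_def by (intro smooth_mult h cut(4))
  have fout: "f n p = 0" if "p \<notin> K n" for n p using cut(3)[OF that] by (simp add: f_def)
  have ftest: "f n \<in> test_functions \<Omega>" for n
  proof -
    have "{p. f n p \<noteq> 0} \<subseteq> K n" using fout by blast
    then have "closure {p. f n p \<noteq> 0} \<subseteq> K n"
      by (rule closure_minimal) (rule compact_imp_closed[OF cut(1)])
    also have "\<dots> \<subseteq> interior \<Omega>" by (rule cut(2))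
    finally show ?thesis using smf by (simp add: test_functions_def)
  qed
  define E where "E n p = (h p)\<^sup>2 * (hel_w A (p $ 1) * (pd 1 (g n) p)\<^sup>2 + (pd 2 (g n) p)\<^sup>2 / hel_w A (p $ 1))" for n p
  have energy: "hel_energy A (f n) = \<mu> * hel_mass A (f n) + (LINT p|lborel. E n p)" for n
    unfolding f_def E_def
  proof (rule product_energy[where K = "K n"])
    show "- jacobi_op (helicoid A) h p = \<mu> * h p" if "p \<in> K n" for p
      using eig cut(2)[of n] that by blast
  qed (use h cut in auto)
  define D where "D p = hel_w A (p $ 1) * (pd 1 h p)\<^sup>2 + (pd 2 h p)\<^sup>2 / hel_w A (p $ 1)" for p
  define y where "y n p = real (Suc n) * (h p * h p)" for n p
  have E_eq: "E n p = (if p \<in> interior \<Omega> then 4 * (y n p * flat_exp 2 (y n p - 1))\<^sup>2 * D p else 0)" for n p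
  proof (cases "p \<in> interior \<Omega>")
    case True
    show ?thesis
      unfolding E_def D_def y_def using True
      by (simp add: cut(5) algebra_simps power2_eq_square add_divide_distrib)
  next
    case False
    then have pK: "p \<notin> K n" using cut(2) by blast
    have "pd i (g n) p = 0" for i
      by (rule pd_outside[where K = "K n"]) (use pK cut(3) compact_imp_closed[OF cut(1)] in auto)
    then show ?thesis using False by (simp add: E_def)
  qed
  have D_nonneg: "D p \<ge> 0" for p using hel_w_pos[of A "p $ 1"] by (simp add: D_def)
  have y_nonneg: "y n p \<ge> 0" for n p by (simp add: y_def)
  have "(\<lambda>n. LINT p|lborel. E n p) \<longlonglongrightarrow> (LINT p|lborel. (\<lambda>p::real^2. 0) p)"
  proof (rule integral_dominated_convergence[where w = "\<lambda>p. indicator \<Omega> p *\<^sub>R (36 * D p)"])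
    have contD: "continuous_on S D" for S
      unfolding D_def using less_imp_neq[OF hel_w_pos, symmetric, of A]
      by (intro continuous_intros smooth_continuous smooth_pd h smooth_hel_w) auto
    show "integrable lborel (\<lambda>p. indicator \<Omega> p *\<^sub>R (36 * D p))"
      by (rule borel_integrable_compact[OF comp]) (intro continuous_intros contD)
    show "E n \<in> borel_measurable lborel" for n
    proof -
      have "continuous_on UNIV (E n)"
        unfolding E_def using less_imp_neq[OF hel_w_pos, symmetric, of A]
        by (intro continuous_intros smooth_continuous smooth_pd h cut(4) smooth_hel_w) auto
      then show ?thesis by (simp add: borel_measurable_continuous_onI)
    qed
    show "AE p in lborel. norm (E n p) \<le> indicator \<Omega> p *\<^sub>R (36 * D p)" for n
    proof (rule AE_I2)
      fix p
      show "norm (E n p) \<le> indicator \<Omega> p *\<^sub>R (36 * D p)"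
      proof (cases "p \<in> interior \<Omega>")
        case True
        have "(y n p * flat_exp 2 (y n p - 1))\<^sup>2 \<le> 3\<^sup>2"
          using flat_exp_2_bound[OF y_nonneg[of n p]] by (intro power_mono)
        then have "4 * (y n p * flat_exp 2 (y n p - 1))\<^sup>2 * D p \<le> 36 * D p"
          using D_nonneg[of p] by (intro mult_right_mono) auto
        then show ?thesis using True interior_subset[of \<Omega>] D_nonneg[of p] by (auto simp: E_eq)
      qed (use D_nonneg in \<open>simp add: E_eq\<close>)
    qed
    show "AE p in lborel. (\<lambda>n. E n p) \<longlonglongrightarrow> 0"
    proof (rule AE_I2)
      fix p
      have "(\<lambda>n. y n p * flat_exp 2 (y n p - 1)) \<longlonglongrightarrow> 0"
      proof (cases "h p = 0")
        case False
        then have hp: "h p * h p > 0" by (metis not_real_square_gt_zero)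
        have "(\<lambda>n. (4 / (h p * h p)) * (1 / real (Suc n))) \<longlonglongrightarrow> (4 / (h p * h p)) * 0"
          by (intro tendsto_mult tendsto_const LIMSEQ_Suc[OF lim_1_over_n])
        then have lim: "(\<lambda>n. 4 / y n p) \<longlonglongrightarrow> 0" by (simp add: y_def mult.commute)
        obtain N where N: "real N \<ge> 2 / (h p * h p)" using real_arch_simple by blast
        have "\<forall>\<^sub>F n in sequentially. y n p \<ge> 2"
          using eventually_ge_at_top[of N]
        proof eventually_elim
          fix n assume "N \<le> n"
          then have "2 / (h p * h p) \<le> real (Suc n)" using N by linarith
          then show "y n p \<ge> 2" using hp by (simp add: y_def pos_divide_le_eq)
        qed
        then have up: "\<forall>\<^sub>F n in sequentially. y n p * flat_exp 2 (y n p - 1) \<le> 4 / y n p"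
          by eventually_elim (rule flat_exp_2_bound(3)[OF y_nonneg])
        show ?thesis
          by (rule tendsto_sandwich[OF _ up tendsto_const lim])
            (simp add: flat_exp_2_bound(1)[OF y_nonneg])
      qed (simp add: y_def)
      then have "(\<lambda>n. 4 * (y n p * flat_exp 2 (y n p - 1))\<^sup>2 * D p) \<longlonglongrightarrow> 4 * 0\<^sup>2 * D p"
        by (intro tendsto_intros)
      then show "(\<lambda>n. E n p) \<longlonglongrightarrow> 0" by (cases "p \<in> interior \<Omega>") (simp_all add: E_eq)
    qed
  qed simp
  then have E_lim: "(\<lambda>n. LINT p|lborel. E n p) \<longlonglongrightarrow> 0" by simp
  have hc: "h c * h c > 0" using c(2) by (metis not_real_square_gt_zero)
  \<comment> \<open>From index \<open>N\<close> on the cutoff does not vanish at \<open>c\<close>, so the masses are bounded below.\<close>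
  obtain N where N: "real N \<ge> 2 / (h c * h c)" using real_arch_simple by blast
  have "real (Suc N) * (h c * h c) > 1"
  proof -
    have "2 \<le> real N * (h c * h c)" using N hc by (simp add: pos_divide_le_eq)
    then show ?thesis using hc by (simp add: algebra_simps)
  qed
  then have "f N c \<noteq> 0"
    using c interior_subset[of \<Omega>] by (auto simp: f_def g_def level_cutoff_def flat_exp_def)
  then have mN: "hel_mass A (f N) > 0"
    by (rule hel_mass_pos[OF smf cut(1) fout, rotated -1])
  have m_mono: "hel_mass A (f N) \<le> hel_mass A (f n)" if "N \<le> n" for n
    unfolding hel_mass_def
  proof (rule integral_mono)
    have int: "integrable lborel (\<lambda>p. (f n p)\<^sup>2 * hel_w A (p $ 1))" for n
      by (rule smooth_integrable[OF _ cut(1)[of n]])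
        (simp_all add: power2_eq_square smooth_mult smf smooth_hel_w fout)
    show "integrable lborel (\<lambda>p. (f N p)\<^sup>2 * hel_w A (p $ 1))" "integrable lborel (\<lambda>p. (f n p)\<^sup>2 * hel_w A (p $ 1))"
      by (rule int)+
    fix p
    have "real (Suc N) * (h p * h p) \<le> real (Suc n) * (h p * h p)"
      using that by (intro mult_right_mono) auto
    then have "g N p \<le> g n p" by (simp add: g_def level_cutoff_def flat_exp_mono)
    moreover have "0 \<le> g N p" by (simp add: g_def level_cutoff_def flat_exp_nonneg)
    ultimately have "(g N p)\<^sup>2 \<le> (g n p)\<^sup>2" by (rule power_mono)
    then have "(h p)\<^sup>2 * (g N p)\<^sup>2 \<le> (h p)\<^sup>2 * (g n p)\<^sup>2" by (rule mult_left_mono) simp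
    then show "(f N p)\<^sup>2 * hel_w A (p $ 1) \<le> (f n p)\<^sup>2 * hel_w A (p $ 1)"
      using hel_w_pos[of A "p $ 1"] unfolding f_def by (simp add: power_mult_distrib mult_right_mono)
  qed
  have "\<forall>\<^sub>F n in sequentially. (LINT p|lborel. E n p) < - \<mu> * hel_mass A (f N)"
    by (rule order_tendstoD(2)[OF E_lim]) (use \<mu> mN in \<open>simp add: mult_neg_pos\<close>)
  then have "\<forall>\<^sub>F n in sequentially. (LINT p|lborel. E n p) < - \<mu> * hel_mass A (f N) \<and> N \<le> n"
    using eventually_ge_at_top[of N] by (rule eventually_conj)
  then obtain n where n: "(LINT p|lborel. E n p) < - \<mu> * hel_mass A (f N)" "N \<le> n"
    using eventually_happens'[OF sequentially_bot] by blast
  have "- \<mu> * hel_mass A (f N) \<le> - \<mu> * hel_mass A (f n)"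
    using m_mono[OF n(2)] \<mu> by (intro mult_left_mono) auto
  then have neg: "hel_energy A (f n) < 0" using n(1) by (simp add: energy)
  have pos: "hel_mass A (f n) > 0" using mN m_mono[OF n(2)] by linarith
  have "first_eigenvalue_on (helicoid A) \<Omega> \<le> hel_energy A (f n) / hel_mass A (f n)"
    by (rule first_eigenvalue_on_le[OF \<Omega> ftest pos])
  also have "\<dots> < 0" using neg pos by (rule divide_neg_pos)
  finally show ?thesis .
qed

lemma helicoid_unstable:
  assumes "ell_complete A > 0"
  shows "unstable (helicoid A)"
proof -
  obtain R \<epsilon>0 where R: "R > 0" and \<epsilon>0: "\<epsilon>0 > 0"
    and ex: "\<forall>\<kappa>. \<kappa>\<^sup>2 \<le> \<epsilon>0 \<longrightarrow> (\<exists>\<mu> \<phi>. separated_mode A R \<kappa> \<mu> \<phi>)"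
    using negative_eigenfunctions[OF assms] by blast
  define L where "L = pi / sqrt \<epsilon>0"
  have L: "L > 0" using \<epsilon>0 by (simp add: L_def)
  have "(pi / L)\<^sup>2 \<le> \<epsilon>0" using \<epsilon>0 by (simp add: L_def)
  then obtain \<mu> \<phi> where m: "separated_mode A R (pi / L) \<mu> \<phi>" using ex by blast
  define h where "h p = \<phi> (p $ 1) * sin (pi / L * p $ 2)" for p :: "real^2"
  have "first_eigenvalue_on (helicoid A) (rectangle R L) < 0"
  proof (rule first_eigenvalue_on_neg[OF compact_subdomain_rectangle[OF R L]])
    show "smooth h" "\<mu> < 0" using m by (auto simp: separated_mode_def h_def[abs_def])
    show "- jacobi_op (helicoid A) h p = \<mu> * h p" for p
      using m by (auto simp: separated_mode_def h_def[abs_def])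
    have piL: "pi / L * L = pi" using L by simp
    show "\<forall>p\<in>frontier (rectangle R L). h p = 0"
    proof
      fix p assume "p \<in> frontier (rectangle R L)"
      then consider "p $ 1 = R" | "p $ 1 = - R" | "p $ 2 = 0" | "p $ 2 = L"
        using frontier_rectangle by blast
      then show "h p = 0"
      proof cases
        case 4
        then show ?thesis by (simp only: h_def piL sin_pi mult_zero_right)
      qed (use m in \<open>simp_all add: separated_mode_def h_def\<close>)
    qed
    show "vector [0, L / 2] \<in> interior (rectangle R L)"
      using R L by (simp add: interior_rectangle_iff)
    show "h (vector [0, L / 2]) \<noteq> 0"
      using m L by (simp add: h_def separated_mode_def)
  qed
  moreover have "first_eigenvalue (helicoid A) \<le> ereal (first_eigenvalue_on (helicoid A) (rectangle R L))"
    unfolding first_eigenvalue_helicoid using compact_subdomain_rectangle[OF R L] by (intro INF_lower) simp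
  ultimately show ?thesis
    unfolding unstable_def by (metis ereal_less(1) le_less_trans zero_ereal_def less_ereal.simps(1))
qed

section \<open>The critical numbers of rho\<close>

lemma ell_complete_integral:
  "(ell_integrand A has_integral ell_complete A) {0..pi / 2}"
  using fundamental_theorem_of_calculus[of 0 "pi / 2" "ell A" "ell_integrand A"] ell_deriv[of A]
  by (simp add: ell_complete_def ell_0 has_real_derivative_iff_has_vector_derivative has_vector_derivative_at_within)

definition rho_kernel :: "real \<Rightarrow> real \<Rightarrow> real" where
  "rho_kernel A \<theta> = A * (cos \<theta>)\<^sup>2 / ((A\<^sup>2 + (sin \<theta>)\<^sup>2) * sqrt (1 + A\<^sup>2 * (sin \<theta>)\<^sup>2))"

text \<open>The function \<open>rho\<close> in terms of the parameter \<open>A = coth a\<close> of the conjugate helicoid, as a complete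
  elliptic integral of the third kind.\<close>

definition rho_coth :: "real \<Rightarrow> real" where
  "rho_coth A = sqrt (A\<^sup>2 - 1) * integral {0..pi / 2} (rho_kernel A)"

lemma rho_kernel_cont: "A > 0 \<Longrightarrow> continuous_on S (rho_kernel A)"
  unfolding rho_kernel_def using one_plus_sq_pos[of A]
  by (intro continuous_intros) (auto simp: less_imp_neq[symmetric] add_pos_nonneg)

lemma arsinh_at_top: "filterlim (arsinh :: real \<Rightarrow> real) at_top at_top"
proof (rule filterlim_at_top_mono[OF ln_at_top])
  show "\<forall>\<^sub>F x::real in at_top. ln x \<le> arsinh x"
    using eventually_gt_at_top[of 0] by eventually_elim (simp add: arsinh_real_def add_pos_pos)
qed

lemma coth_props:
  assumes "a > 0"
  shows "coth a > 1" "(coth a)\<^sup>2 - 1 = 1 / (sinh a)\<^sup>2"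
proof -
  have s: "sinh a > 0" using assms by simp
  show "coth a > 1" using s sinh_less_cosh_real[of a] by (simp add: coth_def)
  show "(coth a)\<^sup>2 - 1 = 1 / (sinh a)\<^sup>2"
    using s cosh_sq[of a] by (simp add: coth_def power_divide divide_simps)
qed

text \<open>The substitution \<open>sinh t = sinh a * w\<close> with \<open>w = sqrt (1 + coth\<^sup>2 a sin\<^sup>2 \<theta>) / cos \<theta>\<close> removes the
  singularity of the integrand at \<open>t = a\<close> and makes the domain of integration independent of \<open>a\<close>.\<close>

lemma rho_eq_rho_coth:
  assumes a: "a > 0"
  shows "rho a = rho_coth (coth a)"
proof -
  define S C where "S = sinh a" and "C = cosh a"
  have SC: "S > 0" "C > 0" "C\<^sup>2 = 1 + S\<^sup>2" using a cosh_sq[of a] by (auto simp: S_def C_def)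
  have CS: "C\<^sup>2 + S\<^sup>2 > 0" by (intro add_pos_pos zero_less_power SC(1,2))
  define Y Z where "Y \<theta> = sqrt (S\<^sup>2 + C\<^sup>2 * (sin \<theta>)\<^sup>2)" and "Z \<theta> = sqrt (C\<^sup>2 + S\<^sup>2 * (sin \<theta>)\<^sup>2)" for \<theta>
  have Ypos: "Y \<theta> > 0" "(Y \<theta>)\<^sup>2 = S\<^sup>2 + C\<^sup>2 * (sin \<theta>)\<^sup>2" for \<theta>
    using SC by (auto simp: Y_def intro!: add_pos_nonneg)
  have Zpos: "Z \<theta> > 0" "(Z \<theta>)\<^sup>2 = C\<^sup>2 + S\<^sup>2 * (sin \<theta>)\<^sup>2" for \<theta>
    using SC by (auto simp: Z_def intro!: add_pos_nonneg)
  define g where "g \<theta> = arsinh (Y \<theta> / cos \<theta>)" for \<theta>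
  define g' where "g' \<theta> = sin \<theta> * (C\<^sup>2 + S\<^sup>2) / (cos \<theta> * Y \<theta> * Z \<theta>)" for \<theta>
  define f where "f t = sinh (2 * a) / cosh t * (1 / sqrt ((sinh (2 * t))\<^sup>2 - (sinh (2 * a))\<^sup>2))" for t
  define h where "h \<theta> = S * C * (cos \<theta>)\<^sup>2 / (Y \<theta> * (Z \<theta>)\<^sup>2)" for \<theta>
  have range: "sin \<theta> > 0" "cos \<theta> > 0" if "0 < ereal \<theta>" "ereal \<theta> < ereal (pi / 2)" for \<theta>
    using that sin_gt_zero2 cos_gt_zero by auto
  have one_plus: "sqrt ((Y \<theta> / cos \<theta>)\<^sup>2 + 1) = Z \<theta> / cos \<theta>" if "cos \<theta> > 0" for \<theta>
  proof (rule real_sqrt_unique)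
    have "(cos \<theta>)\<^sup>2 = 1 - (sin \<theta>)\<^sup>2" by (simp add: cos_squared_eq)
    then have "(Y \<theta>)\<^sup>2 + (cos \<theta>)\<^sup>2 = (Z \<theta>)\<^sup>2" unfolding Ypos Zpos SC(3) by (simp add: algebra_simps)
    then show "(Z \<theta> / cos \<theta>)\<^sup>2 = (Y \<theta> / cos \<theta>)\<^sup>2 + 1"
      using that by (simp add: power_divide field_simps)
  qed (use that Zpos[of \<theta>] in simp)
  have cosh_g: "cosh (g \<theta>) = Z \<theta> / cos \<theta>" and sinh_g: "sinh (g \<theta>) = Y \<theta> / cos \<theta>"
    if "cos \<theta> > 0" for \<theta>
  proof -
    show "sinh (g \<theta>) = Y \<theta> / cos \<theta>" by (simp add: g_def)
    then show "cosh (g \<theta>) = Z \<theta> / cos \<theta>"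
      using one_plus[OF that] cosh_sq[of "g \<theta>"] cosh_real_pos[of "g \<theta>"]
      by (metis add.commute abs_of_pos real_sqrt_abs)
  qed
  have root: "sqrt ((sinh (2 * g \<theta>))\<^sup>2 - (sinh (2 * a))\<^sup>2) = 2 * sin \<theta> * (C\<^sup>2 + S\<^sup>2) / (cos \<theta>)\<^sup>2"
    if "sin \<theta> > 0" "cos \<theta> > 0" for \<theta>
  proof (rule real_sqrt_unique)
    have c: "(cos \<theta>)\<^sup>2 = 1 - (sin \<theta>)\<^sup>2" by (simp add: cos_squared_eq)
    have "(Y \<theta>)\<^sup>2 * (Z \<theta>)\<^sup>2 - S\<^sup>2 * C\<^sup>2 * ((cos \<theta>)\<^sup>2)\<^sup>2 = (sin \<theta>)\<^sup>2 * (C\<^sup>2 + S\<^sup>2)\<^sup>2"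
      unfolding Ypos Zpos c by (simp add: algebra_simps power2_eq_square)
    then have "((sin \<theta>)\<^sup>2 * (C\<^sup>2 + S\<^sup>2)\<^sup>2) / ((cos \<theta>)\<^sup>2)\<^sup>2 = (Y \<theta>)\<^sup>2 * (Z \<theta>)\<^sup>2 / ((cos \<theta>)\<^sup>2)\<^sup>2 - S\<^sup>2 * C\<^sup>2"
      using that by (simp add: field_simps)
    moreover have "(sinh (2 * g \<theta>))\<^sup>2 = 4 * ((Y \<theta>)\<^sup>2 * (Z \<theta>)\<^sup>2 / ((cos \<theta>)\<^sup>2)\<^sup>2)"
      using that by (simp add: sinh_double cosh_g sinh_g power_mult_distrib power_divide)
    moreover have "(sinh (2 * a))\<^sup>2 = 4 * (S\<^sup>2 * C\<^sup>2)"
      by (simp add: sinh_double S_def C_def power_mult_distrib)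
    ultimately show "(2 * sin \<theta> * (C\<^sup>2 + S\<^sup>2) / (cos \<theta>)\<^sup>2)\<^sup>2 = (sinh (2 * g \<theta>))\<^sup>2 - (sinh (2 * a))\<^sup>2"
      by (simp add: power_mult_distrib power_divide)
  qed (use that SC in simp)
  have root_pos: "(sinh (2 * g \<theta>))\<^sup>2 - (sinh (2 * a))\<^sup>2 > 0" if "sin \<theta> > 0" "cos \<theta> > 0" for \<theta>
  proof -
    have "2 * sin \<theta> * (C\<^sup>2 + S\<^sup>2) / (cos \<theta>)\<^sup>2 > 0" using that CS
      by (intro divide_pos_pos mult_pos_pos zero_less_power) auto
    then show ?thesis unfolding root[OF that, symmetric] by simp
  qed
  have fg: "f (g \<theta>) * g' \<theta> = h \<theta>" if "sin \<theta> > 0" "cos \<theta> > 0" for \<theta>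
  proof -
    have "f (g \<theta>) * g' \<theta> = 2 * S * C / (Z \<theta> / cos \<theta>) * (1 / (2 * sin \<theta> * (C\<^sup>2 + S\<^sup>2) / (cos \<theta>)\<^sup>2))
        * (sin \<theta> * (C\<^sup>2 + S\<^sup>2) / (cos \<theta> * Y \<theta> * Z \<theta>))"
      unfolding f_def g'_def root[OF that] cosh_g[OF that(2)] by (simp add: sinh_double S_def C_def)
    also have "\<dots> = h \<theta>"
    proof -
      define W where "W = C\<^sup>2 + S\<^sup>2"
      have "W \<noteq> 0" using CS by (simp only: W_def less_imp_neq[symmetric] not_False_eq_True)
      then show ?thesis
        unfolding h_def W_def[symmetric] using that Ypos(1)[of \<theta>] Zpos(1)[of \<theta>]
        by (simp add: field_simps power2_eq_square)
    qed
    finally show ?thesis .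
  qed
  have Y_deriv: "(Y has_real_derivative C\<^sup>2 * sin \<theta> * cos \<theta> / Y \<theta>) (at \<theta>)" for \<theta>
  proof -
    have "S\<^sup>2 + C\<^sup>2 * (sin \<theta>)\<^sup>2 > 0" using SC by (simp add: add_pos_nonneg)
    then show ?thesis unfolding Y_def by (auto intro!: derivative_eq_intros simp: field_simps)
  qed
  have g_deriv: "(g has_real_derivative g' \<theta>) (at \<theta>)" if "sin \<theta> > 0" "cos \<theta> > 0" for \<theta>
  proof -
    have "((\<lambda>\<theta>. Y \<theta> / cos \<theta>) has_real_derivative
        (C\<^sup>2 * sin \<theta> * cos \<theta> / Y \<theta> * cos \<theta> - Y \<theta> * - sin \<theta>) / (cos \<theta> * cos \<theta>)) (at \<theta>)"
      by (rule DERIV_divide[OF Y_deriv DERIV_cos]) (use that in simp)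
    from DERIV_chain2[OF arsinh_real_has_field_derivative this]
    have "(g has_real_derivative 1 / (Z \<theta> / cos \<theta>) *
        ((C\<^sup>2 * sin \<theta> * cos \<theta> / Y \<theta> * cos \<theta> - Y \<theta> * - sin \<theta>) / (cos \<theta> * cos \<theta>))) (at \<theta>)"
      unfolding g_def one_plus[OF that(2)] .
    also have "1 / (Z \<theta> / cos \<theta>) *
        ((C\<^sup>2 * sin \<theta> * cos \<theta> / Y \<theta> * cos \<theta> - Y \<theta> * - sin \<theta>) / (cos \<theta> * cos \<theta>))
      = sin \<theta> * (C\<^sup>2 * (cos \<theta>)\<^sup>2 + (Y \<theta>)\<^sup>2) / (cos \<theta> * Y \<theta> * Z \<theta>)"
      using that Ypos(1)[of \<theta>] Zpos(1)[of \<theta>] by (simp add: field_simps power2_eq_square)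
    also have "C\<^sup>2 * (cos \<theta>)\<^sup>2 + (Y \<theta>)\<^sup>2 = C\<^sup>2 + S\<^sup>2"
      unfolding Ypos by (simp add: cos_squared_eq algebra_simps)
    finally show ?thesis by (simp add: g'_def)
  qed
  have cont_h: "continuous_on T h" for T
    unfolding h_def Y_def Z_def using Ypos(1) Zpos(1)
    by (intro continuous_intros) (auto simp: Y_def Z_def less_imp_neq[symmetric])
  have h_int: "set_integrable lborel {0..pi / 2} h"
    by (rule borel_integrable_atLeastAtMost') (rule cont_h)
  have cont_YZ: "isCont Y \<theta>" "isCont Z \<theta>" for \<theta>
    unfolding Y_def Z_def by (intro continuous_intros)+
  have "(LBINT t=ereal a..\<infinity>. f t) = (LBINT \<theta>=ereal 0..ereal (pi / 2). f (g \<theta>) * g' \<theta>)"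
  proof (rule interval_integral_substitution_nonneg(2))
    show "ereal 0 < ereal (pi / 2)" by simp
    fix x :: real
    assume x: "ereal 0 < ereal x" "ereal x < ereal (pi / 2)"
    note r = range[OF x[unfolded zero_ereal_def[symmetric]]]
    show "(g has_real_derivative g' x) (at x)" by (rule g_deriv[OF r])
    show "isCont f (g x)"
      unfolding f_def using root_pos[OF r] by (intro continuous_intros) auto
    show "isCont g' x"
      unfolding g'_def using r Ypos(1)[of x] Zpos(1)[of x] by (intro continuous_intros cont_YZ) auto
    show "0 \<le> f (g x)"
      unfolding f_def using a root_pos[OF r] by simp
  next
    fix x :: real assume "ereal 0 \<le> ereal x" "ereal x \<le> ereal (pi / 2)"
    then have "sin x \<ge> 0" "cos x \<ge> 0" by (auto intro!: sin_ge_zero cos_ge_zero)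
    then show "0 \<le> g' x"
      unfolding g'_def using Ypos(1)[of x] Zpos(1)[of x] by simp
  next
    have "isCont (\<lambda>\<theta>. Y \<theta> / cos \<theta>) 0"
      by (rule isCont_divide[OF cont_YZ(1) isCont_cos]) simp
    then have "isCont g 0"
      unfolding g_def[abs_def] by (rule isCont_o2[OF _ DERIV_isCont[OF arsinh_real_has_field_derivative]])
    then have "(g \<longlongrightarrow> g 0) (at_right 0)"
      by (rule tendsto_within_subset[OF isContD subset_UNIV])
    moreover have "g 0 = a" using SC by (simp add: g_def Y_def S_def arsinh_sinh_real)
    ultimately have "(g \<longlongrightarrow> a) (at_right 0)" by simp
    then show "((ereal \<circ> g \<circ> real_of_ereal) \<longlongrightarrow> ereal a) (at_right (ereal 0))"
      by (simp only: ereal_tendsto_simps)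
  next
    have c0: "(cos \<longlongrightarrow> 0) (at_left (pi / 2))"
      using tendsto_within_subset[OF isContD[OF isCont_cos[of "pi / 2"]] subset_UNIV] by simp
    have cpos: "\<forall>\<^sub>F x in at_left (pi / 2). 0 < cos x"
      using eventually_at_left_real[of 0 "pi / 2"] by (auto elim!: eventually_mono intro: cos_gt_zero)
    have "filterlim (\<lambda>x. inverse (cos x)) at_top (at_left (pi / 2))"
      by (rule filterlim_inverse_at_top[OF c0 cpos])
    moreover have "(Y \<longlongrightarrow> Y (pi / 2)) (at_left (pi / 2))"
      using tendsto_within_subset[OF isContD[OF cont_YZ(1)] subset_UNIV] .
    ultimately have "filterlim (\<lambda>x. Y x * inverse (cos x)) at_top (at_left (pi / 2))"
      by (intro filterlim_tendsto_pos_mult_at_top[OF _ Ypos(1)])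
    then have "filterlim g at_top (at_left (pi / 2))"
      unfolding g_def divide_inverse by (rule filterlim_compose[OF arsinh_at_top])
    then show "((ereal \<circ> g \<circ> real_of_ereal) \<longlongrightarrow> \<infinity>) (at_left (ereal (pi / 2)))"
      by (simp only: ereal_tendsto_simps)
  next
    have "set_integrable lborel (einterval (ereal 0) (ereal (pi / 2))) h"
      by (rule set_integrable_subset[OF h_int]) auto
    moreover have "set_integrable lborel (einterval (ereal 0) (ereal (pi / 2))) h
      = set_integrable lborel (einterval (ereal 0) (ereal (pi / 2))) (\<lambda>x. f (g x) * g' x)"
      by (rule set_integrable_cong) (use range in \<open>auto simp: fg zero_ereal_def einterval_def\<close>)
    ultimately show "set_integrable lborel (einterval (ereal 0) (ereal (pi / 2))) (\<lambda>x. f (g x) * g' x)"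
      by simp
  qed
  also have "\<dots> = (LBINT \<theta>=ereal 0..ereal (pi / 2). h \<theta>)"
    by (rule interval_integral_cong) (use range in \<open>auto simp: fg zero_ereal_def einterval_def min_def max_def split: if_splits\<close>)
  also have "\<dots> = integral {0..pi / 2} h"
    using h_int by (intro interval_integral_eq_integral) auto
  finally have rho: "rho a = integral {0..pi / 2} h" by (simp add: rho_def f_def)
  define A where "A = coth a"
  have A: "A * S = C" using SC by (simp add: A_def coth_def S_def C_def)
  have "h \<theta> = 1 / S * rho_kernel A \<theta>" for \<theta>
  proof -
    have "Y \<theta> = S * sqrt (1 + A\<^sup>2 * (sin \<theta>)\<^sup>2)"
    proof -
      have "S\<^sup>2 + C\<^sup>2 * (sin \<theta>)\<^sup>2 = S\<^sup>2 * (1 + A\<^sup>2 * (sin \<theta>)\<^sup>2)"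
        unfolding A[symmetric] by (simp add: algebra_simps power_mult_distrib)
      then show ?thesis using SC by (simp add: Y_def real_sqrt_mult)
    qed
    moreover have "(Z \<theta>)\<^sup>2 = S\<^sup>2 * (A\<^sup>2 + (sin \<theta>)\<^sup>2)"
      unfolding Zpos A[symmetric] by (simp add: algebra_simps power_mult_distrib)
    ultimately show ?thesis
      unfolding h_def rho_kernel_def A[symmetric] using SC by (simp add: power2_eq_square)
  qed
  then have "h = (\<lambda>\<theta>. 1 / S * rho_kernel A \<theta>)" by (rule ext)
  then have "rho a = 1 / S * integral {0..pi / 2} (rho_kernel A)"
    unfolding rho by (simp only: integral_mult_right)
  moreover have "sqrt (A\<^sup>2 - 1) = 1 / S"
    using coth_props(2)[OF a] SC by (simp add: A_def S_def real_sqrt_divide)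
  ultimately show ?thesis by (simp add: rho_coth_def A_def)
qed

definition rho_kernel_deriv :: "real \<Rightarrow> real \<Rightarrow> real" where
  "rho_kernel_deriv A \<theta> = (cos \<theta>)\<^sup>2 / ((A\<^sup>2 + (sin \<theta>)\<^sup>2) * sqrt (1 + A\<^sup>2 * (sin \<theta>)\<^sup>2))
     * (1 - 2 * A\<^sup>2 / (A\<^sup>2 + (sin \<theta>)\<^sup>2) - A\<^sup>2 * (sin \<theta>)\<^sup>2 / (1 + A\<^sup>2 * (sin \<theta>)\<^sup>2))"

lemma rho_kernel_has_deriv:
  assumes "A > 0"
  shows "((\<lambda>A. rho_kernel A \<theta>) has_real_derivative rho_kernel_deriv A \<theta>) (at A within U)"
proof -
  define x where "x = (sin \<theta>)\<^sup>2"
  define c where "c = (cos \<theta>)\<^sup>2"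
  define P where "P = sqrt (1 + A\<^sup>2 * x)"
  have x0: "x \<ge> 0" by (simp add: x_def)
  have pos: "1 + A\<^sup>2 * x > 0" "A\<^sup>2 + x > 0" "P > 0" "P * P = 1 + A\<^sup>2 * x"
    using assms x0 by (auto simp: P_def add_pos_nonneg)
  have D1: "((\<lambda>A. sqrt (1 + A\<^sup>2 * x)) has_real_derivative A * x / P) (at A within U)"
    using pos(1) by (auto intro!: derivative_eq_intros simp: P_def field_simps)
  have D2: "((\<lambda>A. (A\<^sup>2 + x) * sqrt (1 + A\<^sup>2 * x)) has_real_derivative 2 * A * P + (A * x / P) * (A\<^sup>2 + x)) (at A within U)"
  proof -
    have "((\<lambda>A. A\<^sup>2 + x) has_real_derivative 2 * A) (at A within U)"
      by (auto intro!: derivative_eq_intros)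
    from DERIV_mult[OF this D1] show ?thesis by (simp add: P_def)
  qed
  have D3: "((\<lambda>A. A * c) has_real_derivative c) (at A within U)"
    by (auto intro!: derivative_eq_intros)
  have "((\<lambda>A. A * c / ((A\<^sup>2 + x) * sqrt (1 + A\<^sup>2 * x))) has_real_derivative
     (c * ((A\<^sup>2 + x) * P) - A * c * (2 * A * P + (A * x / P) * (A\<^sup>2 + x))) / (((A\<^sup>2 + x) * P) * ((A\<^sup>2 + x) * P))) (at A within U)"
    using DERIV_divide[OF D3 D2] pos unfolding P_def[symmetric] by simp
  also have "(c * ((A\<^sup>2 + x) * P) - A * c * (2 * A * P + (A * x / P) * (A\<^sup>2 + x))) / (((A\<^sup>2 + x) * P) * ((A\<^sup>2 + x) * P))
    = c / ((A\<^sup>2 + x) * P) * (1 - 2 * A\<^sup>2 / (A\<^sup>2 + x) - A\<^sup>2 * x / (P * P))"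
  proof -
    define q where "q = A\<^sup>2 + x"
    have "q > 0" using pos(2) by (simp add: q_def)
    then show ?thesis unfolding q_def[symmetric] using pos(3) by (simp add: field_simps power2_eq_square)
  qed
  finally show ?thesis
    unfolding rho_kernel_def rho_kernel_deriv_def x_def[symmetric] c_def[symmetric] pos(4) P_def[symmetric] .
qed

text \<open>Although \<open>rho_coth\<close> is an integral of the third kind, the integrand of its derivative differs from a
  multiple of \<open>ell_integrand\<close>, which contains only integrals of the first and second kind, by an exact
  derivative. The primitive below is the one of the form \<open>sin \<theta> cos \<theta> (\<alpha> + \<beta> sin\<^sup>2 \<theta>) / ...\<close>, and it
  vanishes at both ends of \<open>[0, \<pi> / 2]\<close>.\<close>

lemma rho_kernel_identity:
  assumes "A > 1"
  shows "\<exists>H'. ((\<lambda>\<theta>. sin \<theta> * cos \<theta> * ((A ^ 4 + 1) + 2 * A\<^sup>2 * (sin \<theta>)\<^sup>2)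
      / ((A\<^sup>2 + (sin \<theta>)\<^sup>2) * sqrt (1 + A\<^sup>2 * (sin \<theta>)\<^sup>2))) has_real_derivative H') (at \<theta>)
    \<and> (A\<^sup>2 + 1) * (A * rho_kernel A \<theta> + (A\<^sup>2 - 1) * rho_kernel_deriv A \<theta>) = H' - ell_integrand A \<theta>"
proof -
  define B where "B = A\<^sup>2"
  define s c where "s = sin \<theta>" and "c = cos \<theta>"
  define P where "P = sqrt (1 + B * s\<^sup>2)"
  have "B > 1" using assms by (simp add: B_def one_less_power)
  then have pos: "1 + B * s\<^sup>2 > 0" "B + s\<^sup>2 > 0" "P > 0" "P\<^sup>2 = 1 + B * s\<^sup>2"
    by (auto simp: P_def add_pos_nonneg)
  have cc: "c\<^sup>2 = 1 - s\<^sup>2" by (simp add: c_def s_def cos_squared_eq)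
  define k where "k = B\<^sup>2 + 1 + 2 * B * s\<^sup>2"
  have DP: "((\<lambda>\<theta>. sqrt (1 + B * (sin \<theta>)\<^sup>2)) has_real_derivative B * s * c / P) (at \<theta>)"
    using pos(1) by (auto intro!: derivative_eq_intros simp: P_def s_def c_def field_simps)
  have Dm: "((\<lambda>\<theta>. (B + (sin \<theta>)\<^sup>2) * sqrt (1 + B * (sin \<theta>)\<^sup>2)) has_real_derivative
      2 * s * c * P + (B * s * c / P) * (B + s\<^sup>2)) (at \<theta>)"
  proof -
    have "((\<lambda>\<theta>. B + (sin \<theta>)\<^sup>2) has_real_derivative 2 * s * c) (at \<theta>)"
      by (auto intro!: derivative_eq_intros simp: s_def c_def)
    from DERIV_mult[OF this DP] show ?thesis by (simp add: P_def s_def)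
  qed
  have Dn: "((\<lambda>\<theta>. sin \<theta> * cos \<theta> * ((B\<^sup>2 + 1) + 2 * B * (sin \<theta>)\<^sup>2)) has_real_derivative
      (c\<^sup>2 - s\<^sup>2) * k + 4 * B * (s\<^sup>2 * c\<^sup>2)) (at \<theta>)"
    by (auto intro!: derivative_eq_intros simp: s_def c_def k_def algebra_simps power2_eq_square)
  define H' where "H' = (((c\<^sup>2 - s\<^sup>2) * k + 4 * B * (s\<^sup>2 * c\<^sup>2)) * ((B + s\<^sup>2) * P)
      - (s * c * k) * (2 * s * c * P + (B * s * c / P) * (B + s\<^sup>2))) / (((B + s\<^sup>2) * P) * ((B + s\<^sup>2) * P))"
  have D: "((\<lambda>\<theta>. sin \<theta> * cos \<theta> * ((B\<^sup>2 + 1) + 2 * B * (sin \<theta>)\<^sup>2)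
      / ((B + (sin \<theta>)\<^sup>2) * sqrt (1 + B * (sin \<theta>)\<^sup>2))) has_real_derivative H') (at \<theta>)"
    using DERIV_divide[OF Dn Dm] pos(2,3) unfolding H'_def P_def s_def c_def k_def by simp
  define v where "v = c\<^sup>2 / ((B + s\<^sup>2) * P)"
  have "rho_kernel A \<theta> = A * v"
    unfolding rho_kernel_def v_def B_def[symmetric] s_def[symmetric] c_def[symmetric] P_def[symmetric] by simp
  moreover have "rho_kernel_deriv A \<theta> = v * (1 - 2 * B / (B + s\<^sup>2) - B * s\<^sup>2 / P\<^sup>2)"
    unfolding rho_kernel_deriv_def v_def B_def[symmetric] s_def[symmetric] c_def[symmetric] pos(4)
    by (simp add: P_def)
  ultimately have "A * rho_kernel A \<theta> + (A\<^sup>2 - 1) * rho_kernel_deriv A \<theta>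
      = v * (B + (B - 1) * (1 - 2 * B / (B + s\<^sup>2) - B * s\<^sup>2 / P\<^sup>2))"
    by (simp only: B_def) (simp add: algebra_simps power2_eq_square)
  also have "B + (B - 1) * (1 - 2 * B / (B + s\<^sup>2) - B * s\<^sup>2 / P\<^sup>2)
      = 2 * B - 1 - B * (B - 1) * (2 / (B + s\<^sup>2) + s\<^sup>2 / P\<^sup>2)"
    by (simp add: algebra_simps divide_inverse)
  finally have L: "A * rho_kernel A \<theta> + (A\<^sup>2 - 1) * rho_kernel_deriv A \<theta>
      = c\<^sup>2 / ((B + s\<^sup>2) * P) * (2 * B - 1 - B * (B - 1) * (2 / (B + s\<^sup>2) + s\<^sup>2 / P\<^sup>2))" unfolding v_def .
  define x q where "x = s\<^sup>2" and "q = B + s\<^sup>2"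
  have q: "q > 0" "q = B + x" using pos(2) by (auto simp: q_def x_def)
  have Q: "P\<^sup>2 = 1 + B * x" by (simp add: pos(4) x_def)
  have "(B + 1) * (c\<^sup>2 / (q * P) * (2 * B - 1 - B * (B - 1) * (2 / q + x / P\<^sup>2))) * (q\<^sup>2 * P ^ 3)
      = (B + 1) * (1 - x) * ((2 * B - 1) * q * P\<^sup>2 - B * (B - 1) * (2 * P\<^sup>2 + x * q))"
    unfolding cc x_def[symmetric] using pos(3) q(1) by (simp add: field_simps power2_eq_square power3_eq_cube)
  also have "\<dots> = ((1 - 2 * x) * k + 4 * B * (x * (1 - x))) * q * P\<^sup>2 - x * (1 - x) * k * (2 * P\<^sup>2 + B * q)
      - (B - 1 - 2 * B * x) * q\<^sup>2 * P\<^sup>2"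
    unfolding k_def x_def[symmetric] Q q(2) by (simp add: algebra_simps power2_eq_square)
  also have "\<dots> = (H' - (B - 1 - 2 * B * x) / P) * (q\<^sup>2 * P ^ 3)"
  proof -
    have "H' * (q\<^sup>2 * P ^ 3) = ((c\<^sup>2 - s\<^sup>2) * k + 4 * B * (s\<^sup>2 * c\<^sup>2)) * q * P\<^sup>2
        - s\<^sup>2 * c\<^sup>2 * k * (2 * P\<^sup>2 + B * q)"
      unfolding H'_def q_def[symmetric] using pos(3) q(1)
      by (simp add: field_simps power2_eq_square power3_eq_cube)
    then have "H' * (q\<^sup>2 * P ^ 3) = ((1 - 2 * x) * k + 4 * B * (x * (1 - x))) * q * P\<^sup>2 - x * (1 - x) * k * (2 * P\<^sup>2 + B * q)"
      unfolding cc x_def[symmetric] by (simp add: algebra_simps)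
    moreover have "(B - 1 - 2 * B * x) / P * (q\<^sup>2 * P ^ 3) = (B - 1 - 2 * B * x) * q\<^sup>2 * P\<^sup>2"
      using pos(3) by (simp add: power2_eq_square power3_eq_cube)
    ultimately show ?thesis by (simp add: left_diff_distrib)
  qed
  finally have "(B + 1) * (c\<^sup>2 / (q * P) * (2 * B - 1 - B * (B - 1) * (2 / q + x / P\<^sup>2))) = H' - (B - 1 - 2 * B * x) / P"
    by (rule mult_right_cancel[THEN iffD1, rotated]) (use pos(3) q(1) in simp)
  then have "(A\<^sup>2 + 1) * (A * rho_kernel A \<theta> + (A\<^sup>2 - 1) * rho_kernel_deriv A \<theta>) = H' - ell_integrand A \<theta>"
    unfolding L q_def x_def P_def by (simp add: B_def ell_integrand_def s_def)
  then show ?thesis using D unfolding B_def by (intro exI[of _ H']) simp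
qed

lemma rho_coth_deriv:
  assumes A: "A > 1"
  shows "(rho_coth has_real_derivative - ell_complete A / ((A\<^sup>2 + 1) * sqrt (A\<^sup>2 - 1))) (at A)"
proof -
  let ?I = "\<lambda>A. integral (cbox 0 (pi / 2)) (rho_kernel A)"
  let ?I' = "integral (cbox 0 (pi / 2)) (rho_kernel_deriv A)"
  have A2: "A\<^sup>2 - 1 > 0" using A by (simp add: one_less_power)
  have cont2: "continuous_on ({0<..} \<times> cbox 0 (pi / 2)) (\<lambda>(A, \<theta>). rho_kernel_deriv A \<theta>)"
    unfolding rho_kernel_deriv_def case_prod_unfold
    using one_plus_sq_pos by (intro continuous_intros) (auto simp: less_imp_neq[symmetric] add_pos_nonneg)
  have "(?I has_real_derivative ?I') (at A within {0<..})"
    by (rule leibniz_rule_field_derivative[OF _ _ cont2])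
      (use A in \<open>auto intro!: rho_kernel_has_deriv integrable_continuous_interval rho_kernel_cont\<close>)
  then have "(?I has_real_derivative ?I') (at A)"
    using A by (simp add: at_within_open[of _ "{0<..}"])
  moreover have "((\<lambda>A. sqrt (A\<^sup>2 - 1)) has_real_derivative A / sqrt (A\<^sup>2 - 1)) (at A)"
    using A2 by (auto intro!: derivative_eq_intros simp: field_simps)
  ultimately have D: "(rho_coth has_real_derivative sqrt (A\<^sup>2 - 1) * ?I' + A / sqrt (A\<^sup>2 - 1) * ?I A) (at A)"
    unfolding rho_coth_def[abs_def] using DERIV_mult by (fastforce simp: add.commute mult.commute)
  have int: "rho_kernel A integrable_on {0..pi / 2}" "rho_kernel_deriv A integrable_on {0..pi / 2}"
  proof -
    show "rho_kernel A integrable_on {0..pi / 2}"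
      using A by (intro integrable_continuous_interval rho_kernel_cont) simp
    have "continuous_on {0..pi / 2} (rho_kernel_deriv A)"
      unfolding rho_kernel_deriv_def using A one_plus_sq_pos[of A]
      by (intro continuous_intros) (auto simp: less_imp_neq[symmetric] add_pos_nonneg)
    then show "rho_kernel_deriv A integrable_on {0..pi / 2}" by (rule integrable_continuous_interval)
  qed
  define H where "H \<theta> = sin \<theta> * cos \<theta> * ((A ^ 4 + 1) + 2 * A\<^sup>2 * (sin \<theta>)\<^sup>2)
      / ((A\<^sup>2 + (sin \<theta>)\<^sup>2) * sqrt (1 + A\<^sup>2 * (sin \<theta>)\<^sup>2))" for \<theta>
  let ?L = "\<lambda>\<theta>. (A\<^sup>2 + 1) * (A * rho_kernel A \<theta> + (A\<^sup>2 - 1) * rho_kernel_deriv A \<theta>)"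
  have "(H has_real_derivative ?L \<theta> + ell_integrand A \<theta>) (at \<theta>)" for \<theta>
    using rho_kernel_identity[OF A, of \<theta>] unfolding H_def[symmetric, abs_def] by auto
  then have "((\<lambda>\<theta>. ?L \<theta> + ell_integrand A \<theta>) has_integral H (pi / 2) - H 0) {0..pi / 2}"
    by (intro fundamental_theorem_of_calculus)
      (auto simp: has_real_derivative_iff_has_vector_derivative has_vector_derivative_at_within)
  then have "((\<lambda>\<theta>. ?L \<theta> + ell_integrand A \<theta>) has_integral 0) {0..pi / 2}" by (simp add: H_def)
  moreover have "((\<lambda>\<theta>. ?L \<theta> + ell_integrand A \<theta>) has_integral
      (A\<^sup>2 + 1) * (A * ?I A + (A\<^sup>2 - 1) * ?I') + ell_complete A) {0..pi / 2}"
    using int by (intro has_integral_add has_integral_mult_right ell_complete_integral)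
      (simp_all add: integrable_integral)
  ultimately have "(A\<^sup>2 + 1) * (A * ?I A + (A\<^sup>2 - 1) * ?I') + ell_complete A = 0"
    by (rule has_integral_unique[symmetric])
  then have key: "A * ?I A + (A\<^sup>2 - 1) * ?I' = - ell_complete A / (A\<^sup>2 + 1)"
    using A2 by (simp add: field_simps)
  have "sqrt (A\<^sup>2 - 1) * ?I' + A / sqrt (A\<^sup>2 - 1) * ?I A = (A * ?I A + (A\<^sup>2 - 1) * ?I') / sqrt (A\<^sup>2 - 1)"
  proof -
    have "(A\<^sup>2 - 1) * ?I' / sqrt (A\<^sup>2 - 1) = sqrt (A\<^sup>2 - 1) * ?I'"
      using real_div_sqrt[of "A\<^sup>2 - 1"] A2 by (metis less_imp_le times_divide_eq_left)
    then show ?thesis by (simp add: add_divide_distrib)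
  qed
  also have "\<dots> = - ell_complete A / ((A\<^sup>2 + 1) * sqrt (A\<^sup>2 - 1))"
    unfolding key by simp
  finally show ?thesis using D by simp
qed

lemma coth_deriv: "a > 0 \<Longrightarrow> (coth has_real_derivative - 1 / (sinh a)\<^sup>2) (at a)"
proof -
  assume a: "a > 0"
  have "((\<lambda>x. cosh x / sinh x) has_real_derivative (sinh a * sinh a - cosh a * cosh a) / (sinh a * sinh a)) (at a)"
    by (rule DERIV_divide[OF has_field_derivative_cosh[OF DERIV_ident, simplified] has_field_derivative_sinh[OF DERIV_ident, simplified]])
      (use a in simp)
  moreover have "sinh a * sinh a - cosh a * cosh a = - 1"
    using cosh_sq[of a] by (simp add: power2_eq_square)
  ultimately show ?thesis unfolding coth_def[abs_def] by (simp add: power2_eq_square)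
qed

text \<open>So the critical numbers of \<open>rho\<close> are the parameters at which the stability of the conjugate helicoid
  changes.\<close>

lemma critical_number_rho_iff:
  assumes a: "a > 0"
  shows "critical_number rho a \<longleftrightarrow> ell_complete (coth a) = 0"
proof -
  define A where "A = coth a"
  have A: "A > 1" using coth_props(1)[OF a] by (simp add: A_def)
  have A2: "A\<^sup>2 - 1 > 0" using A by (simp add: one_less_power)
  define d where "d = - ell_complete A / ((A\<^sup>2 + 1) * sqrt (A\<^sup>2 - 1)) * (- 1 / (sinh a)\<^sup>2)"
  have "((\<lambda>a. rho_coth (coth a)) has_real_derivative d) (at a)"
    unfolding d_def using DERIV_chain2[OF rho_coth_deriv[OF A, unfolded A_def] coth_deriv[OF a]]
    by (simp add: A_def)
  then have "(rho has_real_derivative d) (at a)"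
    by (rule has_field_derivative_transform_within_open[of _ _ _ "{0<..}"])
      (use a rho_eq_rho_coth in auto)
  then have "critical_number rho a \<longleftrightarrow> d = 0"
    unfolding critical_number_def using DERIV_unique by blast
  moreover have "(A\<^sup>2 + 1) * sqrt (A\<^sup>2 - 1) > 0" "sinh a \<noteq> 0" using A2 a by (auto simp: add_nonneg_pos)
  ultimately show ?thesis by (auto simp: d_def A_def)
qed

section \<open>Numerical bounds\<close>

text \<open>The coefficients \<open>binomial (2 n) n / 4^n\<close> of the power series of \<open>1 / sqrt (1 - z)\<close>, which are also the
  mean values of the even powers of the cosine.\<close>

primrec central_coeff :: "nat \<Rightarrow> real" where
  "central_coeff 0 = 1"
| "central_coeff (Suc n) = central_coeff n * ((2 * real n + 1) / (2 * real n + 2))"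

lemma central_coeff_bounds: "0 \<le> central_coeff n" "central_coeff n \<le> 1"
proof -
  have "0 \<le> central_coeff n \<and> central_coeff n \<le> 1"
  proof (induction n)
    case (Suc n)
    have "central_coeff n * ((2 * real n + 1) / (2 * real n + 2)) \<le> 1 * 1"
      using Suc by (intro mult_mono) auto
    then show ?case using Suc by simp
  qed simp
  then show "0 \<le> central_coeff n" "central_coeff n \<le> 1" by auto
qed

lemma central_coeff_gchoose: "((-1/2::real) gchoose n) * (-1) ^ n = central_coeff n"
proof (induction n)
  case (Suc n)
  have "((-1/2::real) gchoose Suc n) = ((-1/2) gchoose n) * ((-1/2 - real n) / real (Suc n))"
    by (simp add: gbinomial_prod_rev prod.atLeast0_lessThan_Suc field_simps)
  then have "((-1/2::real) gchoose Suc n) * (-1) ^ Suc n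
      = (((-1/2) gchoose n) * (-1) ^ n) * (- ((-1/2 - real n) / real (Suc n)))"
    by (simp only: power_Suc mult_minus_left mult_minus_right mult_1_left mult.assoc mult.commute mult.left_commute)
  also have "- ((-1/2 - real n) / real (Suc n)) = (2 * real n + 1) / (2 * real n + 2)"
    by (simp add: field_simps)
  finally show ?case using Suc by simp
qed simp

lemma inverse_sqrt_remainder:
  fixes z :: real
  assumes z: "\<bar>z\<bar> < 1"
  shows "\<bar>1 / sqrt (1 - z) - (\<Sum>n<N. central_coeff n * z ^ n)\<bar> \<le> \<bar>z\<bar> ^ N / (1 - \<bar>z\<bar>)"
proof -
  have "(\<lambda>n. ((-1/2) gchoose n) * (- z) ^ n) sums (1 + - z) powr (-1/2)"
    by (rule gen_binomial_real) (use z in simp)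
  moreover have "((-1/2) gchoose n) * (- z) ^ n = central_coeff n * z ^ n" for n
    unfolding central_coeff_gchoose[symmetric] by (simp add: power_minus[of z])
  moreover have "(1 + - z) powr (-1/2) = 1 / sqrt (1 - z)"
    using z powr_minus_divide[of "1 - z" "1/2"] by (simp add: powr_half_sqrt)
  ultimately have s: "(\<lambda>n. central_coeff n * z ^ n) sums (1 / sqrt (1 - z))" by simp
  have tail: "(\<lambda>n. central_coeff (n + N) * z ^ (n + N)) sums (1 / sqrt (1 - z) - (\<Sum>n<N. central_coeff n * z ^ n))"
    using sums_split_initial_segment[OF s, of N] by simp
  have geo: "(\<lambda>n. \<bar>z\<bar> ^ N * \<bar>z\<bar> ^ n) sums (\<bar>z\<bar> ^ N * (1 / (1 - \<bar>z\<bar>)))"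
    by (intro sums_mult geometric_sums) (use z in simp)
  have le: "norm (central_coeff (n + N) * z ^ (n + N)) \<le> \<bar>z\<bar> ^ N * \<bar>z\<bar> ^ n" for n
  proof -
    have "\<bar>central_coeff (n + N)\<bar> * \<bar>z ^ (n + N)\<bar> \<le> 1 * \<bar>z ^ (n + N)\<bar>"
      using central_coeff_bounds[of "n + N"] by (intro mult_right_mono) auto
    then show ?thesis by (simp add: abs_mult power_abs power_add mult.commute)
  qed
  have "norm (\<Sum>n. central_coeff (n + N) * z ^ (n + N)) \<le> (\<Sum>n. \<bar>z\<bar> ^ N * \<bar>z\<bar> ^ n)"
    by (rule norm_suminf_le[OF le sums_summable[OF geo]])
  then show ?thesis using sums_unique[OF tail] sums_unique[OF geo] by simp
qed

lemma cos_power_integral: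
  "((\<lambda>\<theta>. cos (2 * \<theta>) ^ (2 * k)) has_integral pi / 2 * central_coeff k) {0..pi / 2} \<and>
   ((\<lambda>\<theta>. cos (2 * \<theta>) ^ (2 * k + 1)) has_integral 0) {0..pi / 2}"
proof -
  have step: "((\<lambda>\<theta>. cos (2 * \<theta>) ^ (n + 2)) has_integral (real n + 1) / (real n + 2) * I) {0..pi / 2}"
    if I: "((\<lambda>\<theta>. cos (2 * \<theta>) ^ n) has_integral I) {0..pi / 2}" for n I
  proof -
    have D: "((\<lambda>\<theta>. sin (2 * \<theta>) * cos (2 * \<theta>) ^ Suc n) has_real_derivative
        2 * (real n + 2) * cos (2 * \<theta>) ^ (n + 2) - 2 * (real n + 1) * cos (2 * \<theta>) ^ n) (at \<theta>)" for \<theta>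
    proof -
      have d1: "((\<lambda>\<theta>. cos (2 * \<theta>)) has_real_derivative - 2 * sin (2 * \<theta>)) (at \<theta>)"
        and d2: "((\<lambda>\<theta>. sin (2 * \<theta>)) has_real_derivative 2 * cos (2 * \<theta>)) (at \<theta>)"
        by (auto intro!: derivative_eq_intros)
      have "2 * cos (2 * \<theta>) * cos (2 * \<theta>) ^ Suc n
          + (1 + real n) * (- 2 * sin (2 * \<theta>) * cos (2 * \<theta>) ^ n) * sin (2 * \<theta>)
        = 2 * cos (2 * \<theta>) ^ (n + 2) - 2 * (real n + 1) * (cos (2 * \<theta>) ^ n * (sin (2 * \<theta>))\<^sup>2)"
        by (simp add: algebra_simps power2_eq_square)
      also have "(sin (2 * \<theta>))\<^sup>2 = 1 - (cos (2 * \<theta>))\<^sup>2" by (rule sin_squared_eq)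
      also have "2 * cos (2 * \<theta>) ^ (n + 2) - 2 * (real n + 1) * (cos (2 * \<theta>) ^ n * (1 - (cos (2 * \<theta>))\<^sup>2))
        = 2 * (real n + 2) * cos (2 * \<theta>) ^ (n + 2) - 2 * (real n + 1) * cos (2 * \<theta>) ^ n"
        by (simp add: algebra_simps power_add power2_eq_square)
      finally show ?thesis using DERIV_mult[OF d2 DERIV_power_Suc[OF d1, of n]] by simp
    qed
    have "((\<lambda>\<theta>. 2 * (real n + 2) * cos (2 * \<theta>) ^ (n + 2) - 2 * (real n + 1) * cos (2 * \<theta>) ^ n) has_integral
        sin (2 * (pi / 2)) * cos (2 * (pi / 2)) ^ Suc n - sin (2 * 0) * cos (2 * 0) ^ Suc n) {0..pi / 2}"
      by (rule fundamental_theorem_of_calculus)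
        (use D in \<open>auto simp: has_real_derivative_iff_has_vector_derivative[symmetric] intro: has_field_derivative_at_within\<close>)
    then have "((\<lambda>\<theta>. 2 * (real n + 2) * cos (2 * \<theta>) ^ (n + 2) - 2 * (real n + 1) * cos (2 * \<theta>) ^ n) has_integral 0) {0..pi / 2}"
      by simp
    from has_integral_mult_right[OF has_integral_add[OF this has_integral_mult_right[OF I, of "2 * (real n + 1)"]],
        of "1 / (2 * (real n + 2))"]
    have "((\<lambda>\<theta>. 1 / (2 * (real n + 2)) * (2 * (real n + 2) * cos (2 * \<theta>) ^ (n + 2))) has_integral
        1 / (2 * (real n + 2)) * (2 * (real n + 1) * I)) {0..pi / 2}" by simp
    moreover have "1 / (2 * (real n + 2)) * (2 * (real n + 2) * x) = x" for x by simp
    moreover have "1 / (2 * (real n + 2)) * (2 * (real n + 1) * I) = (real n + 1) / (real n + 2) * I"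
      by (simp add: field_simps)
    ultimately show ?thesis by (simp only:)
  qed
  show ?thesis
  proof (induction k)
    case 0
    have "((\<lambda>\<theta>. cos (2 * \<theta>)) has_integral sin (2 * (pi / 2)) / 2 - sin (2 * 0) / 2) {0..pi / 2}"
      by (rule fundamental_theorem_of_calculus)
        (auto intro!: derivative_eq_intros simp: has_real_derivative_iff_has_vector_derivative[symmetric])
    moreover have "((\<lambda>\<theta>::real. 1::real) has_integral pi / 2) {0..pi / 2}"
      using has_integral_const_real[of "1::real" 0 "pi / 2"] by simp
    ultimately show ?case by simp
  next
    case (Suc k)
    have "(real (2 * k) + 1) / (real (2 * k) + 2) * (pi / 2 * central_coeff k) = pi / 2 * central_coeff (Suc k)"
      by simp
    moreover have "(real (2 * k + 1) + 1) / (real (2 * k + 1) + 2) * 0 = 0" by simp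
    moreover have "2 * k + 2 = 2 * Suc k" "2 * k + 1 + 2 = 2 * Suc k + 1" by simp_all
    ultimately show ?case
      using step[OF conjunct1[OF Suc]] step[OF conjunct2[OF Suc]] by (simp only:)
  qed
qed

definition series_u :: "real \<Rightarrow> nat \<Rightarrow> real" where
  "series_u r k = central_coeff (2 * k) * central_coeff k * r ^ (2 * k)"

definition series_v :: "real \<Rightarrow> nat \<Rightarrow> real" where
  "series_v r k = central_coeff (2 * k + 1) * central_coeff (k + 1) * r ^ (2 * k)"

text \<open>In terms of \<open>cos (2 \<theta>)\<close> the integrand is \<open>(B cos (2 \<theta>) - 1) / sqrt (1 - r cos (2 \<theta>))\<close> up to a constant
  factor, where \<open>B = A\<^sup>2\<close> and \<open>r = B / (2 + B)\<close>. Odd powers of the cosine integrate to \<open>0\<close>, so the series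
  converges like a geometric series of ratio \<open>r\<^sup>2\<close>, which is about one half at the critical parameter.\<close>

lemma ell_complete_series:
  assumes r: "0 < r" "r < 1"
  defines "B \<equiv> 2 * r / (1 - r)"
  shows "\<bar>sqrt (1 / (1 - r)) * ell_complete (sqrt B) - pi / 2 * (\<Sum>k<M. - series_u r k + B * r * series_v r k)\<bar>
     \<le> pi / 2 * ((1 + B) * (r ^ (2 * M) / (1 - r)))"
proof -
  have B: "B > 0" using r by (simp add: B_def)
  define p where "p z = (\<Sum>n<2 * M. central_coeff n * (r * z) ^ n)" for z
  let ?I = "{0..pi / 2}"
  have integrand: "sqrt (1 / (1 - r)) * ell_integrand (sqrt B) \<theta> = (B * cos (2 * \<theta>) - 1) * (1 / sqrt (1 - r * cos (2 * \<theta>)))" for \<theta>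
  proof -
    have s: "(sin \<theta>)\<^sup>2 = (1 - cos (2 * \<theta>)) / 2" by (simp add: cos_double_sin)
    have "1 + B * (sin \<theta>)\<^sup>2 = 1 / (1 - r) * (1 - r * cos (2 * \<theta>))"
      unfolding s B_def using r by (simp add: field_simps)
    moreover have "B - 1 - 2 * B * (sin \<theta>)\<^sup>2 = B * cos (2 * \<theta>) - 1" unfolding s by (simp add: field_simps)
    moreover have "sqrt (1 / (1 - r)) > 0" using r by simp
    ultimately show ?thesis
      using B unfolding ell_integrand_def by (simp only: real_sqrt_mult real_sqrt_pow2 less_imp_le) simp
  qed
  have full: "((\<lambda>\<theta>. (B * cos (2 * \<theta>) - 1) * (1 / sqrt (1 - r * cos (2 * \<theta>)))) has_integral
      sqrt (1 / (1 - r)) * ell_complete (sqrt B)) ?I"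
    using has_integral_mult_right[OF ell_complete_integral, of "sqrt (1 / (1 - r))" "sqrt B"] unfolding integrand .
  have poly: "((\<lambda>\<theta>. (B * cos (2 * \<theta>) - 1) * (\<Sum>n<2 * m. central_coeff n * (r * cos (2 * \<theta>)) ^ n)) has_integral
      pi / 2 * (\<Sum>k<m. - series_u r k + B * r * series_v r k)) ?I" for m
  proof (induction m)
    case (Suc m)
    note e = conjunct1[OF cos_power_integral[of m]] and o = conjunct2[OF cos_power_integral[of m]]
      and e' = conjunct1[OF cos_power_integral[of "Suc m"]]
    let ?a = "central_coeff (2 * m) * r ^ (2 * m)" and ?b = "central_coeff (2 * m + 1) * r ^ (2 * m + 1)"
    have "((\<lambda>\<theta>. (?a * B - ?b) * cos (2 * \<theta>) ^ (2 * m + 1) + (- ?a * cos (2 * \<theta>) ^ (2 * m) + ?b * B * cos (2 * \<theta>) ^ (2 * Suc m)))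
        has_integral (?a * B - ?b) * 0 + (- ?a * (pi / 2 * central_coeff m) + ?b * B * (pi / 2 * central_coeff (Suc m)))) ?I"
      by (intro has_integral_add has_integral_mult_right e o e')
    from has_integral_add[OF Suc this]
    have "((\<lambda>\<theta>. (B * cos (2 * \<theta>) - 1) * (\<Sum>n<2 * m. central_coeff n * (r * cos (2 * \<theta>)) ^ n)
        + ((?a * B - ?b) * cos (2 * \<theta>) ^ (2 * m + 1) + (- ?a * cos (2 * \<theta>) ^ (2 * m) + ?b * B * cos (2 * \<theta>) ^ (2 * Suc m))))
        has_integral pi / 2 * (\<Sum>k<m. - series_u r k + B * r * series_v r k)
          + ((?a * B - ?b) * 0 + (- ?a * (pi / 2 * central_coeff m) + ?b * B * (pi / 2 * central_coeff (Suc m))))) ?I" .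
    moreover have "(B * x - 1) * (\<Sum>n<2 * m. central_coeff n * (r * x) ^ n)
        + ((?a * B - ?b) * x ^ (2 * m + 1) + (- ?a * x ^ (2 * m) + ?b * B * x ^ (2 * Suc m)))
      = (B * x - 1) * (\<Sum>n<2 * Suc m. central_coeff n * (r * x) ^ n)" for x
    proof -
      have "(\<Sum>n<2 * Suc m. central_coeff n * (r * x) ^ n) = (\<Sum>n<2 * m. central_coeff n * (r * x) ^ n)
          + central_coeff (2 * m) * (r * x) ^ (2 * m) + central_coeff (2 * m + 1) * (r * x) ^ (2 * m + 1)"
        by simp
      then show ?thesis
        by (simp only: power_mult_distrib power_add power_one_right mult_Suc_right power2_eq_square) (simp only: ring_distribs, simp add: mult_ac)
    qed
    moreover have "pi / 2 * (\<Sum>k<m. - series_u r k + B * r * series_v r k)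
          + ((?a * B - ?b) * 0 + (- ?a * (pi / 2 * central_coeff m) + ?b * B * (pi / 2 * central_coeff (Suc m))))
        = pi / 2 * (\<Sum>k<Suc m. - series_u r k + B * r * series_v r k)"
      unfolding sum.lessThan_Suc series_u_def series_v_def
      by (simp only: ring_distribs) (simp add: algebra_simps del: central_coeff.simps)
    ultimately show ?case by (simp only:)
  qed simp
  let ?err = "(1 + B) * (r ^ (2 * M) / (1 - r))"
  have "norm ((B * cos (2 * \<theta>) - 1) * (1 / sqrt (1 - r * cos (2 * \<theta>)))
      - (B * cos (2 * \<theta>) - 1) * (\<Sum>n<2 * M. central_coeff n * (r * cos (2 * \<theta>)) ^ n)) \<le> ?err" for \<theta>
  proof -
    have c: "\<bar>cos (2 * \<theta>)\<bar> \<le> 1" by simp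
    have z: "\<bar>r * cos (2 * \<theta>)\<bar> \<le> r" using mult_left_mono[OF c, of r] r by (simp add: abs_mult)
    have "\<bar>1 / sqrt (1 - r * cos (2 * \<theta>)) - (\<Sum>n<2 * M. central_coeff n * (r * cos (2 * \<theta>)) ^ n)\<bar>
        \<le> \<bar>r * cos (2 * \<theta>)\<bar> ^ (2 * M) / (1 - \<bar>r * cos (2 * \<theta>)\<bar>)"
      by (rule inverse_sqrt_remainder) (use z r in simp)
    also have "\<dots> \<le> r ^ (2 * M) / (1 - r)"
      using z r by (intro frac_le power_mono) auto
    finally have rem: "\<bar>1 / sqrt (1 - r * cos (2 * \<theta>)) - (\<Sum>n<2 * M. central_coeff n * (r * cos (2 * \<theta>)) ^ n)\<bar>
        \<le> r ^ (2 * M) / (1 - r)" .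
    have "\<bar>B * cos (2 * \<theta>) - 1\<bar> \<le> \<bar>B * cos (2 * \<theta>)\<bar> + 1" using abs_triangle_ineq4[of "B * cos (2 * \<theta>)" 1] by simp
    also have "\<dots> \<le> 1 + B" using mult_left_mono[OF c, of B] B by (simp add: abs_mult)
    finally have "\<bar>B * cos (2 * \<theta>) - 1\<bar> \<le> 1 + B" .
    then have "\<bar>B * cos (2 * \<theta>) - 1\<bar> * \<bar>1 / sqrt (1 - r * cos (2 * \<theta>)) - (\<Sum>n<2 * M. central_coeff n * (r * cos (2 * \<theta>)) ^ n)\<bar>
        \<le> ?err"
      by (rule mult_mono[OF _ rem]) (use B in auto)
    then show ?thesis unfolding real_norm_def right_diff_distrib[symmetric] abs_mult .
  qed
  note bound = this
  have "norm (sqrt (1 / (1 - r)) * ell_complete (sqrt B) - pi / 2 * (\<Sum>k<M. - series_u r k + B * r * series_v r k))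
      \<le> ?err * measure lborel (cbox 0 (pi / 2))"
    by (rule has_integral_bound[OF _ has_integral_diff[OF full poly, folded box_real(2)] bound]) (use B r in simp)
  then show ?thesis by (simp add: mult_ac)
qed

lemma series_u_Suc: "series_u r (Suc k) = series_u r k * (r\<^sup>2 *
    ((4 * real k + 1) * (4 * real k + 3) * (2 * real k + 1)) / ((4 * real k + 2) * (4 * real k + 4) * (2 * real k + 2)))"
proof -
  have "central_coeff (2 * Suc k) = central_coeff (2 * k) * ((4 * real k + 1) / (4 * real k + 2)) * ((4 * real k + 3) / (4 * real k + 4))"
    by (simp add: algebra_simps)
  moreover have "r ^ (2 * Suc k) = r ^ (2 * k) * r\<^sup>2" by (simp add: power2_eq_square)
  ultimately show ?thesis unfolding series_u_def by (simp add: mult_ac)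
qed

lemma series_v_Suc: "series_v r (Suc k) = series_v r k * (r\<^sup>2 *
    ((4 * real k + 3) * (4 * real k + 5) * (2 * real k + 3)) / ((4 * real k + 4) * (4 * real k + 6) * (2 * real k + 4)))"
proof -
  have e1: "central_coeff (2 * Suc k + 1) = central_coeff (2 * k + 1) * ((4 * real k + 3) / (4 * real k + 4)) * ((4 * real k + 5) / (4 * real k + 6))"
    by (simp add: algebra_simps)
  have e2: "central_coeff (Suc k + 1) = central_coeff (k + 1) * ((2 * real k + 3) / (2 * real k + 4))"
    by (simp add: algebra_simps)
  have e3: "r ^ (2 * Suc k) = r ^ (2 * k) * r\<^sup>2" by (simp add: power2_eq_square)
  show ?thesis unfolding series_v_def e1 e2 e3 by (simp add: mult_ac del: central_coeff.simps)
qed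

text \<open>Partial sums of a sequence with rational ratios \<open>a k / b k\<close> in fixed-point arithmetic. Each term is
  rounded down for \<open>e = 0\<close> and up for \<open>e = 1\<close>, which bounds the exact sum from the respective side.\<close>

primrec fixed_sum :: "(int \<Rightarrow> int) \<Rightarrow> (int \<Rightarrow> int) \<Rightarrow> int \<Rightarrow> nat \<Rightarrow> int \<Rightarrow> int \<Rightarrow> int" where
  "fixed_sum a b e 0 k x = 0"
| "fixed_sum a b e (Suc n) k x = x + fixed_sum a b e n (k + 1) (x * a k div b k + e)"

lemma fixed_sum_numeral:
  "fixed_sum a b e (numeral n) k x = x + fixed_sum a b e (pred_numeral n) (k + 1) (x * a k div b k + e)"
  by (simp add: numeral_eq_Suc)

lemma fixed_sum_lower:
  fixes X :: "nat \<Rightarrow> real"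
  assumes step: "\<And>k. X (Suc k) = X k * (real_of_int (a (int k)) / real_of_int (b (int k)))"
    and pos: "\<And>k. a (int k) \<ge> 0" "\<And>k. b (int k) > 0" and x: "real_of_int x \<le> S * X k"
  shows "real_of_int (fixed_sum a b 0 n (int k) x) \<le> S * (\<Sum>j<n. X (k + j))"
  using x
proof (induction n arbitrary: k x)
  case (Suc n)
  have "real_of_int (x * a (int k) div b (int k)) \<le> real_of_int (x * a (int k)) / real_of_int (b (int k))"
    by (metis floor_divide_of_int_eq of_int_floor_le)
  also have "\<dots> = real_of_int x * (real_of_int (a (int k)) / real_of_int (b (int k)))" by simp
  also have "\<dots> \<le> (S * X k) * (real_of_int (a (int k)) / real_of_int (b (int k)))"
    using Suc.prems pos by (intro mult_right_mono) (auto simp: less_imp_le)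
  also have "\<dots> = S * X (Suc k)" by (simp add: step)
  finally have "real_of_int (x * a (int k) div b (int k) + 0) \<le> S * X (Suc k)" by simp
  from Suc.IH[OF this] Suc.prems show ?case
    by (simp add: sum.lessThan_Suc_shift distrib_left add.commute[of 1] del: sum.lessThan_Suc)
qed simp

lemma fixed_sum_upper:
  fixes X :: "nat \<Rightarrow> real"
  assumes step: "\<And>k. X (Suc k) = X k * (real_of_int (a (int k)) / real_of_int (b (int k)))"
    and pos: "\<And>k. a (int k) \<ge> 0" "\<And>k. b (int k) > 0" and x: "S * X k \<le> real_of_int x"
  shows "S * (\<Sum>j<n. X (k + j)) \<le> real_of_int (fixed_sum a b 1 n (int k) x)"
  using x
proof (induction n arbitrary: k x)
  case (Suc n)
  have "S * X (Suc k) = (S * X k) * (real_of_int (a (int k)) / real_of_int (b (int k)))" by (simp add: step)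
  also have "\<dots> \<le> real_of_int x * (real_of_int (a (int k)) / real_of_int (b (int k)))"
    using Suc.prems pos by (intro mult_right_mono) (auto simp: less_imp_le)
  also have "\<dots> = real_of_int (x * a (int k)) / real_of_int (b (int k))" by simp
  also have "\<dots> \<le> real_of_int (x * a (int k) div b (int k) + 1)"
    using pos(2)[of k] floor_divide_of_int_eq[where 'a = real, of "x * a (int k)" "b (int k)"]
      floor_correct[of "real_of_int (x * a (int k)) / real_of_int (b (int k))"] by simp
  finally have "S * X (Suc k) \<le> real_of_int (x * a (int k) div b (int k) + 1)" .
  from Suc.IH[OF this] Suc.prems show ?case
    by (simp add: sum.lessThan_Suc_shift distrib_left add.commute[of 1] del: sum.lessThan_Suc)
qed simp

abbreviation u_num :: "int \<Rightarrow> int \<Rightarrow> int" where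
  "u_num m \<equiv> \<lambda>k. m * m * ((4 * k + 1) * (4 * k + 3) * (2 * k + 1))"
abbreviation u_den :: "int \<Rightarrow> int" where
  "u_den \<equiv> \<lambda>k. 10 ^ 12 * ((4 * k + 2) * (4 * k + 4) * (2 * k + 2))"
abbreviation v_num :: "int \<Rightarrow> int \<Rightarrow> int" where
  "v_num m \<equiv> \<lambda>k. m * m * ((4 * k + 3) * (4 * k + 5) * (2 * k + 3))"
abbreviation v_den :: "int \<Rightarrow> int" where
  "v_den \<equiv> \<lambda>k. 10 ^ 12 * ((4 * k + 4) * (4 * k + 6) * (2 * k + 4))"

lemma series_sum_bounds:
  fixes m :: int
  assumes m: "m \<ge> 0" and r: "r = real_of_int m / 10 ^ 6"
  shows "real_of_int (fixed_sum (u_num m) u_den 0 n 0 (10 ^ 12)) \<le> 10 ^ 12 * (\<Sum>k<n. series_u r k)"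
    "10 ^ 12 * (\<Sum>k<n. series_u r k) \<le> real_of_int (fixed_sum (u_num m) u_den 1 n 0 (10 ^ 12))"
    "real_of_int (fixed_sum (v_num m) v_den 0 n 0 250000000000) \<le> 10 ^ 12 * (\<Sum>k<n. series_v r k)"
    "10 ^ 12 * (\<Sum>k<n. series_v r k) \<le> real_of_int (fixed_sum (v_num m) v_den 1 n 0 250000000000)"
proof -
  have r2: "r\<^sup>2 = real_of_int m * real_of_int m / 10 ^ 12" by (simp add: r power2_eq_square)
  have u: "series_u r (Suc k) = series_u r k * (real_of_int (u_num m (int k)) / real_of_int (u_den (int k)))" for k
    unfolding series_u_Suc r2 by simp
  have v: "series_v r (Suc k) = series_v r k * (real_of_int (v_num m (int k)) / real_of_int (v_den (int k)))" for k
    unfolding series_v_Suc r2 by simp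
  have pos: "u_num m (int k) \<ge> 0" "u_den (int k) > 0" "v_num m (int k) \<ge> 0" "v_den (int k) > 0" for k
    using m by (auto intro!: mult_nonneg_nonneg mult_pos_pos)
  show "real_of_int (fixed_sum (u_num m) u_den 0 n 0 (10 ^ 12)) \<le> 10 ^ 12 * (\<Sum>k<n. series_u r k)"
    using fixed_sum_lower[OF u pos(1,2), where k = 0 and S = "10 ^ 12" and x = "10 ^ 12" and n = n]
    by (simp add: series_u_def)
  show "10 ^ 12 * (\<Sum>k<n. series_u r k) \<le> real_of_int (fixed_sum (u_num m) u_den 1 n 0 (10 ^ 12))"
    using fixed_sum_upper[OF u pos(1,2), where k = 0 and S = "10 ^ 12" and x = "10 ^ 12" and n = n]
    by (simp add: series_u_def)
  show "real_of_int (fixed_sum (v_num m) v_den 0 n 0 250000000000) \<le> 10 ^ 12 * (\<Sum>k<n. series_v r k)"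
    using fixed_sum_lower[OF v pos(3,4), where k = 0 and S = "10 ^ 12" and x = 250000000000 and n = n]
    by (simp add: series_v_def)
  show "10 ^ 12 * (\<Sum>k<n. series_v r k) \<le> real_of_int (fixed_sum (v_num m) v_den 1 n 0 250000000000)"
    using fixed_sum_upper[OF v pos(3,4), where k = 0 and S = "10 ^ 12" and x = 250000000000 and n = n]
    by (simp add: series_v_def)
qed

lemma coth_exp: "a > 0 \<Longrightarrow> coth a = (exp (2 * a) + 1) / (exp (2 * a) - 1)"
proof -
  assume a: "a > 0"
  have "(p / 2) / (q / 2) = p / q" for p q :: real by simp
  then have "coth a = (exp a + exp (- a)) / (exp a - exp (- a))"
    unfolding coth_def cosh_field_def sinh_field_def .
  also have "\<dots> = ((exp a + exp (- a)) * exp a) / ((exp a - exp (- a)) * exp a)" by simp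
  also have "\<dots> = (exp (2 * a) + 1) / (exp (2 * a) - 1)"
    by (simp add: distrib_right left_diff_distrib flip: exp_add)
  finally show ?thesis .
qed

lemma exp_taylor_bounds:
  assumes "0 < x" "x \<le> 1"
  shows "(\<Sum>m<12. x ^ m / fact m) \<le> exp x" "exp x \<le> (\<Sum>m<12. x ^ m / fact m) + 3 / fact 12 * (x::real) ^ 12"
proof -
  obtain t where t: "\<bar>t\<bar> \<le> \<bar>x\<bar>" "exp x = (\<Sum>m<12. x ^ m / fact m) + exp t / fact 12 * x ^ 12"
    using Maclaurin_exp_le[of x 12] by blast
  have "exp t / fact 12 * x ^ 12 \<ge> 0" using assms by simp
  then show "(\<Sum>m<12. x ^ m / fact m) \<le> exp x" using t(2) by linarith
  have "exp t \<le> exp 1" using t(1) assms by simp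
  also have "\<dots> \<le> 3" by (rule exp_le)
  finally have "exp t / fact 12 * x ^ 12 \<le> 3 / fact 12 * x ^ 12"
    using assms by (intro mult_right_mono divide_right_mono) auto
  then show "exp x \<le> (\<Sum>m<12. x ^ m / fact m) + 3 / fact 12 * x ^ 12" using t(2) by linarith
qed

lemma coth_upper: "coth (49578 / 10 ^ 5) < 217965 / 10 ^ 5"
proof -
  have "2695436 / 10 ^ 6 \<le> (\<Sum>m<12. (99156 / 10 ^ 5 :: real) ^ m / fact m)"
    by (simp add: eval_nat_numeral)
  also have "\<dots> \<le> exp (99156 / 10 ^ 5)" by (rule exp_taylor_bounds) simp_all
  finally show ?thesis by (subst coth_exp) (simp_all add: field_simps)
qed

lemma coth_lower: "coth (49576 / 10 ^ 5) > 217967 / 10 ^ 5"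
proof -
  have "exp (99152 / 10 ^ 5 :: real) \<le> (\<Sum>m<12. (99152 / 10 ^ 5 :: real) ^ m / fact m) + 3 / fact 12 * (99152 / 10 ^ 5) ^ 12"
    by (rule exp_taylor_bounds) simp_all
  also have "\<dots> \<le> 269533 / 10 ^ 5"
    by (simp add: eval_nat_numeral)
  finally have up: "exp (99152 / 10 ^ 5 :: real) \<le> 269533 / 10 ^ 5" .
  have "exp (99152 / 10 ^ 5 :: real) > 1" by simp
  with up show ?thesis by (subst coth_exp) (simp_all add: field_simps)
qed

text \<open>The value is negative at \<open>A = sqrt (2 r / (1 - r))\<close> with \<open>r = 0.703743\<close>, which is about \<open>2.179655\<close>,
  and by monotonicity to the left of it.\<close>

lemma ell_complete_neg: "ell_complete (217965 / 10 ^ 5) < 0"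
proof -
  define r B :: real where "r = real_of_int 703743 / 10 ^ 6" and "B = 2 * r / (1 - r)"
  have rB: "r = 703743 / 10 ^ 6" "B = 1407486 / 296257" by (simp_all add: r_def B_def)
  have lo: "fixed_sum (u_num 703743) u_den 0 30 0 (10 ^ 12) = 1132041023077"
    by (simp add: fixed_sum_numeral)
  have up: "fixed_sum (v_num 703743) v_den 1 30 0 250000000000 = 338586334466"
    by (simp add: fixed_sum_numeral)
  have U: "1132041023077 / 10 ^ 12 \<le> (\<Sum>k<30. series_u r k)"
    using series_sum_bounds(1)[of 703743 r 30] unfolding lo by (simp add: r_def)
  have V: "(\<Sum>k<30. series_v r k) \<le> 338586334466 / 10 ^ 12"
    using series_sum_bounds(4)[of 703743 r 30] unfolding up by (simp add: r_def)
  have "r ^ (2 * 30) \<le> (71 / 100) ^ (2 * 30)" by (rule power_mono) (simp_all add: rB)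
  also have "\<dots> \<le> 1 / 10 ^ 8" by (simp add: power_divide)
  finally have err: "(1 + B) * (r ^ (2 * 30) / (1 - r)) \<le> 1 / 10 ^ 6"
    by (simp add: rB)
  have "(\<Sum>k<30. - series_u r k + B * r * series_v r k) = - (\<Sum>k<30. series_u r k) + B * r * (\<Sum>k<30. series_v r k)"
    by (simp add: sum.distrib sum_subtractf sum_distrib_left)
  also have "\<dots> \<le> - (1132041023077 / 10 ^ 12) + B * r * (338586334466 / 10 ^ 12)"
    using U V by (intro add_mono le_imp_neg_le mult_left_mono) (simp_all add: rB)
  finally have "(\<Sum>k<30. - series_u r k + B * r * series_v r k) + (1 + B) * (r ^ (2 * 30) / (1 - r)) < 0"
    using err by (simp add: rB)
  then have neg: "pi / 2 * ((\<Sum>k<30. - series_u r k + B * r * series_v r k) + (1 + B) * (r ^ (2 * 30) / (1 - r))) < 0"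
    by (intro mult_pos_neg) simp_all
  have "\<bar>sqrt (1 / (1 - r)) * ell_complete (sqrt B) - pi / 2 * (\<Sum>k<30. - series_u r k + B * r * series_v r k)\<bar>
     \<le> pi / 2 * ((1 + B) * (r ^ (2 * 30) / (1 - r)))"
    unfolding B_def by (rule ell_complete_series) (simp_all add: rB(1))
  then have "sqrt (1 / (1 - r)) * ell_complete (sqrt B) < 0"
    using neg unfolding distrib_left by linarith
  moreover have "sqrt (1 / (1 - r)) > 0" by (simp add: rB)
  ultimately have "ell_complete (sqrt B) < 0" by (simp add: mult_less_0_iff)
  moreover have "217965 / 10 ^ 5 < sqrt B"
    by (rule real_less_rsqrt) (simp add: rB power2_eq_square)
  then have "ell_complete (217965 / 10 ^ 5) < ell_complete (sqrt B)"
    by (rule ell_complete_strict_mono[rotated]) simp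
  ultimately show ?thesis by linarith
qed

text \<open>The same computation with \<open>r = 0.703745\<close>, where \<open>A\<close> is about \<open>2.179665\<close>.\<close>

lemma ell_complete_pos: "ell_complete (217967 / 10 ^ 5) > 0"
proof -
  define r B :: real where "r = real_of_int 703745 / 10 ^ 6" and "B = 2 * r / (1 - r)"
  have rB: "r = 703745 / 10 ^ 6" "B = 1407490 / 296255" by (simp_all add: r_def B_def)
  have up: "fixed_sum (u_num 703745) u_den 1 30 0 (10 ^ 12) = 1132042129407"
    by (simp add: fixed_sum_numeral)
  have lo: "fixed_sum (v_num 703745) v_den 0 30 0 250000000000 = 338587124807"
    by (simp add: fixed_sum_numeral)
  have U: "(\<Sum>k<30. series_u r k) \<le> 1132042129407 / 10 ^ 12"
    using series_sum_bounds(2)[of 703745 r 30] unfolding up by (simp add: r_def)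
  have V: "338587124807 / 10 ^ 12 \<le> (\<Sum>k<30. series_v r k)"
    using series_sum_bounds(3)[of 703745 r 30] unfolding lo by (simp add: r_def)
  have "r ^ (2 * 30) \<le> (71 / 100) ^ (2 * 30)" by (rule power_mono) (simp_all add: rB)
  also have "\<dots> \<le> 1 / 10 ^ 8" by (simp add: power_divide)
  finally have err: "(1 + B) * (r ^ (2 * 30) / (1 - r)) \<le> 1 / 10 ^ 6"
    by (simp add: rB)
  have "- (1132042129407 / 10 ^ 12) + B * r * (338587124807 / 10 ^ 12)
      \<le> - (\<Sum>k<30. series_u r k) + B * r * (\<Sum>k<30. series_v r k)"
    using U V by (intro add_mono le_imp_neg_le mult_left_mono) (simp_all add: rB)
  also have "\<dots> = (\<Sum>k<30. - series_u r k + B * r * series_v r k)"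
    by (simp add: sum.distrib sum_subtractf sum_distrib_left)
  finally have "(\<Sum>k<30. - series_u r k + B * r * series_v r k) - (1 + B) * (r ^ (2 * 30) / (1 - r)) > 0"
    using err by (simp add: rB)
  then have pos: "pi / 2 * ((\<Sum>k<30. - series_u r k + B * r * series_v r k) - (1 + B) * (r ^ (2 * 30) / (1 - r))) > 0"
    by (intro mult_pos_pos) simp_all
  have "\<bar>sqrt (1 / (1 - r)) * ell_complete (sqrt B) - pi / 2 * (\<Sum>k<30. - series_u r k + B * r * series_v r k)\<bar>
     \<le> pi / 2 * ((1 + B) * (r ^ (2 * 30) / (1 - r)))"
    unfolding B_def by (rule ell_complete_series) (simp_all add: rB(1))
  then have "sqrt (1 / (1 - r)) * ell_complete (sqrt B) > 0"
    using pos unfolding right_diff_distrib by linarith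
  moreover have "sqrt (1 / (1 - r)) > 0" by (simp add: rB)
  ultimately have "ell_complete (sqrt B) > 0" by (simp add: zero_less_mult_iff)
  moreover have "sqrt B < 217967 / 10 ^ 5"
    by (rule real_less_lsqrt) (simp_all add: rB power2_eq_square)
  then have "ell_complete (sqrt B) < ell_complete (217967 / 10 ^ 5)"
    by (rule ell_complete_strict_mono[rotated]) (simp add: rB)
  ultimately show ?thesis by linarith
qed

section \<open>The critical helicoid\<close>

lemma ell_complete_cont: "continuous_on U ell_complete"
proof -
  have "ell_complete A = integral (cbox 0 (pi / 2)) (ell_integrand A)" for A
    using integral_unique[OF ell_complete_integral[of A]] by simp
  moreover have "continuous_on (U \<times> cbox 0 (pi / 2)) (\<lambda>(A, \<theta>). ell_integrand A \<theta>)"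
    unfolding ell_integrand_def case_prod_unfold
    using one_plus_sq_pos by (intro continuous_intros) (auto simp: less_imp_neq[symmetric])
  then have "continuous_on U (\<lambda>A. integral (cbox 0 (pi / 2)) (ell_integrand A))"
    by (rule integral_continuous_on_param)
  ultimately show ?thesis by simp
qed

lemma coth_strict_antimono: "0 < a \<Longrightarrow> a < b \<Longrightarrow> coth b < coth a"
proof (rule DERIV_neg_imp_decreasing[of a b coth])
  assume "0 < a" "a < b"
  fix x assume "a \<le> x" "x \<le> b"
  then show "\<exists>y. (coth has_real_derivative y) (at x) \<and> y < 0"
    using coth_deriv[of x] \<open>0 < a\<close> by (intro exI[of _ "- 1 / (sinh x)\<^sup>2"]) auto
qed

lemma critical_number_exists:
  "\<exists>a. 49576 / 10 ^ 5 < a \<and> a < 49578 / 10 ^ 5 \<and> ell_complete (coth a) = 0 \<and>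
    217965 / 10 ^ 5 < coth a \<and> coth a < 217967 / 10 ^ 5"
proof -
  obtain A where A: "217965 / 10 ^ 5 \<le> A" "A \<le> 217967 / 10 ^ 5" "ell_complete A = 0"
    using IVT'[of ell_complete "217965 / 10 ^ 5" 0 "217967 / 10 ^ 5", OF _ _ _ ell_complete_cont]
      ell_complete_neg ell_complete_pos by (auto simp: less_imp_le)
  have "A \<noteq> 217965 / 10 ^ 5"
    using A(3) ell_complete_neg by (metis less_irrefl)
  moreover have "A \<noteq> 217967 / 10 ^ 5"
    using A(3) ell_complete_pos by (metis less_irrefl)
  ultimately have A': "217965 / 10 ^ 5 < A" "A < 217967 / 10 ^ 5"
    using A(1,2) by (simp_all only: less_le) simp_all
  have cont: "continuous_on {49576 / 10 ^ 5..49578 / 10 ^ 5} coth"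
  proof (intro continuous_at_imp_continuous_on ballI)
    fix x :: real assume "x \<in> {49576 / 10 ^ 5..49578 / 10 ^ 5}"
    then have "x > 0" by simp
    then show "isCont coth x" by (rule DERIV_isCont[OF coth_deriv])
  qed
  obtain a where a: "49576 / 10 ^ 5 \<le> a" "a \<le> 49578 / 10 ^ 5" "coth a = A"
    using IVT2'[of coth "49578 / 10 ^ 5" A "49576 / 10 ^ 5", OF _ _ _ cont] A' coth_upper coth_lower by auto
  have "a \<noteq> 49576 / 10 ^ 5" "a \<noteq> 49578 / 10 ^ 5"
    using a(3) A' coth_upper coth_lower by (metis less_asym)+
  then show ?thesis using a A A' by (intro exI[of _ a]) auto
qed

theorem theorem1p5:
  shows "(\<exists>!a. a > 0 \<and> critical_number rho a) \<and>
    \<bar>a_crit - 0.49577\<bar> < 1 / 10^5 \<and>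
    (\<exists>abar_c::real. abar_c = coth a_crit \<and> \<bar>abar_c - 2.17968\<bar> < 5 / 10^5 \<and>
      (\<forall>abar. 0 \<le> abar \<and> abar \<le> abar_c \<longrightarrow>
         minimal_surface (helicoid abar) \<and>
         (\<forall>\<Omega>. compact_subdomain \<Omega> \<longrightarrow> first_eigenvalue_on (helicoid abar) \<Omega> > 0) \<and>
         first_eigenvalue (helicoid abar) \<ge> 0 \<and>
         (abar < abar_c \<longrightarrow> globally_stable (helicoid abar))) \<and>
      (\<forall>abar. abar > abar_c \<longrightarrow>
         minimal_surface (helicoid abar) \<and>
         unstable (helicoid abar) \<and>
         morse_index (helicoid abar) = \<infinity>))"
proof -
  obtain a where a: "49576 / 10 ^ 5 < a" "a < 49578 / 10 ^ 5" "ell_complete (coth a) = 0"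
    "217965 / 10 ^ 5 < coth a" "coth a < 217967 / 10 ^ 5"
    using critical_number_exists by blast
  have a_pos: "a > 0" using a(1) by simp
  have crit: "a > 0 \<and> critical_number rho a"
    using a_pos a(3) by (simp add: critical_number_rho_iff)
  have unique: "b = a" if "b > 0 \<and> critical_number rho b" for b
  proof (rule ccontr)
    assume "b \<noteq> a"
    have b: "b > 0" "ell_complete (coth b) = 0" using that by (auto simp: critical_number_rho_iff)
    have "coth b \<noteq> coth a"
      using \<open>b \<noteq> a\<close> coth_strict_antimono[of a b] coth_strict_antimono[of b a] a_pos b(1)
      by (cases "a < b") auto
    moreover have "coth a \<ge> 0" "coth b \<ge> 0" using coth_props(1) a_pos b(1) by fastforce+
    ultimately show False
      using ell_complete_strict_mono[of "coth a" "coth b"] ell_complete_strict_mono[of "coth b" "coth a"] a(3) b(2)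
      by (cases "coth a < coth b") auto
  qed
  have ex1: "\<exists>!a. a > 0 \<and> critical_number rho a" using crit unique by blast
  have a_crit: "a_crit = a" unfolding a_crit_def using crit unique by (rule the_equality)
  have le: "ell_complete A \<le> 0" if "0 \<le> A" "A \<le> coth a" for A
    using ell_complete_strict_mono[OF that(1), of "coth a"] that(2) a(3) by (cases "A = coth a") auto
  have lt: "ell_complete A < 0" if "0 \<le> A" "A < coth a" for A
    using ell_complete_strict_mono[OF that] a(3) by simp
  have gt: "ell_complete A > 0" if "A > coth a" for A
    using ell_complete_strict_mono[of "coth a" A] that a(3) coth_props(1)[OF a_pos] by simp
  show ?thesis
  proof (intro conjI exI[of _ "coth a_crit"] allI impI refl)
    show "\<exists>!a. a > 0 \<and> critical_number rho a" by (rule ex1)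
    show "\<bar>a_crit - 0.49577\<bar> < 1 / 10^5" using a(1,2) unfolding a_crit abs_less_iff by simp
    show "\<bar>coth a_crit - 2.17968\<bar> < 5 / 10^5" using a(4,5) unfolding a_crit abs_less_iff by simp
  next
    fix A assume "0 \<le> A \<and> A \<le> coth a_crit"
    then have A: "0 \<le> A" "A \<le> coth a" by (simp_all add: a_crit)
    show "minimal_surface (helicoid A)" by (rule helicoid_minimal)
    show "first_eigenvalue_on (helicoid A) \<Omega> > 0" if "compact_subdomain \<Omega>" for \<Omega>
      using first_eigenvalue_on_pos[OF le[OF A] that] .
    show "first_eigenvalue (helicoid A) \<ge> 0"
      by (rule helicoid_first_eigenvalue_nonneg[OF le[OF A]])
    show "globally_stable (helicoid A)" if "A < coth a_crit"
      by (rule helicoid_globally_stable[OF lt]) (use A that in \<open>simp_all add: a_crit\<close>)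
  next
    fix A assume "A > coth a_crit"
    then have A: "A > coth a" by (simp add: a_crit)
    show "minimal_surface (helicoid A)" by (rule helicoid_minimal)
    show "unstable (helicoid A)" by (rule helicoid_unstable[OF gt[OF A]])
    show "morse_index (helicoid A) = \<infinity>" by (rule helicoid_infinite_index[OF gt[OF A]])
  qed
qed

end
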